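(* Let $\mathcal A=\mathcal B\ltimes_\eta\mathsf F$ be an image-nilpotent $\eta$-extension, and let $(\mathcal X,\mathcal Y)$ be a hereditary complete cotorsion pair in $\mathcal B$. If $L_1\mathsf F(\mathcal X)=0$ and $\mathsf F(\mathcal X)\subseteq\mathcal Y$, then $\bigl({}^{\perp}\mathsf U^{-1}(\mathcal Y),\mathsf U^{-1}(\mathcal Y)\bigr)$ is a hereditary complete cotorsion pair in $\mathcal A$.
   Context: Conventions: abelian categories under consideration (in particular $\mathcal B$ and $\mathcal A$) have enough projective and enough injective objects; subcategories are full, additive and closed under isomorphisms. $L_i\mathsf F$ denotes the $i$-th left derived functor, and $L_1\mathsf F(\mathcal X)=0$ means $L_1\mathsf F(X)=0$ for all $X\in\mathcal X$. Let $\mathcal B$ be an abelian category, $\mathsf F:\mathcal B\to\mathcal B$ a covariant right exact additive functor, and $\eta:\mathsf F^2\to\mathsf F$ a natural transformation that is associative, i.e. $\eta\circ\mathsf F\eta=\eta\circ\eta\mathsf F$. The $\eta$-extension $\mathcal A=\mathcal B\ltimes_\eta\mathsf F$ is the category whose objects are pairs $(B,f)$ with $f:\mathsf F(B)\to B$ satisfying $f\,\mathsf F(f)=f\,\eta_B$, and whose morphisms $(B,f)\to(B',f')$ are morphisms $\alpha:B\to B'$ with $\alpha f=f'\mathsf F(\alpha)$. It is abelian, with exactness detected in $\mathcal B$. $\mathsf U(X,f)=X$ and $\mathsf U^{-1}(\mathcal Y)=\{(Y,g)\in\mathcal A\mid Y\in\mathcal Y\}$. For $A=(B,f)$ with image factorization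 $f=i_Aq_A$ ($q_A:\mathsf F(B)\twoheadrightarrow\operatorname{Im}f$, $i_A:\operatorname{Im}f\rightarrowtail B$), put $\mathsf I(A)=(\operatorname{Im}f,\,q_A\mathsf F(i_A))\in\mathcal A$; $\mathsf I^0(A)=A$, $\mathsf I^{r+1}(A)=\mathsf I(\mathsf I^r(A))$. $\mathcal A$ is image-nilpotent if for every $A\in\mathcal A$ there is $d\ge0$ with $\mathsf I^d(A)=0$. For a class $\mathcal M$ in an abelian category $\mathcal E$: $\mathcal M^\perp=\{N\mid\operatorname{Ext}^1_{\mathcal E}(M,N)=0\ \forall M\in\mathcal M\}$ and ${}^\perp\mathcal M=\{N\mid\operatorname{Ext}^1_{\mathcal E}(N,M)=0\ \forall M\in\mathcal M\}$. $(\mathcal X,\mathcal Y)$ is a cotorsion pair if $\mathcal X={}^\perp\mathcal Y$ and $\mathcal Y=\mathcal X^\perp$; it is complete if every object $E$ admits short exact sequences $0\to Y_E\to X_E\to E\to0$ and $0\to E\to Y^E\to X^E\to0$ with $X_E,X^E\in\mathcal X$ and $Y_E,Y^E\in\mathcal Y$; it is hereditary if $\operatorname{Ext}^i_{\mathcal E}(\mathcal X,\mathcal Y)=0$ for all $i\ge1$. *)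

theory Defs
  imports "HOL-Algebra.Elementary_Groups"
begin

section \<open>Preadditive and abelian categories\<close>

text \<open>
  A category is given by a set of objects and hom-sets indexed by pairs of objects.  Hom-sets are
  not required to be disjoint; ordinary categories with disjoint hom-sets are the special case, and
  the convention allows the morphisms of an $\eta$-extension to be literally morphisms of the base
  category.  Every notion below mentions source and target explicitly.
\<close>

record ('o, 'm) precat =
  obj :: "'o set"
  homs :: "'o \<Rightarrow> 'o \<Rightarrow> 'm set"
  idm :: "'o \<Rightarrow> 'm"
  cmp :: "'m \<Rightarrow> 'm \<Rightarrow> 'm"  (infixl "\<cdot>\<index>" 70)
  madd :: "'m \<Rightarrow> 'm \<Rightarrow> 'm"
  zerom :: "'o \<Rightarrow> 'o \<Rightarrow> 'm"

definition hom_group :: "('o, 'm, 'x) precat_scheme \<Rightarrow> 'o \<Rightarrow> 'o \<Rightarrow> 'm monoid" where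
  "hom_group C X Y = \<lparr>carrier = homs C X Y, mult = madd C, one = zerom C X Y\<rparr>"

locale category =
  fixes C :: "('o, 'm, 'x) precat_scheme" (structure)
  assumes id_in: "X \<in> obj C \<Longrightarrow> idm C X \<in> homs C X X"
    and comp_in: "\<lbrakk>X \<in> obj C; Y \<in> obj C; Z \<in> obj C; f \<in> homs C X Y; g \<in> homs C Y Z\<rbrakk>
      \<Longrightarrow> g \<cdot> f \<in> homs C X Z"
    and comp_id_right: "\<lbrakk>X \<in> obj C; Y \<in> obj C; f \<in> homs C X Y\<rbrakk> \<Longrightarrow> f \<cdot> idm C X = f"
    and comp_id_left: "\<lbrakk>X \<in> obj C; Y \<in> obj C; f \<in> homs C X Y\<rbrakk> \<Longrightarrow> idm C Y \<cdot> f = f"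
    and comp_assoc: "\<lbrakk>W \<in> obj C; X \<in> obj C; Y \<in> obj C; Z \<in> obj C;
        f \<in> homs C W X; g \<in> homs C X Y; h \<in> homs C Y Z\<rbrakk>
      \<Longrightarrow> h \<cdot> (g \<cdot> f) = (h \<cdot> g) \<cdot> f"

locale preadditive_category = category +
  assumes hom_comm_group: "\<lbrakk>X \<in> obj C; Y \<in> obj C\<rbrakk> \<Longrightarrow> comm_group (hom_group C X Y)"
    and comp_add_left: "\<lbrakk>X \<in> obj C; Y \<in> obj C; Z \<in> obj C;
        f \<in> homs C X Y; g \<in> homs C Y Z; g' \<in> homs C Y Z\<rbrakk>
      \<Longrightarrow> madd C g g' \<cdot> f = madd C (g \<cdot> f) (g' \<cdot> f)"
    and comp_add_right: "\<lbrakk>X \<in> obj C; Y \<in> obj C; Z \<in> obj C;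
        f \<in> homs C X Y; f' \<in> homs C X Y; g \<in> homs C Y Z\<rbrakk>
      \<Longrightarrow> g \<cdot> madd C f f' = madd C (g \<cdot> f) (g \<cdot> f')"

definition is_zero :: "('o, 'm, 'x) precat_scheme \<Rightarrow> 'o \<Rightarrow> bool" where
  "is_zero C Z \<longleftrightarrow> Z \<in> obj C \<and>
     (\<forall>X\<in>obj C. (\<exists>!f. f \<in> homs C Z X) \<and> (\<exists>!f. f \<in> homs C X Z))"

definition is_biproduct ::
  "('o, 'm, 'x) precat_scheme \<Rightarrow> 'o \<Rightarrow> 'o \<Rightarrow> 'o \<Rightarrow> 'm \<Rightarrow> 'm \<Rightarrow> 'm \<Rightarrow> 'm \<Rightarrow> bool" where
  "is_biproduct C X Y S i j p q \<longleftrightarrow>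
     S \<in> obj C \<and> i \<in> homs C X S \<and> j \<in> homs C Y S \<and> p \<in> homs C S X \<and> q \<in> homs C S Y \<and>
     p \<cdot>\<^bsub>C\<^esub> i = idm C X \<and> q \<cdot>\<^bsub>C\<^esub> j = idm C Y \<and>
     p \<cdot>\<^bsub>C\<^esub> j = zerom C Y X \<and> q \<cdot>\<^bsub>C\<^esub> i = zerom C X Y \<and>
     madd C (i \<cdot>\<^bsub>C\<^esub> p) (j \<cdot>\<^bsub>C\<^esub> q) = idm C S"

definition is_mono :: "('o, 'm, 'x) precat_scheme \<Rightarrow> 'o \<Rightarrow> 'o \<Rightarrow> 'm \<Rightarrow> bool" where
  "is_mono C X Y f \<longleftrightarrow> X \<in> obj C \<and> Y \<in> obj C \<and> f \<in> homs C X Y \<and>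
     (\<forall>T\<in>obj C. \<forall>u\<in>homs C T X. \<forall>v\<in>homs C T X. f \<cdot>\<^bsub>C\<^esub> u = f \<cdot>\<^bsub>C\<^esub> v \<longrightarrow> u = v)"

definition is_epi :: "('o, 'm, 'x) precat_scheme \<Rightarrow> 'o \<Rightarrow> 'o \<Rightarrow> 'm \<Rightarrow> bool" where
  "is_epi C X Y f \<longleftrightarrow> X \<in> obj C \<and> Y \<in> obj C \<and> f \<in> homs C X Y \<and>
     (\<forall>T\<in>obj C. \<forall>u\<in>homs C Y T. \<forall>v\<in>homs C Y T. u \<cdot>\<^bsub>C\<^esub> f = v \<cdot>\<^bsub>C\<^esub> f \<longrightarrow> u = v)"

definition is_kernel ::
  "('o, 'm, 'x) precat_scheme \<Rightarrow> 'o \<Rightarrow> 'o \<Rightarrow> 'm \<Rightarrow> 'o \<Rightarrow> 'm \<Rightarrow> bool" where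
  "is_kernel C X Y f K k \<longleftrightarrow>
     X \<in> obj C \<and> Y \<in> obj C \<and> f \<in> homs C X Y \<and> K \<in> obj C \<and> k \<in> homs C K X \<and>
     f \<cdot>\<^bsub>C\<^esub> k = zerom C K Y \<and>
     (\<forall>T\<in>obj C. \<forall>t\<in>homs C T X. f \<cdot>\<^bsub>C\<^esub> t = zerom C T Y \<longrightarrow>
        (\<exists>!u. u \<in> homs C T K \<and> k \<cdot>\<^bsub>C\<^esub> u = t))"

definition is_cokernel ::
  "('o, 'm, 'x) precat_scheme \<Rightarrow> 'o \<Rightarrow> 'o \<Rightarrow> 'm \<Rightarrow> 'o \<Rightarrow> 'm \<Rightarrow> bool" where
  "is_cokernel C X Y f Q c \<longleftrightarrow>
     X \<in> obj C \<and> Y \<in> obj C \<and> f \<in> homs C X Y \<and> Q \<in> obj C \<and> c \<in> homs C Y Q \<and>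
     c \<cdot>\<^bsub>C\<^esub> f = zerom C X Q \<and>
     (\<forall>T\<in>obj C. \<forall>t\<in>homs C Y T. t \<cdot>\<^bsub>C\<^esub> f = zerom C X T \<longrightarrow>
        (\<exists>!u. u \<in> homs C Q T \<and> u \<cdot>\<^bsub>C\<^esub> c = t))"

locale abelian_category = preadditive_category +
  assumes zero_exists: "\<exists>Z. is_zero C Z"
    and biproduct_exists: "\<lbrakk>X \<in> obj C; Y \<in> obj C\<rbrakk> \<Longrightarrow> \<exists>S i j p q. is_biproduct C X Y S i j p q"
    and kernel_exists: "\<lbrakk>X \<in> obj C; Y \<in> obj C; f \<in> homs C X Y\<rbrakk> \<Longrightarrow> \<exists>K k. is_kernel C X Y f K k"
    and cokernel_exists: "\<lbrakk>X \<in> obj C; Y \<in> obj C; f \<in> homs C X Y\<rbrakk> \<Longrightarrow> \<exists>Q c. is_cokernel C X Y f Q c"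
    and mono_is_kernel: "is_mono C X Y f \<Longrightarrow> \<exists>Z g. is_kernel C Y Z g X f"
    and epi_is_cokernel: "is_epi C X Y f \<Longrightarrow> \<exists>W g. is_cokernel C W X g Y f"

text \<open>In an abelian category an image factorization is a factorization into an epimorphism
  followed by a monomorphism.\<close>

definition image_factorization ::
  "('o, 'm, 'x) precat_scheme \<Rightarrow> 'o \<Rightarrow> 'o \<Rightarrow> 'm \<Rightarrow> 'o \<Rightarrow> 'm \<Rightarrow> 'm \<Rightarrow> bool" where
  "image_factorization C X Y f J q i \<longleftrightarrow>
     is_epi C X J q \<and> is_mono C J Y i \<and> f = i \<cdot>\<^bsub>C\<^esub> q"

text \<open>Exactness at Y of X --f--> Y --g--> Z: the image of f is a kernel of g.\<close>

definition exact_at ::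
  "('o, 'm, 'x) precat_scheme \<Rightarrow> 'o \<Rightarrow> 'o \<Rightarrow> 'o \<Rightarrow> 'm \<Rightarrow> 'm \<Rightarrow> bool" where
  "exact_at C X Y Z f g \<longleftrightarrow>
     (\<exists>J q i. image_factorization C X Y f J q i \<and> is_kernel C Y Z g J i)"

definition short_exact ::
  "('o, 'm, 'x) precat_scheme \<Rightarrow> 'o \<Rightarrow> 'o \<Rightarrow> 'o \<Rightarrow> 'm \<Rightarrow> 'm \<Rightarrow> bool" where
  "short_exact C X Y Z f g \<longleftrightarrow> is_mono C X Y f \<and> exact_at C X Y Z f g \<and> is_epi C Y Z g"

definition is_projective :: "('o, 'm, 'x) precat_scheme \<Rightarrow> 'o \<Rightarrow> bool" where
  "is_projective C P \<longleftrightarrow> P \<in> obj C \<and>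
     (\<forall>X Y e. is_epi C X Y e \<longrightarrow> (\<forall>f\<in>homs C P Y. \<exists>h\<in>homs C P X. e \<cdot>\<^bsub>C\<^esub> h = f))"

definition is_injective :: "('o, 'm, 'x) precat_scheme \<Rightarrow> 'o \<Rightarrow> bool" where
  "is_injective C E \<longleftrightarrow> E \<in> obj C \<and>
     (\<forall>X Y m. is_mono C X Y m \<longrightarrow> (\<forall>f\<in>homs C X E. \<exists>h\<in>homs C Y E. h \<cdot>\<^bsub>C\<^esub> m = f))"

definition enough_projectives :: "('o, 'm, 'x) precat_scheme \<Rightarrow> bool" where
  "enough_projectives C \<longleftrightarrow> (\<forall>X\<in>obj C. \<exists>P e. is_projective C P \<and> is_epi C P X e)"

definition enough_injectives :: "('o, 'm, 'x) precat_scheme \<Rightarrow> bool" where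
  "enough_injectives C \<longleftrightarrow> (\<forall>X\<in>obj C. \<exists>E m. is_injective C E \<and> is_mono C X E m)"


section \<open>Functors and natural transformations\<close>

record ('o, 'm, 'p, 'n) fctr =
  on_obj :: "'o \<Rightarrow> 'p"
  on_mor :: "'m \<Rightarrow> 'n"

definition comp_fctr ::
  "('p, 'n, 'q, 'k) fctr \<Rightarrow> ('o, 'm, 'p, 'n) fctr \<Rightarrow> ('o, 'm, 'q, 'k) fctr" where
  "comp_fctr G F = \<lparr>on_obj = on_obj G \<circ> on_obj F, on_mor = on_mor G \<circ> on_mor F\<rparr>"

locale additive_functor =
  fixes C :: "('o, 'm, 'x) precat_scheme" and D :: "('p, 'n, 'y) precat_scheme"
    and F :: "('o, 'm, 'p, 'n) fctr"
  assumes F_obj: "X \<in> obj C \<Longrightarrow> on_obj F X \<in> obj D"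
    and F_mor: "\<lbrakk>X \<in> obj C; Y \<in> obj C; f \<in> homs C X Y\<rbrakk>
      \<Longrightarrow> on_mor F f \<in> homs D (on_obj F X) (on_obj F Y)"
    and F_id: "X \<in> obj C \<Longrightarrow> on_mor F (idm C X) = idm D (on_obj F X)"
    and F_comp: "\<lbrakk>X \<in> obj C; Y \<in> obj C; Z \<in> obj C; f \<in> homs C X Y; g \<in> homs C Y Z\<rbrakk>
      \<Longrightarrow> on_mor F (g \<cdot>\<^bsub>C\<^esub> f) = on_mor F g \<cdot>\<^bsub>D\<^esub> on_mor F f"
    and F_add: "\<lbrakk>X \<in> obj C; Y \<in> obj C; f \<in> homs C X Y; g \<in> homs C X Y\<rbrakk>
      \<Longrightarrow> on_mor F (madd C f g) = madd D (on_mor F f) (on_mor F g)"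

locale right_exact_functor = additive_functor +
  assumes F_right_exact: "short_exact C X Y Z f g \<Longrightarrow>
      exact_at D (on_obj F X) (on_obj F Y) (on_obj F Z) (on_mor F f) (on_mor F g) \<and>
      is_epi D (on_obj F Y) (on_obj F Z) (on_mor F g)"

definition natural_transformation ::
  "('o, 'm, 'x) precat_scheme \<Rightarrow> ('p, 'n, 'y) precat_scheme \<Rightarrow>
   ('o, 'm, 'p, 'n) fctr \<Rightarrow> ('o, 'm, 'p, 'n) fctr \<Rightarrow> ('o \<Rightarrow> 'n) \<Rightarrow> bool" where
  "natural_transformation C D F G \<eta> \<longleftrightarrow>
     (\<forall>X\<in>obj C. \<eta> X \<in> homs D (on_obj F X) (on_obj G X)) \<and>
     (\<forall>X\<in>obj C. \<forall>Y\<in>obj C. \<forall>f\<in>homs C X Y.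
        \<eta> Y \<cdot>\<^bsub>D\<^esub> on_mor F f = on_mor G f \<cdot>\<^bsub>D\<^esub> \<eta> X)"


section \<open>Derived functors\<close>

text \<open>A projective resolution of M is a triple (P, d, e) with d n : P (n+1) \<rightarrow> P n and augmentation
  e : P 0 \<rightarrow> M.\<close>

definition is_projective_resolution ::
  "('o, 'm, 'x) precat_scheme \<Rightarrow> 'o \<Rightarrow> (nat \<Rightarrow> 'o) \<times> (nat \<Rightarrow> 'm) \<times> 'm \<Rightarrow> bool" where
  "is_projective_resolution C M = (\<lambda>(P, d, e).
     (\<forall>n. is_projective C (P n)) \<and> is_epi C (P 0) M e \<and>
     exact_at C (P (Suc 0)) (P 0) M (d 0) e \<and>
     (\<forall>n. exact_at C (P (Suc (Suc n))) (P (Suc n)) (P n) (d (Suc n)) (d n)))"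

text \<open>The derived functors are computed from one chosen resolution for every object; a resolution
  exists in every abelian category with enough projectives.\<close>

definition proj_res ::
  "('o, 'm, 'x) precat_scheme \<Rightarrow> 'o \<Rightarrow> (nat \<Rightarrow> 'o) \<times> (nat \<Rightarrow> 'm) \<times> 'm" where
  "proj_res C M = (SOME R. is_projective_resolution C M R)"

definition zero_object :: "('o, 'm, 'x) precat_scheme \<Rightarrow> 'o" where
  "zero_object C = (SOME Z. is_zero C Z)"

text \<open>Homology Ker g / Im f at Y of a complex X --f--> Y --g--> Z: the cokernel of the morphism
  u : X \<rightarrow> Ker g induced by f.\<close>

definition is_homology ::
  "('o, 'm, 'x) precat_scheme \<Rightarrow> 'o \<Rightarrow> 'o \<Rightarrow> 'o \<Rightarrow> 'm \<Rightarrow> 'm \<Rightarrow> 'o \<Rightarrow> bool" where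
  "is_homology C X Y Z f g H \<longleftrightarrow>
     (\<exists>K k u c. is_kernel C Y Z g K k \<and> u \<in> homs C X K \<and> k \<cdot>\<^bsub>C\<^esub> u = f \<and> is_cokernel C X K u H c)"

definition homology ::
  "('o, 'm, 'x) precat_scheme \<Rightarrow> 'o \<Rightarrow> 'o \<Rightarrow> 'o \<Rightarrow> 'm \<Rightarrow> 'm \<Rightarrow> 'o" where
  "homology C X Y Z f g = (SOME H. is_homology C X Y Z f g H)"

text \<open>The value at M of the n-th left derived functor of F : C \<rightarrow> D.  In degree 0 the complex
  continues with the morphism from F (P 0) to a zero object.\<close>

definition left_derived ::
  "('o, 'm, 'x) precat_scheme \<Rightarrow> ('p, 'n, 'y) precat_scheme \<Rightarrow> ('o, 'm, 'p, 'n) fctr \<Rightarrow>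
   nat \<Rightarrow> 'o \<Rightarrow> 'p" where
  "left_derived C D F n M = (case proj_res C M of (P, d, e) \<Rightarrow>
     (case n of
        0 \<Rightarrow> homology D (on_obj F (P (Suc 0))) (on_obj F (P 0)) (zero_object D)
               (on_mor F (d 0)) (zerom D (on_obj F (P 0)) (zero_object D))
      | Suc m \<Rightarrow> homology D (on_obj F (P (Suc (Suc m)))) (on_obj F (P (Suc m))) (on_obj F (P m))
               (on_mor F (d (Suc m))) (on_mor F (d m))))"

text \<open>The group Ext n M N is the n-th cohomology group of the complex Hom(P, N) for the chosen
  projective resolution P of M.\<close>

definition ext_cocycles ::
  "('o, 'm, 'x) precat_scheme \<Rightarrow> nat \<Rightarrow> 'o \<Rightarrow> 'o \<Rightarrow> 'm set" where
  "ext_cocycles C n M N = (case proj_res C M of (P, d, e) \<Rightarrow>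
     {\<phi> \<in> homs C (P n) N. \<phi> \<cdot>\<^bsub>C\<^esub> d n = zerom C (P (Suc n)) N})"

definition ext_coboundaries ::
  "('o, 'm, 'x) precat_scheme \<Rightarrow> nat \<Rightarrow> 'o \<Rightarrow> 'o \<Rightarrow> 'm set" where
  "ext_coboundaries C n M N = (case proj_res C M of (P, d, e) \<Rightarrow>
     (case n of 0 \<Rightarrow> {zerom C (P 0) N} | Suc m \<Rightarrow> (\<lambda>\<psi>. \<psi> \<cdot>\<^bsub>C\<^esub> d m) ` homs C (P m) N))"

definition Ext :: "('o, 'm, 'x) precat_scheme \<Rightarrow> nat \<Rightarrow> 'o \<Rightarrow> 'o \<Rightarrow> 'm set monoid" where
  "Ext C n M N = (case proj_res C M of (P, d, e) \<Rightarrow>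
     (hom_group C (P n) N)\<lparr>carrier := ext_cocycles C n M N\<rparr> Mod ext_coboundaries C n M N)"


section \<open>Cotorsion pairs\<close>

definition right_perp :: "('o, 'm, 'x) precat_scheme \<Rightarrow> 'o set \<Rightarrow> 'o set" where
  "right_perp C \<M> = {N \<in> obj C. \<forall>M\<in>\<M>. trivial_group (Ext C 1 M N)}"

definition left_perp :: "('o, 'm, 'x) precat_scheme \<Rightarrow> 'o set \<Rightarrow> 'o set" where
  "left_perp C \<M> = {N \<in> obj C. \<forall>M\<in>\<M>. trivial_group (Ext C 1 N M)}"

definition cotorsion_pair :: "('o, 'm, 'x) precat_scheme \<Rightarrow> 'o set \<Rightarrow> 'o set \<Rightarrow> bool" where
  "cotorsion_pair C \<X> \<Y> \<longleftrightarrow>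
     \<X> \<subseteq> obj C \<and> \<Y> \<subseteq> obj C \<and> \<X> = left_perp C \<Y> \<and> \<Y> = right_perp C \<X>"

definition complete_pair :: "('o, 'm, 'x) precat_scheme \<Rightarrow> 'o set \<Rightarrow> 'o set \<Rightarrow> bool" where
  "complete_pair C \<X> \<Y> \<longleftrightarrow> (\<forall>E\<in>obj C.
     (\<exists>Y\<in>\<Y>. \<exists>X\<in>\<X>. \<exists>f g. short_exact C Y X E f g) \<and>
     (\<exists>Y\<in>\<Y>. \<exists>X\<in>\<X>. \<exists>f g. short_exact C E Y X f g))"

definition hereditary_pair :: "('o, 'm, 'x) precat_scheme \<Rightarrow> 'o set \<Rightarrow> 'o set \<Rightarrow> bool" where
  "hereditary_pair C \<X> \<Y> \<longleftrightarrow> (\<forall>i\<ge>1. \<forall>X\<in>\<X>. \<forall>Y\<in>\<Y>. trivial_group (Ext C i X Y))"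

definition hereditary_complete_cotorsion_pair ::
  "('o, 'm, 'x) precat_scheme \<Rightarrow> 'o set \<Rightarrow> 'o set \<Rightarrow> bool" where
  "hereditary_complete_cotorsion_pair C \<X> \<Y> \<longleftrightarrow>
     cotorsion_pair C \<X> \<Y> \<and> complete_pair C \<X> \<Y> \<and> hereditary_pair C \<X> \<Y>"


section \<open>The extension of a category along an associative transformation\<close>

definition associative_transformation ::
  "('o, 'm, 'x) precat_scheme \<Rightarrow> ('o, 'm, 'o, 'm) fctr \<Rightarrow> ('o \<Rightarrow> 'm) \<Rightarrow> bool" where
  "associative_transformation B F \<eta> \<longleftrightarrow>
     natural_transformation B B (comp_fctr F F) F \<eta> \<and>
     (\<forall>X\<in>obj B. \<eta> X \<cdot>\<^bsub>B\<^esub> on_mor F (\<eta> X) = \<eta> X \<cdot>\<^bsub>B\<^esub> \<eta> (on_obj F X))"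

definition eta_extension ::
  "('o, 'm, 'x) precat_scheme \<Rightarrow> ('o, 'm, 'o, 'm) fctr \<Rightarrow> ('o \<Rightarrow> 'm) \<Rightarrow> ('o \<times> 'm, 'm) precat" where
  "eta_extension B F \<eta> = \<lparr>
     obj = {(X, f). X \<in> obj B \<and> f \<in> homs B (on_obj F X) X \<and>
                    f \<cdot>\<^bsub>B\<^esub> on_mor F f = f \<cdot>\<^bsub>B\<^esub> \<eta> X},
     homs = (\<lambda>(X, f) (Y, g). {\<alpha> \<in> homs B X Y. \<alpha> \<cdot>\<^bsub>B\<^esub> f = g \<cdot>\<^bsub>B\<^esub> on_mor F \<alpha>}),
     idm = (\<lambda>(X, f). idm B X),
     cmp = cmp B,
     madd = madd B,
     zerom = (\<lambda>(X, f) (Y, g). zerom B X Y)\<rparr>"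

definition U_preimage ::
  "('o, 'm, 'x) precat_scheme \<Rightarrow> ('o, 'm, 'o, 'm) fctr \<Rightarrow> ('o \<Rightarrow> 'm) \<Rightarrow> 'o set \<Rightarrow> ('o \<times> 'm) set" where
  "U_preimage B F \<eta> \<Y> = {(Y, g) \<in> obj (eta_extension B F \<eta>). Y \<in> \<Y>}"

text \<open>The object I(A), computed from one chosen image factorization of the structure morphism of A.\<close>

definition image_object ::
  "('o, 'm, 'x) precat_scheme \<Rightarrow> ('o, 'm, 'o, 'm) fctr \<Rightarrow> 'o \<times> 'm \<Rightarrow> 'o \<times> 'm" where
  "image_object B F = (\<lambda>(X, f).
     case SOME (J, q, i). image_factorization B (on_obj F X) X f J q i of
       (J, q, i) \<Rightarrow> (J, q \<cdot>\<^bsub>B\<^esub> on_mor F i))"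

definition image_nilpotent ::
  "('o, 'm, 'x) precat_scheme \<Rightarrow> ('o, 'm, 'o, 'm) fctr \<Rightarrow> ('o \<Rightarrow> 'm) \<Rightarrow> bool" where
  "image_nilpotent B F \<eta> \<longleftrightarrow>
     (\<forall>A\<in>obj (eta_extension B F \<eta>). \<exists>r. is_zero (eta_extension B F \<eta>) ((image_object B F ^^ r) A))"

end

theory Submission
  imports Defs
begin

text \<open>
  Let T be the left adjoint of U, so that T X = X + F X.  If L_1 F (X) = 0, then T sends a projective
  presentation of X to one of T X, hence Ext^1(T X, A) vanishes iff Ext^1(X, U A) does.  Therefore
  U^{-1}(Y) is the right orthogonal of the objects T X with X in the left class.  Given A = (B, f),
  choose 0 \<rightarrow> Y \<rightarrow> X \<rightarrow> B \<rightarrow> 0 with X and Y in the two classes.  The kernel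
  of the induced epimorphism T X \<rightarrow> A is an extension of F X by Y, so it lies in
  U^{-1}(Y), which gives a special precover of A.  Special preenvelopes follow by Salce's trick, and
  the higher Ext groups vanish by dimension shifting along injectives, because U^{-1}(Y) is closed
  under cokernels of monomorphisms.
\<close>

section \<open>Arrows with source and target\<close>

text \<open>Ext and L_1 F are defined from one chosen resolution per object, and nothing relates the
  resolution chosen for T X in the extension to the one chosen for X in B. So Ext^1 is recast
  without the choice: for an epimorphism from a projective onto M with kernel k, Ext^1(M, N)
  vanishes iff every arrow from the source of k to N extends along k, and comparing two such
  presentations shows that the choice does not matter. The hypothesis on L_1 F makes F k monic, so T
  k is again a kernel, and the adjunction carries the extension problem for T k into N to the one
  for k into U N. That the extension is abelian is proved by hand: the law of an induced structure
  morphism is checked after cancelling a monic k or an epic F (F e), and right exactness of F keeps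
  cokernels. Closure of U^{-1}(Y) under cokernels of monomorphisms is where heredity of the given
  pair enters. As hom-sets may overlap, a bare morphism does not know its endpoints; arrows carry
  them along, so that typing becomes a side condition for the simplifier.\<close>

datatype ('o, 'm) arrow = Arrow (src: 'o) (mor: 'm) (tgt: 'o)

definition arr :: "('o, 'm, 'x) precat_scheme \<Rightarrow> ('o, 'm) arrow \<Rightarrow> bool" where
  "arr C f \<longleftrightarrow> src f \<in> obj C \<and> tgt f \<in> obj C \<and> mor f \<in> homs C (src f) (tgt f)"

text \<open>Composition is total: the outer endpoints are kept and the inner ones are not compared.
  Hence \<open>src\<close> and \<open>tgt\<close> of a composite simplify unconditionally, and
  matching endpoints are demanded only where \<open>arr\<close> is at stake.\<close>

definition acmp :: "('o, 'm, 'x) precat_scheme \<Rightarrow> ('o, 'm) arrow \<Rightarrow> ('o, 'm) arrow \<Rightarrow> ('o, 'm) arrow"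
    (infixl "\<star>\<index>" 70) where
  "g \<star>\<^bsub>C\<^esub> f = Arrow (src f) (mor g \<cdot>\<^bsub>C\<^esub> mor f) (tgt g)"

definition aplus :: "('o, 'm, 'x) precat_scheme \<Rightarrow> ('o, 'm) arrow \<Rightarrow> ('o, 'm) arrow \<Rightarrow> ('o, 'm) arrow"
    (infixl "\<boxplus>\<index>" 65) where
  "f \<boxplus>\<^bsub>C\<^esub> g = Arrow (src f) (madd C (mor f) (mor g)) (tgt f)"

definition aneg :: "('o, 'm, 'x) precat_scheme \<Rightarrow> ('o, 'm) arrow \<Rightarrow> ('o, 'm) arrow" where
  "aneg C f = Arrow (src f) (inv\<^bsub>hom_group C (src f) (tgt f)\<^esub> mor f) (tgt f)"

definition azero :: "('o, 'm, 'x) precat_scheme \<Rightarrow> 'o \<Rightarrow> 'o \<Rightarrow> ('o, 'm) arrow" where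
  "azero C X Y = Arrow X (zerom C X Y) Y"

definition aid :: "('o, 'm, 'x) precat_scheme \<Rightarrow> 'o \<Rightarrow> ('o, 'm) arrow" where
  "aid C X = Arrow X (idm C X) X"

definition monic :: "('o, 'm, 'x) precat_scheme \<Rightarrow> ('o, 'm) arrow \<Rightarrow> bool" where
  "monic C f \<longleftrightarrow> is_mono C (src f) (tgt f) (mor f)"

definition epic :: "('o, 'm, 'x) precat_scheme \<Rightarrow> ('o, 'm) arrow \<Rightarrow> bool" where
  "epic C f \<longleftrightarrow> is_epi C (src f) (tgt f) (mor f)"

definition ker :: "('o, 'm, 'x) precat_scheme \<Rightarrow> ('o, 'm) arrow \<Rightarrow> ('o, 'm) arrow \<Rightarrow> bool" where
  "ker C f k \<longleftrightarrow> tgt k = src f \<and> is_kernel C (src f) (tgt f) (mor f) (src k) (mor k)"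

definition coker :: "('o, 'm, 'x) precat_scheme \<Rightarrow> ('o, 'm) arrow \<Rightarrow> ('o, 'm) arrow \<Rightarrow> bool" where
  "coker C f c \<longleftrightarrow> src c = tgt f \<and> is_cokernel C (src f) (tgt f) (mor f) (tgt c) (mor c)"

definition exact :: "('o, 'm, 'x) precat_scheme \<Rightarrow> ('o, 'm) arrow \<Rightarrow> ('o, 'm) arrow \<Rightarrow> bool" where
  "exact C f g \<longleftrightarrow> tgt f = src g \<and> exact_at C (src f) (tgt f) (tgt g) (mor f) (mor g)"

definition ses :: "('o, 'm, 'x) precat_scheme \<Rightarrow> ('o, 'm) arrow \<Rightarrow> ('o, 'm) arrow \<Rightarrow> bool" where
  "ses C f g \<longleftrightarrow> tgt f = src g \<and> short_exact C (src f) (tgt f) (tgt g) (mor f) (mor g)"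

lemma src_acmp [simp]: "src (g \<star>\<^bsub>C\<^esub> f) = src f"
  and tgt_acmp [simp]: "tgt (g \<star>\<^bsub>C\<^esub> f) = tgt g"
  and src_aplus [simp]: "src (f \<boxplus>\<^bsub>C\<^esub> g) = src f"
  and tgt_aplus [simp]: "tgt (f \<boxplus>\<^bsub>C\<^esub> g) = tgt f"
  and src_aneg [simp]: "src (aneg C f) = src f"
  and tgt_aneg [simp]: "tgt (aneg C f) = tgt f"
  and src_azero [simp]: "src (azero C X Y) = X"
  and tgt_azero [simp]: "tgt (azero C X Y) = Y"
  and src_aid [simp]: "src (aid C X) = X"
  and tgt_aid [simp]: "tgt (aid C X) = X"
  by (simp_all add: acmp_def aplus_def aneg_def azero_def aid_def)

lemma arr_src [simp]: "arr C f \<Longrightarrow> src f \<in> obj C"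
  and arr_tgt [simp]: "arr C f \<Longrightarrow> tgt f \<in> obj C"
  and arr_mor: "arr C f \<Longrightarrow> mor f \<in> homs C (src f) (tgt f)"
  by (simp_all add: arr_def)

context category
begin

lemma arr_acmp [simp]: "\<lbrakk>arr C f; arr C g; tgt f = src g\<rbrakk> \<Longrightarrow> arr C (g \<star> f)"
  unfolding arr_def acmp_def by (auto intro: comp_in)

lemma arr_aid [simp]: "X \<in> obj C \<Longrightarrow> arr C (aid C X)"
  unfolding arr_def aid_def by (auto intro: id_in)

lemma acmp_assoc [simp]:
  "\<lbrakk>arr C f; arr C g; arr C h; tgt f = src g; tgt g = src h\<rbrakk> \<Longrightarrow> (h \<star> g) \<star> f = h \<star> (g \<star> f)"
  unfolding arr_def acmp_def by (auto simp: comp_assoc)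

lemma acmp_aid_right [simp]: "\<lbrakk>arr C f; src f = X\<rbrakk> \<Longrightarrow> f \<star> aid C X = f"
  by (cases f) (auto simp: arr_def acmp_def aid_def comp_id_right simp del: arr_src arr_tgt)

lemma acmp_aid_left [simp]: "\<lbrakk>arr C f; tgt f = X\<rbrakk> \<Longrightarrow> aid C X \<star> f = f"
  by (cases f) (auto simp: arr_def acmp_def aid_def comp_id_left simp del: arr_src arr_tgt)

lemma monicD [simp]: "monic C f \<Longrightarrow> arr C f"
  by (simp add: monic_def is_mono_def arr_def del: arr_src arr_tgt)

lemma epicD [simp]: "epic C f \<Longrightarrow> arr C f"
  by (simp add: epic_def is_epi_def arr_def del: arr_src arr_tgt)

text \<open>This moves cancellation from bare morphisms with named objects to arrows, so that later
  arguments need not unfold \<open>is_mono\<close>.\<close>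

lemma monic_iff:
  "monic C f \<longleftrightarrow> arr C f \<and>
     (\<forall>u v. arr C u \<longrightarrow> arr C v \<longrightarrow> src u = src v \<longrightarrow> tgt u = src f \<longrightarrow> tgt v = src f \<longrightarrow>
        f \<star> u = f \<star> v \<longrightarrow> u = v)"
proof
  assume L: "monic C f"
  show "arr C f \<and> (\<forall>u v. arr C u \<longrightarrow> arr C v \<longrightarrow> src u = src v \<longrightarrow> tgt u = src f \<longrightarrow> tgt v = src f \<longrightarrow>
        f \<star> u = f \<star> v \<longrightarrow> u = v)"
  proof (intro conjI allI impI)
    show "arr C f" using L by simp
    fix u v assume *: "arr C u" "arr C v" "src u = src v" "tgt u = src f" "tgt v = src f" "f \<star> u = f \<star> v"
    have "mor f \<cdot> mor u = mor f \<cdot> mor v" using *(6) by (simp add: acmp_def)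
    hence "mor u = mor v" using L * unfolding monic_def is_mono_def arr_def by metis
    thus "u = v" using * by (simp add: arrow.expand)
  qed
next
  assume R: "arr C f \<and> (\<forall>u v. arr C u \<longrightarrow> arr C v \<longrightarrow> src u = src v \<longrightarrow> tgt u = src f \<longrightarrow> tgt v = src f \<longrightarrow>
        f \<star> u = f \<star> v \<longrightarrow> u = v)"
  hence fa: "arr C f" ..
  show "monic C f"
    unfolding monic_def is_mono_def
  proof (intro conjI ballI impI)
    show "src f \<in> obj C" "tgt f \<in> obj C" "mor f \<in> homs C (src f) (tgt f)" using fa by (simp_all add: arr_def del: arr_src arr_tgt)
    fix T u v assume *: "T \<in> obj C" "u \<in> homs C T (src f)" "v \<in> homs C T (src f)" "mor f \<cdot> u = mor f \<cdot> v"
    have "Arrow T u (src f) = Arrow T v (src f)"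
      by (rule R[THEN conjunct2, rule_format]) (use * fa in \<open>simp_all add: arr_def acmp_def del: arr_src arr_tgt\<close>)
    thus "u = v" by simp
  qed
qed

lemma epic_iff:
  "epic C f \<longleftrightarrow> arr C f \<and>
     (\<forall>u v. arr C u \<longrightarrow> arr C v \<longrightarrow> tgt u = tgt v \<longrightarrow> src u = tgt f \<longrightarrow> src v = tgt f \<longrightarrow>
        u \<star> f = v \<star> f \<longrightarrow> u = v)"
proof
  assume L: "epic C f"
  show "arr C f \<and> (\<forall>u v. arr C u \<longrightarrow> arr C v \<longrightarrow> tgt u = tgt v \<longrightarrow> src u = tgt f \<longrightarrow> src v = tgt f \<longrightarrow>
        u \<star> f = v \<star> f \<longrightarrow> u = v)"
  proof (intro conjI allI impI)
    show "arr C f" using L by simp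
    fix u v assume *: "arr C u" "arr C v" "tgt u = tgt v" "src u = tgt f" "src v = tgt f" "u \<star> f = v \<star> f"
    have "mor u \<cdot> mor f = mor v \<cdot> mor f" using *(6) by (simp add: acmp_def)
    hence "mor u = mor v" using L * unfolding epic_def is_epi_def arr_def by metis
    thus "u = v" using * by (simp add: arrow.expand)
  qed
next
  assume R: "arr C f \<and> (\<forall>u v. arr C u \<longrightarrow> arr C v \<longrightarrow> tgt u = tgt v \<longrightarrow> src u = tgt f \<longrightarrow> src v = tgt f \<longrightarrow>
        u \<star> f = v \<star> f \<longrightarrow> u = v)"
  hence fa: "arr C f" ..
  show "epic C f"
    unfolding epic_def is_epi_def
  proof (intro conjI ballI impI)
    show "src f \<in> obj C" "tgt f \<in> obj C" "mor f \<in> homs C (src f) (tgt f)" using fa by (simp_all add: arr_def del: arr_src arr_tgt)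
    fix T u v assume *: "T \<in> obj C" "u \<in> homs C (tgt f) T" "v \<in> homs C (tgt f) T" "u \<cdot> mor f = v \<cdot> mor f"
    have "Arrow (tgt f) u T = Arrow (tgt f) v T"
      by (rule R[THEN conjunct2, rule_format]) (use * fa in \<open>simp_all add: arr_def acmp_def del: arr_src arr_tgt\<close>)
    thus "u = v" by simp
  qed
qed

lemma monic_cancel:
  "\<lbrakk>monic C f; f \<star> u = f \<star> v; arr C u; arr C v; tgt u = src f; tgt v = src f\<rbrakk> \<Longrightarrow> u = v"
  unfolding monic_iff by (metis src_acmp)

lemma epic_cancel:
  "\<lbrakk>epic C f; u \<star> f = v \<star> f; arr C u; arr C v; src u = tgt f; src v = tgt f\<rbrakk> \<Longrightarrow> u = v"
  unfolding epic_iff by (metis tgt_acmp)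

lemma monic_acmp: "\<lbrakk>monic C f; monic C g; tgt f = src g\<rbrakk> \<Longrightarrow> monic C (g \<star> f)"
  unfolding monic_iff[of "g \<star> f"]
  by (smt (verit, ccfv_SIG) acmp_assoc arr_acmp monic_cancel monicD src_acmp tgt_acmp)

lemma epic_acmp: "\<lbrakk>epic C f; epic C g; tgt f = src g\<rbrakk> \<Longrightarrow> epic C (g \<star> f)"
  unfolding epic_iff[of "g \<star> f"]
  by (smt (verit, ccfv_SIG) acmp_assoc arr_acmp epic_cancel epicD src_acmp tgt_acmp)

lemma monic_right: "\<lbrakk>monic C (g \<star> f); arr C f; arr C g; tgt f = src g\<rbrakk> \<Longrightarrow> monic C f"
  unfolding monic_iff by (metis acmp_assoc src_acmp)

lemma epic_left: "\<lbrakk>epic C (g \<star> f); arr C f; arr C g; tgt f = src g\<rbrakk> \<Longrightarrow> epic C g"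
  unfolding epic_iff by (metis acmp_assoc tgt_acmp)

lemma monic_aid [simp]: "X \<in> obj C \<Longrightarrow> monic C (aid C X)"
  unfolding monic_iff by auto

lemma epic_aid [simp]: "X \<in> obj C \<Longrightarrow> epic C (aid C X)"
  unfolding epic_iff by auto

end

section \<open>Arithmetic of arrows; kernels and cokernels in terms of arrow equations\<close>

context preadditive_category
begin

lemma arr_azero [simp]: "\<lbrakk>X \<in> obj C; Y \<in> obj C\<rbrakk> \<Longrightarrow> arr C (azero C X Y)"
  using comm_group.axioms(1)[OF hom_comm_group, of X Y, THEN monoid.one_closed[OF comm_monoid.axioms(1)]]
  by (simp add: arr_def azero_def hom_group_def del: arr_src arr_tgt)

lemma arr_aplus [simp]:
  assumes "arr C f" "arr C g" "src f = src g" "tgt f = tgt g"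
  shows "arr C (f \<boxplus> g)"
proof -
  interpret comm_group "hom_group C (src f) (tgt f)" using assms by (intro hom_comm_group) auto
  show ?thesis using assms m_closed[of "mor f" "mor g"] by (auto simp: arr_def aplus_def hom_group_def simp del: arr_src arr_tgt)
qed

lemma arr_aneg [simp]:
  assumes "arr C f"
  shows "arr C (aneg C f)"
proof -
  interpret comm_group "hom_group C (src f) (tgt f)" using assms by (intro hom_comm_group) auto
  have "mor f \<in> carrier (hom_group C (src f) (tgt f))" using assms by (auto simp: arr_def hom_group_def simp del: arr_src arr_tgt)
  from inv_closed[OF this] have "inv\<^bsub>hom_group C (src f) (tgt f)\<^esub> mor f \<in> homs C (src f) (tgt f)"
    by (simp add: hom_group_def)
  thus ?thesis using assms by (simp add: arr_def aneg_def del: arr_src arr_tgt)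
qed

lemma aplus_comm:
  assumes "arr C f" "arr C g" "src f = src g" "tgt f = tgt g"
  shows "f \<boxplus> g = g \<boxplus> f"
proof -
  interpret comm_group "hom_group C (src f) (tgt f)" using assms by (intro hom_comm_group) auto
  show ?thesis using assms m_comm[of "mor f" "mor g"] by (auto simp: arr_def aplus_def hom_group_def simp del: arr_src arr_tgt)
qed

lemma aplus_assoc:
  assumes "arr C f" "arr C g" "arr C h" "src f = src g" "tgt f = tgt g" "src h = src g" "tgt h = tgt g"
  shows "(f \<boxplus> g) \<boxplus> h = f \<boxplus> (g \<boxplus> h)"
proof -
  interpret comm_group "hom_group C (src f) (tgt f)" using assms by (intro hom_comm_group) auto
  show ?thesis using assms m_assoc[of "mor f" "mor g" "mor h"] by (auto simp: arr_def aplus_def hom_group_def simp del: arr_src arr_tgt)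
qed

lemma aplus_zero_right [simp]:
  assumes "arr C f" "src f = X" "tgt f = Y"
  shows "f \<boxplus> azero C X Y = f"
proof -
  interpret comm_group "hom_group C (src f) (tgt f)" using assms by (intro hom_comm_group) auto
  show ?thesis using assms r_one[of "mor f"] by (cases f) (auto simp: arr_def aplus_def azero_def hom_group_def simp del: arr_src arr_tgt)
qed

lemma aplus_zero_left [simp]:
  assumes "arr C f" "src f = X" "tgt f = Y"
  shows "azero C X Y \<boxplus> f = f"
  using assms aplus_comm[of "azero C X Y" f] by auto

lemma aplus_aneg_right [simp]:
  assumes "arr C f"
  shows "f \<boxplus> aneg C f = azero C (src f) (tgt f)"
proof -
  interpret comm_group "hom_group C (src f) (tgt f)" using assms by (intro hom_comm_group) auto
  show ?thesis using assms r_inv[of "mor f"]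
    by (auto simp: arr_def aplus_def azero_def aneg_def hom_group_def simp del: arr_src arr_tgt)
qed

lemma aplus_aneg_left [simp]: "arr C f \<Longrightarrow> aneg C f \<boxplus> f = azero C (src f) (tgt f)"
  by (subst aplus_comm) auto

lemma aplus_aneg_eq_zero:
  assumes "arr C f" "arr C g" "src f = src g" "tgt f = tgt g"
  shows "f \<boxplus> aneg C g = azero C (src g) (tgt g) \<longleftrightarrow> f = g"
proof
  assume *: "f \<boxplus> aneg C g = azero C (src g) (tgt g)"
  have "f = f \<boxplus> (aneg C g \<boxplus> g)" using assms by simp
  also have "\<dots> = (f \<boxplus> aneg C g) \<boxplus> g" using assms by (subst aplus_assoc) auto
  also have "\<dots> = g" using assms by (simp add: *)
  finally show "f = g" .
qed (use assms in simp)

lemma aplus_cancel: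
  assumes "f \<boxplus> g = f \<boxplus> h" "arr C f" "arr C g" "arr C h" "src f = src g" "tgt f = tgt g" "src h = src g" "tgt h = tgt g"
  shows "g = h"
proof -
  have "aneg C f \<boxplus> (f \<boxplus> g) = aneg C f \<boxplus> (f \<boxplus> h)" using assms by simp
  moreover have "aneg C f \<boxplus> (f \<boxplus> g) = g" "aneg C f \<boxplus> (f \<boxplus> h) = h"
    using assms by (subst aplus_assoc[symmetric]; simp)+
  ultimately show ?thesis by simp
qed

lemma aplus_acmp [simp]:
  "\<lbrakk>arr C f; arr C g; arr C h; src g = src h; tgt g = tgt h; tgt f = src h\<rbrakk>
     \<Longrightarrow> (g \<boxplus> h) \<star> f = (g \<star> f) \<boxplus> (h \<star> f)"
  unfolding arr_def aplus_def acmp_def by (auto intro!: comp_add_left[of "src f" "src h" "tgt h"])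

lemma acmp_aplus [simp]:
  "\<lbrakk>arr C f; arr C g; arr C h; src g = src h; tgt g = tgt h; tgt g = src f\<rbrakk>
     \<Longrightarrow> f \<star> (g \<boxplus> h) = (f \<star> g) \<boxplus> (f \<star> h)"
  unfolding arr_def aplus_def acmp_def by (auto intro!: comp_add_right[of "src h" "src f" "tgt f"])

lemma aplus_idem:
  assumes "f \<boxplus> f = f" "arr C f"
  shows "f = azero C (src f) (tgt f)"
  using assms by (intro aplus_cancel[of f f]) simp_all

text \<open>By additivity the composite equals its own double, and in a group only zero
  does.\<close>

lemma acmp_azero [simp]:
  assumes "arr C f" "X \<in> obj C" "src f = Y"
  shows "f \<star> azero C X Y = azero C X (tgt f)"
proof -
  have "f \<star> azero C X Y \<boxplus> f \<star> azero C X Y = f \<star> (azero C X Y \<boxplus> azero C X Y)"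
    using assms by (intro acmp_aplus[symmetric]) auto
  also have "\<dots> = f \<star> azero C X Y" using assms by (subst aplus_zero_right) auto
  finally show ?thesis using aplus_idem assms by fastforce
qed

lemma azero_acmp [simp]:
  assumes "arr C f" "Y \<in> obj C" "tgt f = X"
  shows "azero C X Y \<star> f = azero C (src f) Y"
proof -
  have "azero C X Y \<star> f \<boxplus> azero C X Y \<star> f = (azero C X Y \<boxplus> azero C X Y) \<star> f"
    using assms by (intro aplus_acmp[symmetric]) auto
  also have "\<dots> = azero C X Y \<star> f" using assms by (subst aplus_zero_right) auto
  finally show ?thesis using aplus_idem assms by fastforce
qed

lemma aneg_unique:
  assumes "f \<boxplus> g = azero C (src f) (tgt f)" "arr C f" "arr C g" "src f = src g" "tgt f = tgt g"
  shows "g = aneg C f"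
  by (rule aplus_cancel[of f]) (use assms in simp_all)

lemma acmp_aneg [simp]:
  assumes "arr C f" "arr C g" "tgt g = src f"
  shows "f \<star> aneg C g = aneg C (f \<star> g)"
proof (rule aneg_unique)
  have "f \<star> g \<boxplus> f \<star> aneg C g = f \<star> (g \<boxplus> aneg C g)"
    using assms by (subst acmp_aplus) auto
  thus "f \<star> g \<boxplus> f \<star> aneg C g = azero C (src (f \<star> g)) (tgt (f \<star> g))"
    using assms by simp
qed (use assms in auto)

lemma aneg_acmp [simp]:
  assumes "arr C f" "arr C g" "tgt g = src f"
  shows "aneg C f \<star> g = aneg C (f \<star> g)"
proof (rule aneg_unique)
  have "f \<star> g \<boxplus> aneg C f \<star> g = (f \<boxplus> aneg C f) \<star> g"
    using assms by (subst aplus_acmp) auto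
  thus "f \<star> g \<boxplus> aneg C f \<star> g = azero C (src (f \<star> g)) (tgt (f \<star> g))"
    using assms by simp
qed (use assms in auto)

lemma aneg_azero [simp]: "\<lbrakk>X \<in> obj C; Y \<in> obj C\<rbrakk> \<Longrightarrow> aneg C (azero C X Y) = azero C X Y"
  by (rule aneg_unique[symmetric]) auto

lemma aneg_aneg [simp]: "arr C f \<Longrightarrow> aneg C (aneg C f) = f"
  by (rule aneg_unique[symmetric]) auto

text \<open>Subtraction turns the cancellation of u against v into the zero test for u - v.\<close>

lemma monic_iff_zero:
  "monic C f \<longleftrightarrow> arr C f \<and>
     (\<forall>u. arr C u \<longrightarrow> tgt u = src f \<longrightarrow> f \<star> u = azero C (src u) (tgt f) \<longrightarrow> u = azero C (src u) (src f))"
  (is "_ \<longleftrightarrow> ?R")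
proof
  assume "monic C f"
  thus ?R by (intro conjI allI impI, simp, rule monic_cancel[of f]) simp_all
next
  assume R: ?R
  hence f: "arr C f" ..
  show "monic C f" unfolding monic_iff
  proof (intro conjI allI impI)
    fix u v assume *: "arr C u" "arr C v" "src u = src v" "tgt u = src f" "tgt v = src f" "f \<star> u = f \<star> v"
    have "f \<star> (u \<boxplus> aneg C v) = azero C (src u) (tgt f)"
      using * f by simp
    hence "u \<boxplus> aneg C v = azero C (src (u \<boxplus> aneg C v)) (src f)"
      by (intro R[THEN conjunct2, rule_format]) (use * f in simp_all)
    thus "u = v" using * aplus_aneg_eq_zero[of u v] by simp
  qed (rule f)
qed

lemma epic_iff_zero:
  "epic C f \<longleftrightarrow> arr C f \<and>
     (\<forall>u. arr C u \<longrightarrow> src u = tgt f \<longrightarrow> u \<star> f = azero C (src f) (tgt u) \<longrightarrow> u = azero C (tgt f) (tgt u))"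
  (is "_ \<longleftrightarrow> ?R")
proof
  assume "epic C f"
  thus ?R by (intro conjI allI impI, simp, rule epic_cancel[of f]) simp_all
next
  assume R: ?R
  hence f: "arr C f" ..
  show "epic C f" unfolding epic_iff
  proof (intro conjI allI impI)
    fix u v assume *: "arr C u" "arr C v" "tgt u = tgt v" "src u = tgt f" "src v = tgt f" "u \<star> f = v \<star> f"
    have "(u \<boxplus> aneg C v) \<star> f = azero C (src f) (tgt v)"
      using * f by simp
    hence "u \<boxplus> aneg C v = azero C (tgt f) (tgt (u \<boxplus> aneg C v))"
      by (intro R[THEN conjunct2, rule_format]) (use * f in simp_all)
    thus "u = v" using * aplus_aneg_eq_zero[of u v] by simp
  qed (rule f)
qed

lemma monic_zeroD:
  "\<lbrakk>monic C f; f \<star> u = azero C T Y; arr C u; tgt u = src f\<rbrakk> \<Longrightarrow> u = azero C (src u) (src f)"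
  unfolding monic_iff_zero by (metis src_acmp src_azero tgt_acmp tgt_azero)

lemma epic_zeroD:
  "\<lbrakk>epic C f; u \<star> f = azero C X T; arr C u; src u = tgt f\<rbrakk> \<Longrightarrow> u = azero C (tgt f) (tgt u)"
  unfolding epic_iff_zero by (metis src_acmp src_azero tgt_acmp tgt_azero)

text \<open>Two lifts of one arrow through k have the same composite with k, so uniqueness of lifts
  amounts to monicity of k. Separating it from the existence of lifts leaves two properties that can
  be proved and used independently.\<close>

lemma ker_iff:
  "ker C f k \<longleftrightarrow> arr C f \<and> monic C k \<and> tgt k = src f \<and> f \<star> k = azero C (src k) (tgt f) \<and>
     (\<forall>t. arr C t \<longrightarrow> tgt t = src f \<longrightarrow> f \<star> t = azero C (src t) (tgt f) \<longrightarrow>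
        (\<exists>u. arr C u \<and> src u = src t \<and> tgt u = src k \<and> k \<star> u = t))" (is "_ \<longleftrightarrow> ?R")
proof
  assume L: "ker C f k"
  have tk: "tgt k = src f" and K: "is_kernel C (src f) (tgt f) (mor f) (src k) (mor k)"
    using L by (auto simp: ker_def)
  have f: "arr C f" and k: "arr C k" using K unfolding is_kernel_def arr_def tk by blast+
  have "mor f \<cdot> mor k = zerom C (src k) (tgt f)" using K unfolding is_kernel_def by blast
  hence z: "f \<star> k = azero C (src k) (tgt f)" by (simp add: acmp_def azero_def)
  have ex: "\<exists>!u. u \<in> homs C (src t) (src k) \<and> mor k \<cdot> u = mor t"
    if "arr C t" "tgt t = src f" "f \<star> t = azero C (src t) (tgt f)" for t
    using K that arr_mor[OF that(1)] unfolding is_kernel_def acmp_def azero_def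
    by (metis arr_src arrow.inject)
  show ?R
  proof (intro conjI allI impI)
    show "monic C k" unfolding monic_iff
    proof (intro conjI allI impI)
      fix u v assume *: "arr C u" "arr C v" "src u = src v" "tgt u = src k" "tgt v = src k" "k \<star> u = k \<star> v"
      have "f \<star> (k \<star> u) = azero C (src u) (tgt f)"
        using * f k tk z by (simp flip: acmp_assoc)
      hence "\<exists>!w. w \<in> homs C (src u) (src k) \<and> mor k \<cdot> w = mor (k \<star> u)"
        by (intro ex[of "k \<star> u", simplified]) (use * k tk in simp_all)
      moreover have "mor u \<in> homs C (src u) (src k)" "mor v \<in> homs C (src u) (src k)"
        using * arr_mor by metis+
      moreover have "mor k \<cdot> mor u = mor (k \<star> u)" "mor k \<cdot> mor v = mor (k \<star> u)"
        using *(6) by (simp_all add: acmp_def)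
      ultimately have "mor u = mor v" by blast
      thus "u = v" using * by (simp add: arrow.expand)
    qed (rule k)
    fix t assume t: "arr C t" "tgt t = src f" "f \<star> t = azero C (src t) (tgt f)"
    then obtain u where "u \<in> homs C (src t) (src k)" "mor k \<cdot> u = mor t" using ex by blast
    thus "\<exists>u. arr C u \<and> src u = src t \<and> tgt u = src k \<and> k \<star> u = t"
      using t k tk by (intro exI[of _ "Arrow (src t) u (src k)"]) (auto simp: arr_def acmp_def simp del: arr_src arr_tgt intro: arrow.expand)
  qed (use f tk z in auto)
next
  assume R: ?R
  hence f: "arr C f" and mk: "monic C k" and tk: "tgt k = src f" and z: "f \<star> k = azero C (src k) (tgt f)"
    and ex: "\<And>t. arr C t \<Longrightarrow> tgt t = src f \<Longrightarrow> f \<star> t = azero C (src t) (tgt f) \<Longrightarrow>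
        (\<exists>u. arr C u \<and> src u = src t \<and> tgt u = src k \<and> k \<star> u = t)"
    by blast+
  note k = monicD[OF mk]
  show "ker C f k" unfolding ker_def is_kernel_def
  proof (intro conjI ballI impI)
    show "mor k \<in> homs C (src k) (src f)" using tk k arr_mor by metis
    show "mor f \<cdot> mor k = zerom C (src k) (tgt f)" using z by (simp add: acmp_def azero_def)
    fix T t assume *: "T \<in> obj C" "t \<in> homs C T (src f)" "mor f \<cdot> t = zerom C T (tgt f)"
    let ?t = "Arrow T t (src f)"
    have "arr C ?t" "f \<star> ?t = azero C (src ?t) (tgt f)" using * f by (auto simp: arr_def acmp_def azero_def simp del: arr_src arr_tgt)
    then obtain u where u: "arr C u" "src u = T" "tgt u = src k" "k \<star> u = ?t"
      using ex[of ?t] by auto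
    show "\<exists>!u. u \<in> homs C T (src k) \<and> mor k \<cdot> u = t"
    proof (intro ex1I[of _ "mor u"] conjI)
      show "mor u \<in> homs C T (src k)" using u arr_mor by metis
      show "mor k \<cdot> mor u = t" using u(4) by (simp add: acmp_def)
      fix v assume v: "v \<in> homs C T (src k) \<and> mor k \<cdot> v = t"
      have "k \<star> Arrow T v (src k) = k \<star> u" using u v by (simp add: acmp_def)
      moreover have "arr C (Arrow T v (src k))" using v k \<open>T \<in> obj C\<close>
        by (simp add: arr_def del: arr_src arr_tgt)
      ultimately have "Arrow T v (src k) = u" using monic_cancel[OF mk] u(1,3) by (metis arrow.sel(3))
      thus "v = mor u" by auto
    qed
  qed (use f k tk in \<open>auto simp: arr_mor\<close>)
qed

lemma coker_iff:
  "coker C f c \<longleftrightarrow> arr C f \<and> epic C c \<and> src c = tgt f \<and> c \<star> f = azero C (src f) (tgt c) \<and>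
     (\<forall>t. arr C t \<longrightarrow> src t = tgt f \<longrightarrow> t \<star> f = azero C (src f) (tgt t) \<longrightarrow>
        (\<exists>u. arr C u \<and> src u = tgt c \<and> tgt u = tgt t \<and> u \<star> c = t))" (is "_ \<longleftrightarrow> ?R")
proof
  assume L: "coker C f c"
  have tk: "src c = tgt f" and K: "is_cokernel C (src f) (tgt f) (mor f) (tgt c) (mor c)"
    using L by (auto simp: coker_def)
  have f: "arr C f" and k: "arr C c" using K unfolding is_cokernel_def arr_def tk by blast+
  have "mor c \<cdot> mor f = zerom C (src f) (tgt c)" using K unfolding is_cokernel_def by blast
  hence z: "c \<star> f = azero C (src f) (tgt c)" by (simp add: acmp_def azero_def)
  have ex: "\<exists>!u. u \<in> homs C (tgt c) (tgt t) \<and> u \<cdot> mor c = mor t"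
    if "arr C t" "src t = tgt f" "t \<star> f = azero C (src f) (tgt t)" for t
    using K that arr_mor[OF that(1)] unfolding is_cokernel_def acmp_def azero_def
    by (metis arr_tgt arrow.inject)
  show ?R
  proof (intro conjI allI impI)
    show "epic C c" unfolding epic_iff
    proof (intro conjI allI impI)
      fix u v assume *: "arr C u" "arr C v" "tgt u = tgt v" "src u = tgt c" "src v = tgt c" "u \<star> c = v \<star> c"
      have "(u \<star> c) \<star> f = azero C (src f) (tgt u)"
        using * f k tk z by simp
      hence "\<exists>!w. w \<in> homs C (tgt c) (tgt u) \<and> w \<cdot> mor c = mor (u \<star> c)"
        by (intro ex[of "u \<star> c", simplified]) (use * k tk in simp_all)
      moreover have "mor u \<in> homs C (tgt c) (tgt u)" "mor v \<in> homs C (tgt c) (tgt u)"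
        using * arr_mor by metis+
      moreover have "mor u \<cdot> mor c = mor (u \<star> c)" "mor v \<cdot> mor c = mor (u \<star> c)"
        using *(6) by (simp_all add: acmp_def)
      ultimately have "mor u = mor v" by blast
      thus "u = v" using * by (simp add: arrow.expand)
    qed (rule k)
    fix t assume t: "arr C t" "src t = tgt f" "t \<star> f = azero C (src f) (tgt t)"
    then obtain u where "u \<in> homs C (tgt c) (tgt t)" "u \<cdot> mor c = mor t" using ex by blast
    thus "\<exists>u. arr C u \<and> src u = tgt c \<and> tgt u = tgt t \<and> u \<star> c = t"
      using t k tk by (intro exI[of _ "Arrow (tgt c) u (tgt t)"]) (auto simp: arr_def acmp_def simp del: arr_src arr_tgt intro: arrow.expand)
  qed (use f tk z in auto)
next
  assume R: ?R
  hence f: "arr C f" and mk: "epic C c" and tk: "src c = tgt f" and z: "c \<star> f = azero C (src f) (tgt c)"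
    and ex: "\<And>t. arr C t \<Longrightarrow> src t = tgt f \<Longrightarrow> t \<star> f = azero C (src f) (tgt t) \<Longrightarrow>
        (\<exists>u. arr C u \<and> src u = tgt c \<and> tgt u = tgt t \<and> u \<star> c = t)"
    by blast+
  note k = epicD[OF mk]
  show "coker C f c" unfolding coker_def is_cokernel_def
  proof (intro conjI ballI impI)
    show "mor c \<in> homs C (tgt f) (tgt c)" using tk k arr_mor by metis
    show "mor c \<cdot> mor f = zerom C (src f) (tgt c)" using z by (simp add: acmp_def azero_def)
    fix T t assume *: "T \<in> obj C" "t \<in> homs C (tgt f) T" "t \<cdot> mor f = zerom C (src f) T"
    let ?t = "Arrow (tgt f) t T"
    have "arr C ?t" "?t \<star> f = azero C (src f) (tgt ?t)" using * f by (auto simp: arr_def acmp_def azero_def simp del: arr_src arr_tgt)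
    then obtain u where u: "arr C u" "tgt u = T" "src u = tgt c" "u \<star> c = ?t"
      using ex[of ?t] by auto
    show "\<exists>!u. u \<in> homs C (tgt c) T \<and> u \<cdot> mor c = t"
    proof (intro ex1I[of _ "mor u"] conjI)
      show "mor u \<in> homs C (tgt c) T" using u arr_mor by metis
      show "mor u \<cdot> mor c = t" using u(4) by (simp add: acmp_def)
      fix v assume v: "v \<in> homs C (tgt c) T \<and> v \<cdot> mor c = t"
      have "Arrow (tgt c) v T \<star> c = u \<star> c" using u v tk by (simp add: acmp_def)
      moreover have "arr C (Arrow (tgt c) v T)" using v k \<open>T \<in> obj C\<close>
        by (simp add: arr_def del: arr_src arr_tgt)
      ultimately have "Arrow (tgt c) v T = u" using epic_cancel[OF mk] u(1,3) by (metis arrow.sel(1))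
      thus "v = mor u" by auto
    qed
  qed (use f k tk in \<open>auto simp: arr_mor\<close>)
qed

lemma kerD:
  assumes "ker C f k"
  shows "arr C f" "monic C k" "tgt k = src f" "f \<star> k = azero C (src k) (tgt f)"
  using assms unfolding ker_iff by blast+

lemma ker_lift:
  assumes "ker C f k" "arr C t" "tgt t = src f" "f \<star> t = azero C (src t) (tgt f)"
  obtains u where "arr C u" "src u = src t" "tgt u = src k" "k \<star> u = t"
  using assms unfolding ker_iff by blast+

lemma cokerD:
  assumes "coker C f c"
  shows "arr C f" "epic C c" "src c = tgt f" "c \<star> f = azero C (src f) (tgt c)"
  using assms unfolding coker_iff by blast+

lemma coker_desc:
  assumes "coker C f c" "arr C t" "src t = tgt f" "t \<star> f = azero C (src f) (tgt t)"
  obtains u where "arr C u" "src u = tgt c" "tgt u = tgt t" "u \<star> c = t"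
  using assms unfolding coker_iff by blast+

end

section \<open>Abelian categories\<close>

definition pullback :: "('o, 'm, 'x) precat_scheme \<Rightarrow> ('o, 'm) arrow \<Rightarrow> ('o, 'm) arrow \<Rightarrow>
    ('o, 'm) arrow \<Rightarrow> ('o, 'm) arrow \<Rightarrow> bool" where
  "pullback C f g a b \<longleftrightarrow> arr C f \<and> arr C g \<and> tgt g = tgt f \<and> arr C a \<and> arr C b \<and> src b = src a \<and>
     tgt a = src f \<and> tgt b = src g \<and> f \<star>\<^bsub>C\<^esub> a = g \<star>\<^bsub>C\<^esub> b \<and>
     (\<forall>s t. arr C s \<longrightarrow> arr C t \<longrightarrow> src t = src s \<longrightarrow> tgt s = src f \<longrightarrow> tgt t = src g \<longrightarrow>
        f \<star>\<^bsub>C\<^esub> s = g \<star>\<^bsub>C\<^esub> t \<longrightarrow>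
        (\<exists>!u. arr C u \<and> src u = src s \<and> tgt u = src a \<and> a \<star>\<^bsub>C\<^esub> u = s \<and> b \<star>\<^bsub>C\<^esub> u = t))"

definition biprod :: "('o, 'm, 'x) precat_scheme \<Rightarrow> ('o, 'm) arrow \<Rightarrow> ('o, 'm) arrow \<Rightarrow>
    ('o, 'm) arrow \<Rightarrow> ('o, 'm) arrow \<Rightarrow> bool" where
  "biprod C i j p q \<longleftrightarrow> arr C i \<and> arr C j \<and> arr C p \<and> arr C q \<and> tgt j = tgt i \<and> src p = tgt i \<and>
     src q = tgt i \<and> tgt p = src i \<and> tgt q = src j \<and> p \<star>\<^bsub>C\<^esub> i = aid C (src i) \<and>
     q \<star>\<^bsub>C\<^esub> j = aid C (src j) \<and> p \<star>\<^bsub>C\<^esub> j = azero C (src j) (src i) \<and>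
     q \<star>\<^bsub>C\<^esub> i = azero C (src i) (src j) \<and> (i \<star>\<^bsub>C\<^esub> p) \<boxplus>\<^bsub>C\<^esub> (j \<star>\<^bsub>C\<^esub> q) = aid C (tgt i)"

context category
begin

text \<open>The simplifier nests composites to the right, which hides the product of g and f inside
  g applied to (f applied to x). This form lets a known equation for the product be used
  there.\<close>

lemma acmp_reassoc:
  "\<lbrakk>g \<star> f = h; arr C f; arr C g; tgt f = src g; arr C x; tgt x = src f\<rbrakk> \<Longrightarrow> g \<star> (f \<star> x) = h \<star> x"
  by (metis acmp_assoc)

end

section \<open>Biproducts and pullbacks\<close>

context preadditive_category
begin

lemma biprodD:
  assumes "biprod C i j p q"
  shows "arr C i" "arr C j" "arr C p" "arr C q" "tgt j = tgt i" "src p = tgt i"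
    "src q = tgt i" "tgt p = src i" "tgt q = src j" "p \<star> i = aid C (src i)"
    "q \<star> j = aid C (src j)" "p \<star> j = azero C (src j) (src i)"
    "q \<star> i = azero C (src i) (src j)" "(i \<star> p) \<boxplus> (j \<star> q) = aid C (tgt i)"
  using assms unfolding biprod_def by blast+

lemma biprod_simps:
  assumes "biprod C i j p q" "arr C x"
  shows "tgt x = src i \<Longrightarrow> p \<star> (i \<star> x) = x" "tgt x = src i \<Longrightarrow> q \<star> (i \<star> x) = azero C (src x) (src j)"
    "tgt x = src j \<Longrightarrow> q \<star> (j \<star> x) = x" "tgt x = src j \<Longrightarrow> p \<star> (j \<star> x) = azero C (src x) (src i)"
proof -
  note b = biprodD[OF assms(1)]
  show "tgt x = src i \<Longrightarrow> p \<star> (i \<star> x) = x"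
    using b assms acmp_reassoc[OF b(10), of x] by simp
  show "tgt x = src i \<Longrightarrow> q \<star> (i \<star> x) = azero C (src x) (src j)"
    using b assms acmp_reassoc[OF b(13), of x] by simp
  show "tgt x = src j \<Longrightarrow> q \<star> (j \<star> x) = x"
    using b assms acmp_reassoc[OF b(11), of x] by simp
  show "tgt x = src j \<Longrightarrow> p \<star> (j \<star> x) = azero C (src x) (src i)"
    using b assms acmp_reassoc[OF b(12), of x] by simp
qed

lemma biprod_decomp:
  assumes "biprod C i j p q" "arr C x"
  shows "tgt x = tgt i \<Longrightarrow> x = (i \<star> (p \<star> x)) \<boxplus> (j \<star> (q \<star> x))"
    "src x = tgt i \<Longrightarrow> x = ((x \<star> i) \<star> p) \<boxplus> ((x \<star> j) \<star> q)"
proof -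
  note b = biprodD[OF assms(1)]
  show "x = (i \<star> (p \<star> x)) \<boxplus> (j \<star> (q \<star> x))" if t: "tgt x = tgt i"
  proof -
    have "x = ((i \<star> p) \<boxplus> (j \<star> q)) \<star> x" using b(14) assms(2) t by simp
    also have "\<dots> = (i \<star> p) \<star> x \<boxplus> (j \<star> q) \<star> x" using b(1-9) assms(2) t by (subst aplus_acmp) simp_all
    finally show ?thesis using b(1-9) assms(2) t by simp
  qed
  show "x = ((x \<star> i) \<star> p) \<boxplus> ((x \<star> j) \<star> q)" if t: "src x = tgt i"
  proof -
    have "x = x \<star> ((i \<star> p) \<boxplus> (j \<star> q))" using b(14) assms(2) t by simp
    also have "\<dots> = x \<star> (i \<star> p) \<boxplus> x \<star> (j \<star> q)" using b(1-9) assms(2) t by (subst acmp_aplus) simp_all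
    finally show ?thesis using b(1-9) assms(2) t by simp
  qed
qed

lemma biprod_ext_left:
  assumes "biprod C i j p q" "arr C x" "arr C y" "tgt x = tgt i" "tgt y = tgt i" "p \<star> x = p \<star> y" "q \<star> x = q \<star> y"
  shows "x = y"
  using biprod_decomp(1)[OF assms(1)] assms(2-) by metis

lemma biprod_ext_right:
  assumes "biprod C i j p q" "arr C x" "arr C y" "src x = tgt i" "src y = tgt i" "x \<star> i = y \<star> i" "x \<star> j = y \<star> j"
  shows "x = y"
  using biprod_decomp(2)[OF assms(1)] assms(2-) by metis

text \<open>An arrow into the biproduct is a pair (s, t), and h kills it iff h i s + h j t = 0, that
  is, iff h i s = - (h j t). The kernel of h is therefore a pullback. This serves to construct
  pullbacks, to show that they preserve epimorphisms, and to recognize the kernel of a morphism out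
  of a free object.\<close>

lemma biprod_ker_pullback:
  assumes b: "biprod C i j p q" and k: "ker C h k" and h: "src h = tgt i"
  shows "pullback C (h \<star> i) (aneg C (h \<star> j)) (p \<star> k) (q \<star> k)"
  unfolding pullback_def
proof (intro conjI allI impI)
  note B = biprodD[OF b] and K = kerD[OF k] note mk = monicD[OF K(2)]
  note S = B(1-9) K(1,3) mk h
  show "arr C (h \<star> i)" "arr C (aneg C (h \<star> j))" "arr C (p \<star> k)" "arr C (q \<star> k)"
    "tgt (aneg C (h \<star> j)) = tgt (h \<star> i)" "src (q \<star> k) = src (p \<star> k)"
    "tgt (p \<star> k) = src (h \<star> i)" "tgt (q \<star> k) = src (aneg C (h \<star> j))"
    using S by simp_all
  have "h \<star> k = h \<star> ((i \<star> (p \<star> k)) \<boxplus> (j \<star> (q \<star> k)))"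
    using biprod_decomp(1)[OF b mk] S by simp
  also have "\<dots> = (h \<star> i) \<star> (p \<star> k) \<boxplus> (h \<star> j) \<star> (q \<star> k)"
    using S by simp
  finally have "(h \<star> i) \<star> (p \<star> k) \<boxplus> (h \<star> j) \<star> (q \<star> k) = azero C (src k) (tgt h)" using K(4) by simp
  thus "(h \<star> i) \<star> (p \<star> k) = aneg C (h \<star> j) \<star> (q \<star> k)"
    using aplus_aneg_eq_zero[of "(h \<star> i) \<star> (p \<star> k)" "aneg C ((h \<star> j) \<star> (q \<star> k))"] S by simp
  fix s t assume st: "arr C s" "arr C t" "src t = src s" "tgt s = src (h \<star> i)" "tgt t = src (aneg C (h \<star> j))"
    and e: "h \<star> i \<star> s = aneg C (h \<star> j) \<star> t"
  have st': "tgt s = src i" "tgt t = src j" using st by simp_all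
  note S = S st(1-3) st'
  \<comment> \<open>The pair (s, t) as a single arrow into the biproduct.\<close>
  define x where "x = i \<star> s \<boxplus> j \<star> t"
  have x: "arr C x" "src x = src s" "tgt x = tgt i" using S by (simp_all add: x_def)
  have "h \<star> x = (h \<star> i \<star> s) \<boxplus> (h \<star> j \<star> t)" using S by (simp add: x_def)
  also have "\<dots> = azero C (src x) (tgt h)" unfolding e using S x by simp
  finally have "h \<star> x = azero C (src x) (tgt h)" .
  then obtain u where u: "arr C u" "src u = src x" "tgt u = src k" "k \<star> u = x"
    using ker_lift[OF k x(1)] x h by metis
  have px: "p \<star> x = s" "q \<star> x = t" using S biprod_simps[OF b] by (simp_all add: x_def)
  show "\<exists>!u. arr C u \<and> src u = src s \<and> tgt u = src (p \<star> k) \<and> p \<star> k \<star> u = s \<and> q \<star> k \<star> u = t"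
  proof (intro ex1I[of _ u] conjI)
    show "p \<star> k \<star> u = s" "q \<star> k \<star> u = t" using S u px by simp_all
    fix v assume v: "arr C v \<and> src v = src s \<and> tgt v = src (p \<star> k) \<and> p \<star> k \<star> v = s \<and> q \<star> k \<star> v = t"
    hence v': "arr C v" "src v = src s" "tgt v = src k" by simp_all
    have "k \<star> v = k \<star> u"
    proof (rule biprod_ext_left[OF b])
      show "p \<star> (k \<star> v) = p \<star> (k \<star> u)" using v v' u px S by simp
      show "q \<star> (k \<star> v) = q \<star> (k \<star> u)" using v v' u px S by simp
    qed (use v' u S x in simp_all)
    thus "v = u" using monic_cancel[OF K(2)] v' u by simp
  qed (use u x in simp_all)
qed

lemma pullbackD:
  assumes "pullback C f g a b"
  shows "arr C f" "arr C g" "tgt g = tgt f" "arr C a" "arr C b" "src b = src a" "tgt a = src f" "tgt b = src g"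
    "f \<star> a = g \<star> b"
  using assms unfolding pullback_def by blast+

lemma pullback_lift:
  assumes "pullback C f g a b" "arr C s" "arr C t" "src t = src s" "tgt s = src f" "tgt t = src g" "f \<star> s = g \<star> t"
  obtains u where "arr C u" "src u = src s" "tgt u = src a" "a \<star> u = s" "b \<star> u = t"
  using assms unfolding pullback_def by blast

lemma pullback_ext:
  assumes p: "pullback C f g a b" and "arr C u" "arr C v" "tgt u = src a" "tgt v = src a" "a \<star> u = a \<star> v" "b \<star> u = b \<star> v"
  shows "u = v"
proof -
  note P = pullbackD[OF p]
  have ex: "\<And>s t. arr C s \<Longrightarrow> arr C t \<Longrightarrow> src t = src s \<Longrightarrow> tgt s = src f \<Longrightarrow> tgt t = src g \<Longrightarrow>
        f \<star> s = g \<star> t \<Longrightarrow>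
        (\<exists>!u. arr C u \<and> src u = src s \<and> tgt u = src a \<and> a \<star> u = s \<and> b \<star> u = t)"
    using p unfolding pullback_def by blast
  have s: "src v = src u" using assms by (metis src_acmp)
  have "f \<star> (a \<star> u) = (g \<star> b) \<star> u" unfolding P(9)[symmetric] using P(1-8) assms(2,4) by simp
  hence "f \<star> (a \<star> u) = g \<star> (b \<star> u)" using P(1-8) assms(2,4) by simp
  moreover have "arr C (a \<star> u)" "arr C (b \<star> u)" using P(1-8) assms(2,4) by simp_all
  ultimately have "\<exists>!w. arr C w \<and> src w = src (a \<star> u) \<and> tgt w = src a \<and> a \<star> w = a \<star> u \<and> b \<star> w = b \<star> u"
    using ex[of "a \<star> u" "b \<star> u"] P(4-8) assms(2,4) by simp
  moreover have "arr C u \<and> src u = src (a \<star> u) \<and> tgt u = src a \<and> a \<star> u = a \<star> u \<and> b \<star> u = b \<star> u"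
    "arr C v \<and> src v = src (a \<star> u) \<and> tgt v = src a \<and> a \<star> v = a \<star> u \<and> b \<star> v = b \<star> u"
    using assms s by simp_all
  ultimately show ?thesis by blast
qed

lemma pullback_sym:
  assumes "pullback C f g a b"
  shows "pullback C g f b a"
  unfolding pullback_def
proof (intro conjI allI impI)
  note P = pullbackD[OF assms]
  show "arr C f" "arr C g" "tgt f = tgt g" "arr C a" "arr C b" "src a = src b" "tgt a = src f" "tgt b = src g"
    "g \<star> b = f \<star> a" using P by simp_all
  fix s t assume *: "arr C s" "arr C t" "src t = src s" "tgt s = src g" "tgt t = src f" "g \<star> s = f \<star> t"
  obtain u where u: "arr C u" "src u = src t" "tgt u = src a" "a \<star> u = t" "b \<star> u = s"
    using pullback_lift[OF assms *(2,1) *(3)[symmetric] *(5,4) *(6)[symmetric]] .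
  show "\<exists>!u. arr C u \<and> src u = src s \<and> tgt u = src b \<and> b \<star> u = s \<and> a \<star> u = t"
  proof (intro ex1I[of _ u])
    fix v assume "arr C v \<and> src v = src s \<and> tgt v = src b \<and> b \<star> v = s \<and> a \<star> v = t"
    thus "v = u" using pullback_ext[OF assms, of v u] u P(6) by simp
  qed (use u * P in simp)
qed

text \<open>Since f k = 0, the pair (k, 0) lifts to the pullback, and the lift n is a kernel of the
  side b parallel to f. The two parallel sides thus have kernels with the same source.\<close>

lemma pullback_ker:
  assumes p: "pullback C f g a b" and k: "ker C f k"
  obtains n where "ker C b n" "src n = src k" "a \<star> n = k"
proof -
  note P = pullbackD[OF p] and K = kerD[OF k] note mk = monicD[OF K(2)]
  have "f \<star> k = g \<star> azero C (src k) (src g)" using P(1-8) K mk by simp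
  then obtain n where n: "arr C n" "src n = src k" "tgt n = src a" "a \<star> n = k" "b \<star> n = azero C (src k) (src g)"
    using pullback_lift[OF p mk, of "azero C (src k) (src g)"] P(1-8) K mk by auto
  have "ker C b n" unfolding ker_iff
  proof (intro conjI allI impI)
    show "monic C n" using monic_right[of a n] n K(2) P by simp
    fix t assume t: "arr C t" "tgt t = src b" "b \<star> t = azero C (src t) (tgt b)"
    have "f \<star> (a \<star> t) = (g \<star> b) \<star> t" unfolding P(9)[symmetric] using P(1-8) t by simp
    also have "\<dots> = azero C (src (a \<star> t)) (tgt f)" using P(1-8) t by simp
    finally obtain u where u: "arr C u" "src u = src (a \<star> t)" "tgt u = src k" "k \<star> u = a \<star> t"
      using ker_lift[OF k, of "a \<star> t"] P(1-8) t by auto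
    have "n \<star> u = t"
    proof (rule pullback_ext[OF p])
      show "a \<star> (n \<star> u) = a \<star> t" using acmp_reassoc[OF n(4)] n(1-3) P(4) u by simp
      show "b \<star> (n \<star> u) = b \<star> t" using acmp_reassoc[OF n(5)] n(1-3) P(1-8) u t by simp
    qed (use n u t P in simp_all)
    thus "\<exists>u. arr C u \<and> src u = src t \<and> tgt u = src n \<and> n \<star> u = t"
      using u n by auto
  qed (use n P in simp_all)
  thus ?thesis using that n by blast
qed

end

section \<open>Image factorizations, exactness and arguments with generalized elements\<close>

context abelian_category
begin

lemma ex_ker: "arr C f \<Longrightarrow> \<exists>k. ker C f k"
  using kernel_exists[of "src f" "tgt f" "mor f"] unfolding arr_def ker_def by (metis arrow.sel)

lemma ex_coker: "arr C f \<Longrightarrow> \<exists>k. coker C f k"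
  using cokernel_exists[of "src f" "tgt f" "mor f"] unfolding arr_def coker_def by (metis arrow.sel)

lemma monic_ker: "monic C f \<Longrightarrow> \<exists>g. ker C g f"
  unfolding monic_def ker_def using mono_is_kernel[of "src f" "tgt f" "mor f"] by (metis arrow.sel)

lemma epic_coker: "epic C f \<Longrightarrow> \<exists>g. coker C g f"
  unfolding epic_def coker_def using epi_is_cokernel[of "src f" "tgt f" "mor f"] by (metis arrow.sel)

lemma ex_biprod:
  assumes "X \<in> obj C" "Y \<in> obj C"
  obtains i j p q where "biprod C i j p q" "src i = X" "src j = Y"
proof -
  obtain S i j p q where b: "is_biproduct C X Y S i j p q" using biproduct_exists assms by blast
  have "biprod C (Arrow X i S) (Arrow Y j S) (Arrow S p X) (Arrow S q Y)"
    using b assms unfolding is_biproduct_def biprod_def arr_def acmp_def aplus_def aid_def azero_def by simp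
  thus ?thesis using that by simp
qed

text \<open>An epimorphism is the cokernel of some g. As g factors through the kernel k, whatever
  kills k kills g and descends.\<close>

lemma coker_of_ker:
  assumes e: "epic C f" and k: "ker C f k"
  shows "coker C k f"
  unfolding coker_iff
proof (intro conjI allI impI)
  obtain g where g: "coker C g f" using epic_coker[OF e] by blast
  note G = cokerD[OF g] and K = kerD[OF k] note f = epicD[OF e] and ka = monicD[OF K(2)]
  obtain v where v: "arr C v" "src v = src g" "tgt v = src k" "k \<star> v = g"
    using ker_lift[OF k G(1)] G by auto
  fix t assume t: "arr C t" "src t = tgt k" "t \<star> k = azero C (src k) (tgt t)"
  have "t \<star> g = (t \<star> k) \<star> v" using t v ka by (subst acmp_assoc) simp_all
  hence "t \<star> g = azero C (src g) (tgt t)" using t(3) v t(1) by simp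
  thus "\<exists>u. arr C u \<and> src u = tgt f \<and> tgt u = tgt t \<and> u \<star> f = t"
    using coker_desc[OF g t(1)] t K G by metis
qed (use e kerD[OF k] in simp_all)

lemma ker_of_coker:
  assumes m: "monic C f" and c: "coker C f c"
  shows "ker C c f"
  unfolding ker_iff
proof (intro conjI allI impI)
  obtain g where g: "ker C g f" using monic_ker[OF m] by blast
  note G = kerD[OF g] and K = cokerD[OF c] note f = monicD[OF m] and ca = epicD[OF K(2)]
  obtain v where v: "arr C v" "src v = tgt c" "tgt v = tgt g" "v \<star> c = g"
    using coker_desc[OF c G(1)] G by auto
  fix t assume t: "arr C t" "tgt t = src c" "c \<star> t = azero C (src t) (tgt c)"
  have "g \<star> t = v \<star> (c \<star> t)" unfolding v(4)[symmetric] using t(1,2) v(1-3) ca by simp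
  hence "g \<star> t = azero C (src t) (tgt g)" using t(3) v t(1) by simp
  thus "\<exists>u. arr C u \<and> src u = src t \<and> tgt u = src f \<and> f \<star> u = t"
    using ker_lift[OF g t(1)] t K G by metis
qed (use m cokerD[OF c] in simp_all)

text \<open>As a monomorphism f is the kernel of some g, and g f = 0 with f epic forces g = 0. So
  the identity of the target lifts through f.\<close>

lemma monic_epic_inverse:
  assumes m: "monic C f" and e: "epic C f"
  obtains s where "arr C s" "src s = tgt f" "tgt s = src f" "f \<star> s = aid C (tgt f)" "s \<star> f = aid C (src f)"
proof -
  note f = monicD[OF m]
  obtain g where g: "ker C g f" using monic_ker[OF m] by blast
  note G = kerD[OF g]
  have "g = azero C (tgt f) (tgt g)" using epic_zeroD[OF e G(4)] G by simp
  hence "g \<star> aid C (tgt f) = azero C (src (aid C (tgt f))) (tgt g)" using f G by simp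
  then obtain s where s: "arr C s" "src s = tgt f" "tgt s = src f" "f \<star> s = aid C (tgt f)"
    using ker_lift[OF g, of "aid C (tgt f)"] G f by auto
  have "f \<star> (s \<star> f) = f \<star> aid C (src f)" using acmp_reassoc[OF s(4), of f] s f by simp
  hence "s \<star> f = aid C (src f)" using monic_cancel[OF m] s f by simp
  thus ?thesis using that s by blast
qed

lemma exact_iff:
  "exact C f g \<longleftrightarrow> (\<exists>q i. epic C q \<and> tgt q = src i \<and> f = i \<star> q \<and> ker C g i)"
proof
  assume "exact C f g"
  then obtain J q i where *: "tgt f = src g" "is_epi C (src f) J q" "is_mono C J (tgt f) i"
    "mor f = i \<cdot> q" "is_kernel C (tgt f) (tgt g) (mor g) J i"
    unfolding exact_def exact_at_def image_factorization_def by blast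
  have "f = Arrow J i (src g) \<star> Arrow (src f) q J" using * by (simp add: acmp_def arrow.expand)
  moreover have "epic C (Arrow (src f) q J)" "ker C g (Arrow J i (src g))"
    using * by (simp_all add: epic_def ker_def)
  ultimately show "\<exists>q i. epic C q \<and> tgt q = src i \<and> f = i \<star> q \<and> ker C g i"
    by (metis arrow.sel(1,3))
next
  assume "\<exists>q i. epic C q \<and> tgt q = src i \<and> f = i \<star> q \<and> ker C g i"
  then obtain q i where *: "epic C q" "tgt q = src i" "f = i \<star> q" "ker C g i" by blast
  have m: "monic C i" "tgt i = src g" using kerD[OF *(4)] by blast+
  show "exact C f g"
    using * m unfolding exact_def exact_at_def image_factorization_def epic_def monic_def ker_def
    by (intro conjI exI[of _ "src i"] exI[of _ "mor q"] exI[of _ "mor i"]) (simp_all add: acmp_def)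
qed

text \<open>Exactness allows an image object different from the source of f. For monic f the epic
  part q of the factorization is also monic, hence invertible, and f inherits the kernel property of
  i.\<close>

lemma ses_iff: "ses C f g \<longleftrightarrow> ker C g f \<and> epic C g"
proof
  assume "ses C f g"
  hence *: "monic C f" "exact C f g" "epic C g"
    unfolding ses_def short_exact_def monic_def exact_def epic_def by auto
  then obtain q i where q: "epic C q" "tgt q = src i" "f = i \<star> q" "ker C g i" unfolding exact_iff by blast
  note K = kerD[OF q(4)] note i = monicD[OF K(2)]
  have "monic C q" using monic_right[of i q] * q i by simp
  then obtain s where s: "arr C s" "src s = tgt q" "tgt s = src q" "q \<star> s = aid C (tgt q)"
    using monic_epic_inverse q(1) by metis
  have "ker C g f" unfolding ker_iff
  proof (intro conjI allI impI)
    show "g \<star> f = azero C (src f) (tgt g)"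
      unfolding q(3) using acmp_reassoc[OF K(4), of q] K(1,3) i q(1,2) by simp
    fix t assume t: "arr C t" "tgt t = src g" "g \<star> t = azero C (src t) (tgt g)"
    obtain u where u: "arr C u" "src u = src t" "tgt u = src i" "i \<star> u = t"
      using ker_lift[OF q(4) t] .
    have "f \<star> (s \<star> u) = t" unfolding q(3) using acmp_reassoc[OF s(4), of u] s(1-3) q(1,2) i u by simp
    thus "\<exists>u. arr C u \<and> src u = src t \<and> tgt u = src f \<and> f \<star> u = t"
      using s(1-3) u q(2,3) by (intro exI[of _ "s \<star> u"]) simp
  qed (use * K q(3) in simp_all)
  thus "ker C g f \<and> epic C g" using * by simp
next
  assume *: "ker C g f \<and> epic C g"
  note K = kerD[OF *[THEN conjunct1]] note f = monicD[OF K(2)]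
  have "exact C f g" unfolding exact_iff
    using * f by (intro exI[of _ "aid C (src f)"] exI[of _ f]) simp
  thus "ses C f g" unfolding ses_def short_exact_def
    using * K unfolding monic_def exact_def epic_def by simp
qed

text \<open>Take i as the kernel of the cokernel c of f. If u q = 0, then q factors through the
  kernel k of u, so f factors through the monic i k, which is the kernel of some g. Then g kills f,
  factors through c and so kills i; hence i factors through i k, k has a right inverse, and u =
  0.\<close>

lemma ex_image:
  assumes f: "arr C f"
  obtains q i where "epic C q" "monic C i" "tgt q = src i" "f = i \<star> q"
proof -
  obtain c where c: "coker C f c" using ex_coker[OF f] by blast
  note D = cokerD[OF c] note ca = epicD[OF D(2)]
  obtain i where i: "ker C c i" using ex_ker ca by blast
  note K = kerD[OF i] note ia = monicD[OF K(2)]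
  obtain q where q: "arr C q" "src q = src f" "tgt q = src i" "i \<star> q = f"
    using ker_lift[OF i f] D by metis
  have "epic C q" unfolding epic_iff_zero
  proof (intro conjI allI impI)
    fix u assume u: "arr C u" "src u = tgt q" "u \<star> q = azero C (src q) (tgt u)"
    obtain k where k: "ker C u k" using ex_ker u by blast
    note L = kerD[OF k] note ka = monicD[OF L(2)]
    obtain r where r: "arr C r" "src r = src q" "tgt r = src k" "k \<star> r = q"
      using ker_lift[OF k q(1)] u by metis
    have "monic C (i \<star> k)" using monic_acmp[OF L(2) K(2)] L u q by simp
    then obtain g where g: "ker C g (i \<star> k)" using monic_ker by blast
    note G = kerD[OF g]
    have ty: "src g = tgt i" "tgt k = src i" using G(3) L u q by simp_all
    have gik: "(g \<star> i) \<star> k = azero C (src k) (tgt g)" using G(1,4) ty ka ia by simp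
    have "f = (i \<star> k) \<star> r" using r q ty ka ia by simp
    hence "g \<star> f = (g \<star> (i \<star> k)) \<star> r" using G(1) ty ka ia r(1,3) by simp
    hence "g \<star> f = azero C (src f) (tgt g)" unfolding G(4) using r G(1) ka ty q(2) by simp
    then obtain h where h: "arr C h" "src h = tgt c" "tgt h = tgt g" "h \<star> c = g"
      using coker_desc[OF c G(1)] ty K D by metis
    have "g \<star> i = azero C (src i) (tgt g)"
      using acmp_reassoc[OF refl, of c h i] h ca K ia by simp
    then obtain s where s: "arr C s" "src s = src i" "tgt s = src k" "(i \<star> k) \<star> s = i"
      using ker_lift[OF g ia] ty by auto
    have "i \<star> (k \<star> s) = i \<star> aid C (src i)" using s ia ka ty by simp
    hence ks: "k \<star> s = aid C (src i)" using monic_cancel[OF K(2)] s ia ka ty by simp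
    have "u = u \<star> (k \<star> s)" unfolding ks using u q by simp
    also have "\<dots> = azero C (tgt q) (tgt u)" using acmp_reassoc[OF L(4), of s] u s ka L q by simp
    finally show "u = azero C (tgt q) (tgt u)" .
  qed (rule q(1))
  thus ?thesis using that K(2) q by blast
qed

lemma ex_pullback:
  assumes "arr C f" "arr C g" "tgt g = tgt f"
  obtains a b where "pullback C f g a b"
proof -
  obtain i j p q where b: "biprod C i j p q" and s: "src i = src f" "src j = src g"
    by (rule ex_biprod[OF arr_src[OF assms(1)] arr_src[OF assms(2)]])
  note B = biprodD[OF b]
  \<comment> \<open>The sign makes \<open>aneg C (h \<star> j)\<close> equal to g, the form in which
    \<open>biprod_ker_pullback\<close> returns the second leg.\<close>
  define h where "h = f \<star> p \<boxplus> aneg C (g \<star> q)"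
  have h: "arr C h" "src h = tgt i" "tgt h = tgt f" using B(1-9) s assms by (simp_all add: h_def)
  obtain k where k: "ker C h k" using ex_ker h by blast
  have "h \<star> i = f" "h \<star> j = aneg C g" using B s assms by (simp_all add: h_def)
  thus ?thesis using biprod_ker_pullback[OF b k h(2)] that assms by simp
qed

text \<open>The claim is first shown for the pullback inside the biproduct. There h is epic because
  h i = f is, so h is the cokernel of its kernel k. If u kills q k, then u q = v h for some v;
  composing with i gives v f = 0, so v = 0 and u = u q j = 0. The comparison arrow into the given
  pullback carries the result over.\<close>

lemma pullback_epic:
  assumes p: "pullback C f g a b" and e: "epic C f"
  shows "epic C b"
proof -
  note P = pullbackD[OF p]
  obtain i j p' q where bp: "biprod C i j p' q" and s: "src i = src f" "src j = src g"
    by (rule ex_biprod[OF arr_src[OF P(1)] arr_src[OF P(2)]])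
  note B = biprodD[OF bp]
  define h where "h = f \<star> p' \<boxplus> aneg C (g \<star> q)"
  have h: "arr C h" "src h = tgt i" "tgt h = tgt f" using B(1-9) s P by (simp_all add: h_def)
  have hi: "h \<star> i = f" and hj: "h \<star> j = aneg C g" using B s P by (simp_all add: h_def)
  have he: "epic C h" using epic_left[of h i] hi e h B by simp
  obtain k where k: "ker C h k" using ex_ker h by blast
  note K = kerD[OF k] note ka = monicD[OF K(2)]
  have ck: "coker C k h" using coker_of_ker[OF he k] .
  have pb: "pullback C f g (p' \<star> k) (q \<star> k)" using biprod_ker_pullback[OF bp k h(2)] hi hj P by simp
  have "epic C (q \<star> k)" unfolding epic_iff_zero
  proof (intro conjI allI impI)
    show "arr C (q \<star> k)" using B K ka h by simp
    fix u assume u: "arr C u" "src u = tgt (q \<star> k)" "u \<star> (q \<star> k) = azero C (src (q \<star> k)) (tgt u)"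
    have us: "src u = src j" using u B by simp
    have "(u \<star> q) \<star> k = azero C (src k) (tgt (u \<star> q))" using u us B K ka h by simp
    then obtain v where v: "arr C v" "src v = tgt h" "tgt v = tgt u" "v \<star> h = u \<star> q"
      using coker_desc[OF ck, of "u \<star> q"] u us B K ka h by auto
    have "v \<star> f = (u \<star> q) \<star> i" unfolding hi[symmetric] v(4)[symmetric] using v(1-3) h B by simp
    hence vf: "v \<star> f = azero C (src f) (tgt u)" using u us B s P(1,2) by simp
    have "v = azero C (tgt f) (tgt u)" using epic_zeroD[OF e vf] v h by simp
    hence "u \<star> q = azero C (tgt i) (tgt u)" using v(4) h u by simp
    moreover have "u = (u \<star> q) \<star> j" using u us B by simp
    ultimately show "u = azero C (tgt (q \<star> k)) (tgt u)" using u B by simp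
  qed
  moreover obtain u where u: "arr C u" "src u = src (p' \<star> k)" "tgt u = src a" "b \<star> u = q \<star> k"
    using pullback_lift[OF p, of "p' \<star> k" "q \<star> k"] pullbackD[OF pb] by auto
  ultimately show ?thesis using epic_left[of b u] P by simp
qed

text \<open>Generalized elements: up to an epimorphism of the source, exactness can be tested on arrows.\<close>

lemma epic_local_lift:
  assumes e: "epic C f" and z: "arr C z" "tgt z = tgt f"
  obtains d w where "epic C d" "tgt d = src z" "arr C w" "src w = src d" "tgt w = src f" "f \<star> w = z \<star> d"
proof -
  obtain a b where p: "pullback C f z a b" using ex_pullback[of f z] assms by auto
  note P = pullbackD[OF p]
  show ?thesis using that[of b a] pullback_epic[OF p e] P by simp
qed

lemma exact_local_lift:
  assumes "exact C f g" and z: "arr C z" "tgt z = src g" "g \<star> z = azero C (src z) (tgt g)"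
  obtains d w where "epic C d" "tgt d = src z" "arr C w" "src w = src d" "tgt w = src f" "f \<star> w = z \<star> d"
proof -
  obtain q i where q: "epic C q" "tgt q = src i" "f = i \<star> q" "ker C g i" using assms(1) exact_iff by blast
  note K = kerD[OF q(4)] note i = monicD[OF K(2)]
  obtain z' where z': "arr C z'" "src z' = src z" "tgt z' = src i" "i \<star> z' = z" using ker_lift[OF q(4) z] .
  obtain d w where d: "epic C d" "tgt d = src z'" "arr C w" "src w = src d" "tgt w = src q" "q \<star> w = z' \<star> d"
    using epic_local_lift[OF q(1) z'(1)] z' q by metis
  have "f \<star> w = z \<star> d" unfolding q(3) z'(4)[symmetric] using d q(1,2) i z'(1-3) by simp
  thus ?thesis using that[of d w] d z' q by simp
qed

lemma exactD:
  assumes "exact C f g"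
  shows "arr C f" "arr C g" "tgt f = src g" "g \<star> f = azero C (src f) (tgt g)"
proof -
  obtain q i where q: "epic C q" "tgt q = src i" "f = i \<star> q" "ker C g i" using assms exact_iff by blast
  note K = kerD[OF q(4)] note i = monicD[OF K(2)]
  show "arr C f" "arr C g" "tgt f = src g" unfolding q(3) using q(1,2) K i by simp_all
  show "g \<star> f = azero C (src f) (tgt g)" unfolding q(3) using acmp_reassoc[OF K(4), of q] K i q by simp
qed

lemma exact_epic_coker:
  assumes x: "exact C f g" and e: "epic C g"
  shows "coker C f g"
  unfolding coker_iff
proof (intro conjI allI impI)
  obtain q i where q: "epic C q" "tgt q = src i" "f = i \<star> q" "ker C g i" using x exact_iff by blast
  note K = kerD[OF q(4)] note i = monicD[OF K(2)]
  note X = exactD[OF x]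
  show "arr C f" "epic C g" "src g = tgt f" "g \<star> f = azero C (src f) (tgt g)" using X e by simp_all
  fix t assume t: "arr C t" "src t = tgt f" "t \<star> f = azero C (src f) (tgt t)"
  have "(t \<star> i) \<star> q = azero C (src f) (tgt t)" using t q i by simp
  hence "t \<star> i = azero C (src i) (tgt t)" using epic_zeroD[OF q(1), of "t \<star> i" "src f" "tgt t"] t q i by simp
  thus "\<exists>u. arr C u \<and> src u = tgt g \<and> tgt u = tgt t \<and> u \<star> g = t"
    using coker_desc[OF coker_of_ker[OF e q(4)] t(1)] t q by auto
qed

end

section \<open>Resolutions and vanishing of Ext\<close>

context preadditive_category
begin

lemma ker_monic_acmp:
  assumes k: "ker C g k" and m: "monic C m" "tgt g = src m"
  shows "ker C (m \<star> g) k"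
  unfolding ker_iff
proof (intro conjI allI impI)
  note K = kerD[OF k] note ka = monicD[OF K(2)] and ma = monicD[OF m(1)]
  show "arr C (m \<star> g)" "monic C k" "tgt k = src (m \<star> g)" using K ma m by simp_all
  show "(m \<star> g) \<star> k = azero C (src k) (tgt (m \<star> g))" using K ka ma m by simp
  fix t assume t: "arr C t" "tgt t = src (m \<star> g)" "(m \<star> g) \<star> t = azero C (src t) (tgt (m \<star> g))"
  have "m \<star> (g \<star> t) = azero C (src t) (tgt m)" using t K ma m by simp
  hence "g \<star> t = azero C (src t) (tgt g)" using monic_zeroD[OF m(1), of "g \<star> t"] t K m by simp
  thus "\<exists>u. arr C u \<and> src u = src t \<and> tgt u = src k \<and> k \<star> u = t"
    using ker_lift[OF k t(1)] t by (metis src_acmp)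
qed

lemma projective_lift:
  assumes "is_projective C P" "epic C e" "arr C f" "src f = P" "tgt f = tgt e"
  obtains h where "arr C h" "src h = P" "tgt h = src e" "e \<star> h = f"
proof -
  have "\<exists>h\<in>homs C P (src e). mor e \<cdot> h = mor f"
    using assms unfolding is_projective_def epic_def by (metis arr_mor)
  then obtain h where h: "h \<in> homs C P (src e)" "mor e \<cdot> h = mor f" by blast
  have "arr C (Arrow P h (src e))" using h assms arr_src[OF epicD[OF assms(2)]]
    by (simp add: arr_def is_projective_def del: arr_src arr_tgt)
  moreover have "e \<star> Arrow P h (src e) = f" using h assms by (auto simp: acmp_def arrow.expand)
  ultimately show ?thesis using that[of "Arrow P h (src e)"] by simp
qed

lemma injective_extend:
  assumes "is_injective C E" "monic C m" "arr C f" "tgt f = E" "src f = src m"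
  obtains h where "arr C h" "src h = tgt m" "tgt h = E" "h \<star> m = f"
proof -
  have "\<exists>h\<in>homs C (tgt m) E. h \<cdot> mor m = mor f"
    using assms unfolding is_injective_def monic_def by (metis arr_mor)
  then obtain h where h: "h \<in> homs C (tgt m) E" "h \<cdot> mor m = mor f" by blast
  have "arr C (Arrow (tgt m) h E)" using h assms arr_tgt[OF monicD[OF assms(2)]]
    by (simp add: arr_def is_injective_def del: arr_src arr_tgt)
  moreover have "Arrow (tgt m) h E \<star> m = f" using h assms by (auto simp: acmp_def arrow.expand)
  ultimately show ?thesis using that[of "Arrow (tgt m) h E"] by simp
qed

lemma projectiveI:
  assumes "P \<in> obj C"
    and "\<And>e f. epic C e \<Longrightarrow> arr C f \<Longrightarrow> src f = P \<Longrightarrow> tgt f = tgt e \<Longrightarrow>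
      \<exists>h. arr C h \<and> src h = P \<and> tgt h = src e \<and> e \<star> h = f"
  shows "is_projective C P"
  unfolding is_projective_def
proof (intro conjI allI impI ballI)
  fix X Y e f assume *: "is_epi C X Y e" "f \<in> homs C P Y"
  have "epic C (Arrow X e Y)" "arr C (Arrow P f Y)"
    using * assms(1) by (simp_all add: epic_def is_epi_def arr_def del: arr_src arr_tgt)
  then obtain h where "arr C h" "src h = P" "tgt h = X" "Arrow X e Y \<star> h = Arrow P f Y"
    using assms(2)[of "Arrow X e Y" "Arrow P f Y"] by auto
  thus "\<exists>h\<in>homs C P X. e \<cdot> h = f" using arr_mor[of C h] by (auto simp: acmp_def)
qed (rule assms(1))

end

definition res_obj :: "('o, 'm, 'x) precat_scheme \<Rightarrow> 'o \<Rightarrow> nat \<Rightarrow> 'o" where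
  "res_obj C M n = fst (proj_res C M) n"

definition res_arr :: "('o, 'm, 'x) precat_scheme \<Rightarrow> 'o \<Rightarrow> nat \<Rightarrow> ('o, 'm) arrow" where
  "res_arr C M n = Arrow (res_obj C M (Suc n)) (fst (snd (proj_res C M)) n) (res_obj C M n)"

definition res_aug :: "('o, 'm, 'x) precat_scheme \<Rightarrow> 'o \<Rightarrow> ('o, 'm) arrow" where
  "res_aug C M = Arrow (res_obj C M 0) (snd (snd (proj_res C M))) M"

text \<open>The index is shifted: this is the vanishing of Ext in degree n + 1.\<close>

definition ext_van :: "('o, 'm, 'x) precat_scheme \<Rightarrow> nat \<Rightarrow> 'o \<Rightarrow> 'o \<Rightarrow> bool" where
  "ext_van C n M N \<longleftrightarrow> (\<forall>f. arr C f \<longrightarrow> src f = res_obj C M (Suc n) \<longrightarrow> tgt f = N \<longrightarrow>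
     f \<star>\<^bsub>C\<^esub> res_arr C M (Suc n) = azero C (res_obj C M (Suc (Suc n))) N \<longrightarrow>
     (\<exists>g. arr C g \<and> src g = res_obj C M n \<and> tgt g = N \<and> g \<star>\<^bsub>C\<^esub> res_arr C M n = f))"

lemma src_res_arr [simp]: "src (res_arr C M n) = res_obj C M (Suc n)"
  and tgt_res_arr [simp]: "tgt (res_arr C M n) = res_obj C M n"
  and src_res_aug [simp]: "src (res_aug C M) = res_obj C M 0"
  and tgt_res_aug [simp]: "tgt (res_aug C M) = M"
  by (simp_all add: res_arr_def res_aug_def)

locale abelian_category_enough_projectives = abelian_category +
  assumes enough_proj: "enough_projectives C"
begin

lemma ex_projective_cover:
  assumes "X \<in> obj C"
  obtains e where "epic C e" "is_projective C (src e)" "tgt e = X"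
proof -
  obtain P e where "is_projective C P" "is_epi C P X e"
    using enough_proj assms unfolding enough_projectives_def by blast
  thus ?thesis using that[of "Arrow P e X"] by (simp add: epic_def)
qed

text \<open>The resolution is spliced from syzygies: \<open>k n\<close> includes the syzygy number n
  + 1 into the n-th projective, \<open>c n\<close> is an epimorphism from a projective onto that
  syzygy, and the differential is their composite.\<close>

lemma ex_resolution:
  assumes M: "M \<in> obj C"
  shows "\<exists>R. is_projective_resolution C M R"
proof -
  obtain e where e: "epic C e" "is_projective C (src e)" "tgt e = M" using ex_projective_cover[OF M] .
  obtain k0 where k0: "ker C e k0" using ex_ker e by fastforce
  let ?R = "\<lambda>k c k'. epic C c \<and> is_projective C (src c) \<and> tgt c = src k \<and> ker C c k'"
  \<comment> \<open>Dependent choice runs over the inclusions alone. The condition at 0 pins the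
    start to the kernel of the augmentation, and the epimorphisms \<open>c n\<close> are selected
    afterwards.\<close>
  have "\<exists>k. \<forall>n. (monic C (k n) \<and> (n = 0 \<longrightarrow> k n = k0)) \<and> (\<exists>c. ?R (k n) c (k (Suc n)))"
  proof (rule dependent_nat_choice)
    show "\<exists>k. monic C k \<and> (0 = 0 \<longrightarrow> k = k0)" using kerD(2)[OF k0] by blast
    fix k and n :: nat assume "monic C k \<and> (n = 0 \<longrightarrow> k = k0)"
    hence k: "monic C k" by blast
    obtain c where c: "epic C c" "is_projective C (src c)" "tgt c = src k"
      using ex_projective_cover[OF arr_src[OF monicD[OF k]]] .
    obtain k' where k': "ker C c k'" using ex_ker c by fastforce
    show "\<exists>k'. (monic C k' \<and> (Suc n = 0 \<longrightarrow> k' = k0)) \<and> (\<exists>c. ?R k c k')"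
      using c k' kerD(2)[OF k'] by blast
  qed
  then obtain k where k: "\<And>n. monic C (k n)" "k 0 = k0" "\<And>n. \<exists>c. ?R (k n) c (k (Suc n))" by blast
  then obtain c where c: "\<And>n. epic C (c n)" "\<And>n. is_projective C (src (c n))"
    "\<And>n. tgt (c n) = src (k n)" "\<And>n. ker C (c n) (k (Suc n))" by metis
  define P where "P n = (case n of 0 \<Rightarrow> src e | Suc m \<Rightarrow> src (c m))" for n
  have tk: "tgt (k n) = P n" for n
    by (cases n) (use kerD(3)[OF k0] kerD(3)[OF c(4)] k in \<open>simp_all add: P_def\<close>)
  have x: "exact C (k (Suc n) \<star> c (Suc n)) (k n \<star> c n)" for n
    unfolding exact_iff using c ker_monic_acmp[OF c(4) k(1) c(3)] by blast
  have x0: "exact C (k 0 \<star> c 0) e" unfolding exact_iff using c k k0 by metis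
  have "is_projective_resolution C M (P, \<lambda>n. mor (k n \<star> c n), mor e)"
    unfolding is_projective_resolution_def prod.case
  proof (intro conjI allI)
    show "is_projective C (P n)" for n by (cases n) (simp_all add: P_def e c)
    show "is_epi C (P 0) M (mor e)" using e by (simp add: epic_def P_def)
    show "exact_at C (P (Suc 0)) (P 0) M (mor (k 0 \<star> c 0)) (mor e)"
      using x0 e tk[of 0] by (simp add: exact_def P_def)
    show "exact_at C (P (Suc (Suc n))) (P (Suc n)) (P n) (mor (k (Suc n) \<star> c (Suc n))) (mor (k n \<star> c n))" for n
      using x[of n] tk[of n] tk[of "Suc n"] by (simp add: exact_def P_def)
  qed
  thus ?thesis by blast
qed

lemma resolution:
  assumes M: "M \<in> obj C"
  shows "is_projective C (res_obj C M n)" "epic C (res_aug C M)"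
    "exact C (res_arr C M 0) (res_aug C M)" "exact C (res_arr C M (Suc n)) (res_arr C M n)"
proof -
  have r: "is_projective_resolution C M (proj_res C M)"
    unfolding proj_res_def using someI_ex[OF ex_resolution[OF M]] .
  obtain P d e where p: "proj_res C M = (P, d, e)" by (cases "proj_res C M")
  show "is_projective C (res_obj C M n)" "epic C (res_aug C M)"
    "exact C (res_arr C M 0) (res_aug C M)" "exact C (res_arr C M (Suc n)) (res_arr C M n)"
    using r unfolding p is_projective_resolution_def
    by (simp_all add: res_obj_def res_aug_def res_arr_def p epic_def exact_def)
qed

lemma res_in_obj [simp]: "M \<in> obj C \<Longrightarrow> res_obj C M n \<in> obj C"
  using resolution(1) by (simp add: is_projective_def)

lemma arr_res_aug [simp]: "M \<in> obj C \<Longrightarrow> arr C (res_aug C M)"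
  using resolution(2) by simp

lemma arr_res_arr [simp]: "M \<in> obj C \<Longrightarrow> arr C (res_arr C M n)"
  using exactD(2)[OF resolution(4)] .

lemma res_arr_comp [simp]:
  "M \<in> obj C \<Longrightarrow> res_arr C M n \<star> res_arr C M (Suc n) = azero C (res_obj C M (Suc (Suc n))) (res_obj C M n)"
  using exactD(4)[OF resolution(4)] by simp

text \<open>A quotient group is trivial iff the subgroup is everything, here iff each cocycle is a
  coboundary. Most of the work is to see both as subgroups of the hom group, one inside the other,
  before the quotient may be treated as a group. Writing the degree as \<open>Suc n\<close> bypasses
  the special coboundaries of degree 0.\<close>

lemma trivial_Ext_iff:
  assumes M: "M \<in> obj C" and N: "N \<in> obj C"
  shows "trivial_group (Ext C (Suc n) M N) \<longleftrightarrow> ext_van C n M N"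
proof -
  obtain P d e where p: "proj_res C M = (P, d, e)" by (cases "proj_res C M")
  have P: "res_obj C M m = P m" "res_arr C M m = Arrow (P (Suc m)) (d m) (P m)" for m
    by (simp_all add: res_obj_def res_arr_def p)
  let ?Z = "ext_cocycles C (Suc n) M N" and ?B = "ext_coboundaries C (Suc n) M N"
  let ?G = "hom_group C (P (Suc n)) N"
  let ?Gz = "?G\<lparr>carrier := ?Z\<rparr>"
  have PO: "P m \<in> obj C" for m using res_in_obj[OF M, of m] P by simp
  interpret G: comm_group ?G using hom_comm_group PO N by blast
  have Z: "h \<in> ?Z \<longleftrightarrow> arr C (Arrow (P (Suc n)) h N) \<and>
      Arrow (P (Suc n)) h N \<star> res_arr C M (Suc n) = azero C (P (Suc (Suc n))) N" for h
    unfolding ext_cocycles_def p by (auto simp: arr_def acmp_def azero_def P PO N simp del: arr_src arr_tgt)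
  have B: "h \<in> ?B \<longleftrightarrow> (\<exists>g. arr C (Arrow (P n) g N) \<and> Arrow (P n) g N \<star> res_arr C M n = Arrow (P (Suc n)) h N)" for h
    unfolding ext_coboundaries_def p by (auto simp: arr_def acmp_def P PO N simp del: arr_src arr_tgt)
  have plus: "Arrow X (madd C g h) Y = Arrow X g Y \<boxplus> Arrow X h Y" for X Y g h by (simp add: aplus_def)
  have iv: "Arrow X (inv\<^bsub>hom_group C X Y\<^esub> g) Y = aneg C (Arrow X g Y)" for X Y g by (simp add: aneg_def)
  have zer: "Arrow X (zerom C X Y) Y = azero C X Y" for X Y by (simp add: azero_def)
  have carr: "h \<in> carrier ?G \<longleftrightarrow> arr C (Arrow (P (Suc n)) h N)" for h
    by (simp add: hom_group_def arr_def PO N del: arr_src arr_tgt)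
  have opsG: "x \<otimes>\<^bsub>?G\<^esub> y = madd C x y" "\<one>\<^bsub>?G\<^esub> = zerom C (P (Suc n)) N" for x y
    by (simp_all add: hom_group_def)
  have da: "arr C (res_arr C M m)" for m using M by simp
  have subZ: "subgroup ?Z ?G"
  proof
    show "?Z \<subseteq> carrier ?G" using Z carr by blast
    show "x \<otimes>\<^bsub>?G\<^esub> y \<in> ?Z" if "x \<in> ?Z" "y \<in> ?Z" for x y
      using that da unfolding Z opsG plus by (simp add: P(1) PO N)
    show "\<one>\<^bsub>?G\<^esub> \<in> ?Z" unfolding Z opsG zer using da[of "Suc n"] by (simp add: P(1) PO N)
    show "inv\<^bsub>?G\<^esub> x \<in> ?Z" if "x \<in> ?Z" for x
      using that da[of "Suc n"] unfolding Z iv by (simp add: P(1) PO N)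
  qed
  have subB: "subgroup ?B ?G"
  proof
    show "?B \<subseteq> carrier ?G"
    proof
      fix h assume "h \<in> ?B"
      then obtain g where g: "arr C (Arrow (P n) g N)" "Arrow (P n) g N \<star> res_arr C M n = Arrow (P (Suc n)) h N"
        using B by blast
      have "arr C (Arrow (P n) g N \<star> res_arr C M n)" using g(1) da[of n] by (simp add: P(1))
      thus "h \<in> carrier ?G" using g(2) carr by simp
    qed
    show "x \<otimes>\<^bsub>?G\<^esub> y \<in> ?B" if xy: "x \<in> ?B" "y \<in> ?B" for x y
    proof -
      obtain g h where *: "arr C (Arrow (P n) g N)" "Arrow (P n) g N \<star> res_arr C M n = Arrow (P (Suc n)) x N"
        "arr C (Arrow (P n) h N)" "Arrow (P n) h N \<star> res_arr C M n = Arrow (P (Suc n)) y N"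
        using xy unfolding B by blast
      have "(Arrow (P n) g N \<boxplus> Arrow (P n) h N) \<star> res_arr C M n = Arrow (P (Suc n)) x N \<boxplus> Arrow (P (Suc n)) y N"
        using *(1,3) da[of n] unfolding *(2,4)[symmetric] by (simp add: P(1))
      moreover have "arr C (Arrow (P n) g N \<boxplus> Arrow (P n) h N)" using * by simp
      ultimately show ?thesis unfolding B opsG plus by (intro exI[of _ "madd C g h"]) (simp add: plus)
    qed
    show "\<one>\<^bsub>?G\<^esub> \<in> ?B" unfolding B opsG zer using da[of n]
      by (intro exI[of _ "zerom C (P n) N"]) (simp add: P(1) PO N zer)
    show "inv\<^bsub>?G\<^esub> x \<in> ?B" if xy: "x \<in> ?B" for x
    proof -
      obtain g where *: "arr C (Arrow (P n) g N)" "Arrow (P n) g N \<star> res_arr C M n = Arrow (P (Suc n)) x N"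
        using xy unfolding B by blast
      have "aneg C (Arrow (P n) g N) \<star> res_arr C M n = aneg C (Arrow (P (Suc n)) x N)"
        using *(1) da[of n] unfolding *(2)[symmetric] by (simp add: P(1))
      moreover have "arr C (aneg C (Arrow (P n) g N))" using * by simp
      ultimately show ?thesis unfolding B iv by (intro exI[of _ "inv\<^bsub>hom_group C (P n) N\<^esub> g"]) (simp add: iv)
    qed
  qed
  have BZ: "?B \<subseteq> ?Z"
  proof
    fix h assume h: "h \<in> ?B"
    then obtain g where g: "arr C (Arrow (P n) g N)" "Arrow (P n) g N \<star> res_arr C M n = Arrow (P (Suc n)) h N"
      using B by blast
    have "arr C (Arrow (P (Suc n)) h N)" using subgroup.subset[OF subB] h carr by blast
    moreover have "Arrow (P (Suc n)) h N \<star> res_arr C M (Suc n) = azero C (P (Suc (Suc n))) N"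
      unfolding g(2)[symmetric] using g(1) da[of n] da[of "Suc n"] res_arr_comp[OF M, of n] by (simp add: P(1) PO N)
    ultimately show "h \<in> ?Z" using Z by blast
  qed
  have E: "Ext C (Suc n) M N = ?Gz Mod ?B" unfolding Ext_def p by simp
  have 1: "ext_van C n M N \<longleftrightarrow> ?Z \<subseteq> ?B"
  proof
    assume v: "ext_van C n M N"
    show "?Z \<subseteq> ?B"
    proof
      fix h assume "h \<in> ?Z"
      hence "arr C (Arrow (P (Suc n)) h N)" "Arrow (P (Suc n)) h N \<star> res_arr C M (Suc n) = azero C (P (Suc (Suc n))) N"
        using Z by blast+
      then obtain g where g: "arr C g" "src g = P n" "tgt g = N" "g \<star> res_arr C M n = Arrow (P (Suc n)) h N"
        using v unfolding ext_van_def P(1) by (metis arrow.sel(1,3))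
      thus "h \<in> ?B" unfolding B by (intro exI[of _ "mor g"]) (metis arrow.collapse)
    qed
  next
    assume v: "?Z \<subseteq> ?B"
    show "ext_van C n M N" unfolding ext_van_def P(1)
    proof (intro allI impI)
      fix f assume f: "arr C f" "src f = P (Suc n)" "tgt f = N" "f \<star> res_arr C M (Suc n) = azero C (P (Suc (Suc n))) N"
      have fe: "Arrow (P (Suc n)) (mor f) N = f" using f by (metis arrow.collapse)
      have "mor f \<in> ?Z" unfolding Z fe using f by blast
      hence "mor f \<in> ?B" using v by blast
      thus "\<exists>g. arr C g \<and> src g = P n \<and> tgt g = N \<and> g \<star> res_arr C M n = f"
        unfolding B fe by (metis arrow.sel(1,3))
    qed
  qed
  interpret Gz: group ?Gz using subgroup.subgroup_is_group[OF subZ G.is_group] .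
  have com: "comm_group ?Gz"
    by (rule Gz.group_comm_groupI) (use subgroup.subset[OF subZ] G.m_comm in auto)
  have subBz: "subgroup ?B ?Gz"
    using G.subgroup_incl[OF subB subZ BZ] .
  have nb: "normal ?B ?Gz" using comm_group.subgroup_imp_normal[OF com subBz] .
  have "trivial_group (?Gz Mod ?B) \<longleftrightarrow> ?Z \<subseteq> ?B"
  proof
    assume t: "trivial_group (?Gz Mod ?B)"
    show "?Z \<subseteq> ?B"
    proof
      fix h assume h: "h \<in> ?Z"
      hence "?B #>\<^bsub>?Gz\<^esub> h \<in> carrier (?Gz Mod ?B)"
        unfolding FactGroup_def RCOSETS_def by auto
      hence "?B #>\<^bsub>?Gz\<^esub> h = ?B" using t unfolding trivial_group_def FactGroup_def by simp
      moreover have "h \<in> ?B #>\<^bsub>?Gz\<^esub> h"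
        using Gz.rcos_self[of h ?B] h subBz by simp
      ultimately show "h \<in> ?B" by blast
    qed
  next
    assume "?Z \<subseteq> ?B"
    hence eq: "?B = carrier ?Gz" using BZ by simp
    have "carrier (?Gz Mod ?B) = {?B}"
    proof -
      have "?B #>\<^bsub>?Gz\<^esub> h = ?B" if "h \<in> carrier ?Gz" for h
        using Gz.coset_join2[OF that subBz] that eq by blast
      moreover have "\<one>\<^bsub>?Gz\<^esub> \<in> carrier ?Gz" by (rule Gz.one_closed)
      ultimately show ?thesis unfolding FactGroup_def RCOSETS_def by auto
    qed
    thus "trivial_group (?Gz Mod ?B)"
      unfolding trivial_group_def using normal.factorgroup_is_group[OF nb] by (simp add: FactGroup_def)
  qed
  thus ?thesis using E 1 by simp
qed

end

section \<open>Ext in the second variable: diagram chases on cocycles\<close>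

context preadditive_category
begin

lemma aplus_aneg_cancel:
  assumes "arr C f" "arr C x" "src f = src x" "tgt f = tgt x"
  shows "x \<boxplus> (f \<boxplus> aneg C x) = f"
proof -
  have "x \<boxplus> (f \<boxplus> aneg C x) = x \<boxplus> (aneg C x \<boxplus> f)"
    using assms aplus_comm[of f "aneg C x"] by simp
  also have "\<dots> = (x \<boxplus> aneg C x) \<boxplus> f" using assms by (intro aplus_assoc[symmetric]) simp_all
  also have "\<dots> = f" using assms by simp
  finally show ?thesis .
qed

end

context abelian_category
begin

lemma sesD:
  assumes "ses C f g"
  shows "ker C g f" "epic C g" "monic C f" "arr C f" "arr C g" "tgt f = src g" "g \<star> f = azero C (src f) (tgt g)"
proof -
  show 1: "ker C g f" and 2: "epic C g" using assms unfolding ses_iff by blast+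
  show "monic C f" using kerD[OF 1] by blast
  show "arr C f" "arr C g" "tgt f = src g" "g \<star> f = azero C (src f) (tgt g)" using kerD[OF 1] by simp_all
qed

text \<open>The monic i does not change kernels, so the image of f is the kernel of the epic q, and
  q is the cokernel of that image. Applied to a resolution, cocycles on
  \<open>res_obj C M (Suc n)\<close> are the arrows that factor through the image of
  \<open>res_arr C M n\<close>.\<close>

lemma exact_factor_coker:
  assumes "exact C f g" and q: "epic C q" "monic C i" "tgt q = src i" "g = i \<star> q"
  shows "coker C f q"
proof -
  note X = exactD[OF assms(1)]
  obtain r k where r: "epic C r" "tgt r = src k" "f = k \<star> r" "ker C g k" using assms(1) unfolding exact_iff by blast
  note K = kerD[OF r(4)] note s = epicD[OF q(1)] monicD[OF q(2)] monicD[OF K(2)]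
  have sk: "tgt k = src q" using K(3) q(4) by simp
  have "ker C q k" unfolding ker_iff
  proof (intro conjI allI impI)
    have "i \<star> (q \<star> k) = azero C (src k) (tgt i)" using K(4) q(3,4) s sk by simp
    thus "q \<star> k = azero C (src k) (tgt q)" using monic_zeroD[OF q(2), of "q \<star> k"] s sk q(3) by simp
    fix t assume t: "arr C t" "tgt t = src q" "q \<star> t = azero C (src t) (tgt q)"
    have "g \<star> t = azero C (src t) (tgt g)" unfolding q(4) using acmp_reassoc[of i q g t] t q(3) s by simp
    thus "\<exists>u. arr C u \<and> src u = src t \<and> tgt u = src k \<and> k \<star> u = t"
      using ker_lift[OF r(4) t(1)] t(2) K(3) sk by metis
  qed (use K s sk in simp_all)
  thus "coker C f q"
    using exact_epic_coker[of f q] q(1) r(1-3) unfolding exact_iff by blast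
qed

end

context abelian_category_enough_projectives
begin

lemma ext_vanD:
  assumes "ext_van C n M N" "arr C f" "src f = res_obj C M (Suc n)" "tgt f = N"
    "f \<star> res_arr C M (Suc n) = azero C (res_obj C M (Suc (Suc n))) N"
  obtains g where "arr C g" "src g = res_obj C M n" "tgt g = N" "g \<star> res_arr C M n = f"
  using assms unfolding ext_van_def by blast

lemma res_lift:
  assumes "M \<in> obj C" "epic C e" "arr C f" "src f = res_obj C M n" "tgt f = tgt e"
  obtains h where "arr C h" "src h = res_obj C M n" "tgt h = src e" "e \<star> h = f"
  using projective_lift[OF resolution(1)[OF assms(1)] assms(2-5)] .

text \<open>Exactness of the long Ext sequence at its middle term, in degree n + 1. Over the
  quotient the cocycle x is a coboundary; its primitive lifts along g by projectivity, and what
  remains of x comes from the subobject.\<close>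

lemma ext_van_middle:
  assumes M: "M \<in> obj C" and s: "ses C f g" and v: "ext_van C n M (src f)" "ext_van C n M (tgt g)"
  shows "ext_van C n M (tgt f)"
  unfolding ext_van_def
proof (intro allI impI)
  note S = sesD[OF s]
  let ?d = "res_arr C M n" and ?d1 = "res_arr C M (Suc n)"
  fix x assume x: "arr C x" "src x = res_obj C M (Suc n)" "tgt x = tgt f"
    "x \<star> ?d1 = azero C (res_obj C M (Suc (Suc n))) (tgt f)"
  have "(g \<star> x) \<star> ?d1 = azero C (res_obj C M (Suc (Suc n))) (tgt g)"
    using x S M by simp
  then obtain y where y: "arr C y" "src y = res_obj C M n" "tgt y = tgt g" "y \<star> ?d = g \<star> x"
    using ext_vanD[OF v(2), of "g \<star> x"] x S by auto
  obtain z where z: "arr C z" "src z = res_obj C M n" "tgt z = src g" "g \<star> z = y"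
    using res_lift[OF M S(2) y(1,2)] y by auto
  \<comment> \<open>Subtracting the coboundary of z leaves the class of x unchanged but makes the
    cocycle vanish under g.\<close>
  define w where "w = x \<boxplus> aneg C (z \<star> ?d)"
  have w: "arr C w" "src w = src x" "tgt w = src g" using x z M S by (simp_all add: w_def)
  have "g \<star> (z \<star> ?d) = g \<star> x" using acmp_reassoc[OF z(4), of ?d] y(4) z S M by simp
  hence "g \<star> w = azero C (src w) (tgt g)" using x z S M by (simp add: w_def)
  then obtain u where u: "arr C u" "src u = src w" "tgt u = src f" "f \<star> u = w"
    using ker_lift[OF S(1) w(1)] w by auto
  have "f \<star> (u \<star> ?d1) = w \<star> ?d1" using acmp_reassoc[OF u(4), of ?d1] u w x M S by simp
  also have "\<dots> = azero C (res_obj C M (Suc (Suc n))) (tgt f)" using x z M S by (simp add: w_def)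
  finally have "u \<star> ?d1 = azero C (res_obj C M (Suc (Suc n))) (src f)"
    using monic_zeroD[OF S(3), of "u \<star> ?d1"] u w x M by simp
  then obtain t where t: "arr C t" "src t = res_obj C M n" "tgt t = src f" "t \<star> ?d = u"
    using ext_vanD[OF v(1) u(1)] u w x by metis
  have "(f \<star> t) \<star> ?d = w" using t u S M by simp
  hence "((f \<star> t) \<boxplus> z) \<star> ?d = w \<boxplus> z \<star> ?d" using t z S M by simp
  also have "\<dots> = x" using x z S M by (simp add: w_def aplus_assoc)
  finally show "\<exists>g. arr C g \<and> src g = res_obj C M n \<and> tgt g = tgt f \<and> g \<star> ?d = x"
    using t z S by (intro exI[of _ "(f \<star> t) \<boxplus> z"]) simp
qed

text \<open>The index jump is the connecting homomorphism: for 0 -> A -> B -> C -> 0 the group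
  Ext^{n+1}(M, C) lies between Ext^{n+1}(M, B) and Ext^{n+2}(M, A). With n = 0 it yields closure
  under cokernels of monomorphisms from vanishing of Ext^2.\<close>

lemma ext_van_right:
  assumes M: "M \<in> obj C" and s: "ses C f g" and v: "ext_van C n M (tgt f)" "ext_van C (Suc n) M (src f)"
  shows "ext_van C n M (tgt g)"
  unfolding ext_van_def
proof (intro allI impI)
  note S = sesD[OF s]
  let ?d = "res_arr C M n" and ?d1 = "res_arr C M (Suc n)" and ?d2 = "res_arr C M (Suc (Suc n))"
  fix x assume x: "arr C x" "src x = res_obj C M (Suc n)" "tgt x = tgt g"
    "x \<star> ?d1 = azero C (res_obj C M (Suc (Suc n))) (tgt g)"
  obtain y where y: "arr C y" "src y = res_obj C M (Suc n)" "tgt y = src g" "g \<star> y = x"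
    using res_lift[OF M S(2) x(1,2)] x by auto
  have yd: "arr C (y \<star> ?d1)" "tgt (y \<star> ?d1) = src g" using y M by simp_all
  have "g \<star> (y \<star> ?d1) = azero C (src (y \<star> ?d1)) (tgt g)"
    using acmp_reassoc[OF y(4), of ?d1] x y S M by simp
  \<comment> \<open>The cocycle u represents the image of x under the connecting homomorphism. A
    primitive t of u later corrects the lift y to a cocycle.\<close>
  then obtain u where u: "arr C u" "src u = src (y \<star> ?d1)" "tgt u = src f" "f \<star> u = y \<star> ?d1"
    using ker_lift[OF S(1) yd] by auto
  have us: "src u = res_obj C M (Suc (Suc n))" using u by simp
  have "f \<star> (u \<star> ?d2) = (y \<star> ?d1) \<star> ?d2" using acmp_reassoc[OF u(4), of ?d2] u(1,3) us M S by simp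
  also have "\<dots> = azero C (src ?d2) (tgt f)" using y M S by simp
  finally have "u \<star> ?d2 = azero C (src ?d2) (src f)"
    using monic_zeroD[OF S(3), of "u \<star> ?d2"] u(1,3) us M by simp
  then obtain t where t: "arr C t" "src t = res_obj C M (Suc n)" "tgt t = src f" "t \<star> ?d1 = u"
    using ext_vanD[OF v(2) u(1) us u(3)] by auto
  define w where "w = y \<boxplus> aneg C (f \<star> t)"
  have w: "arr C w" "src w = res_obj C M (Suc n)" "tgt w = tgt f" using y t S by (simp_all add: w_def)
  have "w \<star> ?d1 = azero C (res_obj C M (Suc (Suc n))) (tgt f)"
    using y t u M S by (simp add: w_def)
  then obtain z where z: "arr C z" "src z = res_obj C M n" "tgt z = tgt f" "z \<star> ?d = w"
    using ext_vanD[OF v(1) w] by auto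
  have "g \<star> (f \<star> t) = azero C (src t) (tgt g)" using acmp_reassoc[OF S(7), of t] t S by simp
  hence "g \<star> w = x" using x(1-3) y t S M by (simp add: w_def)
  hence "(g \<star> z) \<star> ?d = x" using z S M by simp
  thus "\<exists>h. arr C h \<and> src h = res_obj C M n \<and> tgt h = tgt g \<and> h \<star> ?d = x"
    using z S by (intro exI[of _ "g \<star> z"]) simp
qed

text \<open>In the long exact sequence Ext^{n+2}(M, A) lies between Ext^{n+1}(M, C) and Ext^{n+2}(M,
  B). With B injective this is dimension shifting.\<close>

lemma ext_van_shift:
  assumes M: "M \<in> obj C" and s: "ses C f g" and v: "ext_van C (Suc n) M (tgt f)" "ext_van C n M (tgt g)"
  shows "ext_van C (Suc n) M (src f)"
  unfolding ext_van_def
proof (intro allI impI)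
  note S = sesD[OF s]
  let ?d = "res_arr C M n" and ?d1 = "res_arr C M (Suc n)" and ?d2 = "res_arr C M (Suc (Suc n))"
  fix x assume x: "arr C x" "src x = res_obj C M (Suc (Suc n))" "tgt x = src f"
    "x \<star> ?d2 = azero C (res_obj C M (Suc (Suc (Suc n)))) (src f)"
  have "(f \<star> x) \<star> ?d2 = azero C (res_obj C M (Suc (Suc (Suc n)))) (tgt f)"
    using x S M by simp
  then obtain y where y: "arr C y" "src y = res_obj C M (Suc n)" "tgt y = tgt f" "y \<star> ?d1 = f \<star> x"
    using ext_vanD[OF v(1), of "f \<star> x"] x S by auto
  have "(g \<star> y) \<star> ?d1 = g \<star> (f \<star> x)" using y S M by simp
  also have "\<dots> = azero C (res_obj C M (Suc (Suc n))) (tgt g)" using acmp_reassoc[OF S(7), of x] x S by simp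
  finally obtain z where z: "arr C z" "src z = res_obj C M n" "tgt z = tgt g" "z \<star> ?d = g \<star> y"
    using ext_vanD[OF v(2), of "g \<star> y"] y S by auto
  obtain z' where z': "arr C z'" "src z' = res_obj C M n" "tgt z' = src g" "g \<star> z' = z"
    using res_lift[OF M S(2) z(1,2)] z by auto
  define w where "w = y \<boxplus> aneg C (z' \<star> ?d)"
  have w: "arr C w" "src w = res_obj C M (Suc n)" "tgt w = src g" using y z' M S by (simp_all add: w_def)
  have "g \<star> (z' \<star> ?d) = g \<star> y" using acmp_reassoc[OF z'(4), of ?d] z z' S M by simp
  hence "g \<star> w = azero C (src w) (tgt g)" using y z' S M by (simp add: w_def)
  then obtain u where u: "arr C u" "src u = src w" "tgt u = src f" "f \<star> u = w"
    using ker_lift[OF S(1) w(1)] w by auto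
  have "f \<star> (u \<star> ?d1) = w \<star> ?d1" using acmp_reassoc[OF u(4), of ?d1] u w M S by simp
  also have "\<dots> = f \<star> x" using x y z' M S by (simp add: w_def)
  finally have "u \<star> ?d1 = x" using monic_cancel[OF S(3), of "u \<star> ?d1" x] u(1-3) w x M by simp
  thus "\<exists>h. arr C h \<and> src h = res_obj C M (Suc n) \<and> tgt h = src f \<and> h \<star> ?d1 = x"
    using u w by auto
qed

text \<open>A cocycle factors through the image of the differential, a subobject of
  \<open>res_obj C M n\<close>, and an injective target lets the factor extend to the whole
  object.\<close>

lemma ext_van_injective:
  assumes M: "M \<in> obj C" and E: "is_injective C E"
  shows "ext_van C n M E"
  unfolding ext_van_def
proof (intro allI impI)
  let ?d = "res_arr C M n" and ?d1 = "res_arr C M (Suc n)"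
  fix x assume x: "arr C x" "src x = res_obj C M (Suc n)" "tgt x = E"
    "x \<star> ?d1 = azero C (res_obj C M (Suc (Suc n))) E"
  obtain q i where qi: "epic C q" "monic C i" "tgt q = src i" "?d = i \<star> q"
    using ex_image[OF arr_res_arr[OF M]] .
  note q = qi exact_factor_coker[OF resolution(4)[OF M] qi] epicD[OF qi(1)] monicD[OF qi(2)]
  obtain y where y: "arr C y" "src y = tgt q" "tgt y = E" "y \<star> q = x"
    using coker_desc[OF q(5) x(1)] x by auto
  obtain h where h: "arr C h" "src h = tgt i" "tgt h = E" "h \<star> i = y"
    using injective_extend[OF E q(2) y(1)] y q(3) by metis
  have "tgt i = res_obj C M n" using q(4) by (metis tgt_acmp tgt_res_arr)
  moreover have "h \<star> ?d = x" unfolding q(4) using acmp_reassoc[OF h(4), of q] h y q(3,6,7) by simp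
  ultimately show "\<exists>h. arr C h \<and> src h = res_obj C M n \<and> tgt h = E \<and> h \<star> ?d = x"
    using h by auto
qed

text \<open>For k the kernel of an epimorphism from a projective onto M, this says that Ext^1(M, N)
  vanishes, without reference to a chosen resolution.\<close>

definition extends :: "('a, 'b) arrow \<Rightarrow> 'a \<Rightarrow> bool" where
  "extends k N \<longleftrightarrow> (\<forall>f. arr C f \<longrightarrow> src f = src k \<longrightarrow> tgt f = N \<longrightarrow>
     (\<exists>g. arr C g \<and> src g = tgt k \<and> tgt g = N \<and> g \<star> k = f))"

text \<open>Projectivity gives a and b between the two projectives over their common quotient, and
  these induce a' and b' on kernels. Now e' kills 1 - b a, so 1 - b a = k' h for some h, and
  restricting along k' gives h k' = 1 - b' a'. Hence f = f b' a' + f h k'. The second summand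
  visibly extends along k'; for the first, extend f b' to y along k, so that f b' a' = y k a' = y a
  k'.\<close>

lemma extends_independent:
  assumes e: "epic C e" "is_projective C (src e)" "ker C e k"
    and e': "epic C e'" "is_projective C (src e')" "ker C e' k'" and t: "tgt e' = tgt e"
    and x: "extends k N"
  shows "extends k' N"
  unfolding extends_def
proof (intro allI impI)
  fix f assume f: "arr C f" "src f = src k'" "tgt f = N"
  note K = kerD[OF e(3)] note K' = kerD[OF e'(3)] note s = monicD[OF K(2)] monicD[OF K'(2)]
  obtain a where a: "arr C a" "src a = src e'" "tgt a = src e" "e \<star> a = e'"
    using projective_lift[OF e'(2) e(1) K'(1) refl t] .
  obtain b where b: "arr C b" "src b = src e" "tgt b = src e'" "e' \<star> b = e"
    using projective_lift[OF e(2) e'(1) K(1) refl t[symmetric]] .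
  have "e \<star> (a \<star> k') = azero C (src (a \<star> k')) (tgt e)"
    using acmp_reassoc[OF a(4), of k'] a K K' s t by simp
  then obtain a' where a': "arr C a'" "src a' = src k'" "tgt a' = src k" "k \<star> a' = a \<star> k'"
    using ker_lift[OF e(3), of "a \<star> k'"] a s K' by auto
  have "e' \<star> (b \<star> k) = azero C (src (b \<star> k)) (tgt e')"
    using acmp_reassoc[OF b(4), of k] b K K' s t by simp
  then obtain b' where b': "arr C b'" "src b' = src k" "tgt b' = src k'" "k' \<star> b' = b \<star> k"
    using ker_lift[OF e'(3), of "b \<star> k"] b s K by auto
  have "arr C (f \<star> b')" "src (f \<star> b') = src k" "tgt (f \<star> b') = N" using f b' by simp_all
  then obtain y where y: "arr C y" "src y = tgt k" "tgt y = N" "y \<star> k = f \<star> b'"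
    using x unfolding extends_def by blast
  have o: "src e' \<in> obj C" using K' by simp
  define w where "w = aid C (src e') \<boxplus> aneg C (b \<star> a)"
  have w: "arr C w" "src w = src e'" "tgt w = src e'" using a b o by (simp_all add: w_def)
  have "e' \<star> (b \<star> a) = e'" using acmp_reassoc[OF b(4), of a] a b K' by simp
  hence "e' \<star> w = azero C (src w) (tgt e')" using a b K' o by (simp add: w_def)
  then obtain h where h: "arr C h" "src h = src e'" "tgt h = src k'" "k' \<star> h = w"
    using ker_lift[OF e'(3) w(1)] w by auto
  have "k' \<star> (h \<star> k') = w \<star> k'" using acmp_reassoc[OF h(4), of k'] h s K' by simp
  also have "\<dots> = k' \<boxplus> aneg C (b \<star> (a \<star> k'))" using a b s o K' by (simp add: w_def)
  also have "b \<star> (a \<star> k') = k' \<star> (b' \<star> a')"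
    unfolding a'(4)[symmetric] using acmp_reassoc[OF b'(4)[symmetric], of a'] b b'(1-3) a'(1-3) s K by simp
  also have "k' \<boxplus> aneg C (k' \<star> (b' \<star> a')) = k' \<star> (aid C (src k') \<boxplus> aneg C (b' \<star> a'))"
    using s a' b' by simp
  finally have "h \<star> k' = aid C (src k') \<boxplus> aneg C (b' \<star> a')"
    using monic_cancel[OF K'(2)] h s K' a' b' by simp
  hence "f \<star> (h \<star> k') = f \<boxplus> aneg C (f \<star> (b' \<star> a'))" using f h s K' a' b' by simp
  moreover have "y \<star> (a \<star> k') = f \<star> (b' \<star> a')"
    unfolding a'(4)[symmetric] using acmp_reassoc[OF y(4), of a'] y f b' a'(1-3) s by simp
  ultimately have "((y \<star> a) \<boxplus> (f \<star> h)) \<star> k' = f \<star> (b' \<star> a') \<boxplus> (f \<boxplus> aneg C (f \<star> (b' \<star> a')))"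
    using y a f h s K K' by simp
  also have "\<dots> = f" using f a' b' by (intro aplus_aneg_cancel) simp_all
  finally show "\<exists>g. arr C g \<and> src g = tgt k' \<and> tgt g = N \<and> g \<star> k' = f"
    using y a f h K K' by (intro exI[of _ "(y \<star> a) \<boxplus> (f \<star> h)"]) simp
qed

text \<open>For the chosen resolution, the cocycles of degree 1 are the arrows out of the kernel i
  of the augmentation, composed with the epic q, and being a coboundary means extending along i.
  Independence of the presentation then replaces i by k.\<close>

lemma ext_van_iff_extends:
  assumes M: "M \<in> obj C" and e: "epic C e" "is_projective C (src e)" "ker C e k" "tgt e = M"
  shows "ext_van C 0 M N \<longleftrightarrow> extends k N"
proof -
  let ?a = "res_aug C M" and ?d = "res_arr C M 0" and ?d1 = "res_arr C M (Suc 0)"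
  obtain k0 where k0: "ker C ?a k0" using ex_ker M by fastforce
  note K = kerD[OF k0] note ka = monicD[OF K(2)]
  obtain q i where q: "epic C q" "tgt q = src i" "?d = i \<star> q" "ker C ?a i"
    using resolution(3)[OF M] unfolding exact_iff by blast
  note I = kerD[OF q(4)] note ia = monicD[OF I(2)]
  have x: "exact C ?d1 ?d" using resolution(4)[OF M] .
  have sq: "src q = res_obj C M (Suc 0)" using q(3) by (metis src_acmp src_res_arr)
  have qd: "q \<star> ?d1 = azero C (src ?d1) (tgt q)"
  proof -
    have "i \<star> (q \<star> ?d1) = azero C (src ?d1) (tgt i)"
      using acmp_reassoc[OF q(3)[symmetric], of ?d1] q(1,2) ia sq M I by simp
    thus ?thesis using monic_zeroD[OF I(2), of "q \<star> ?d1"] q sq M by simp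
  qed
  have cq: "coker C ?d1 q" using exact_factor_coker[OF x q(1) I(2) q(2,3)] .
  have "ext_van C 0 M N \<longleftrightarrow> extends i N"
  proof
    assume v: "ext_van C 0 M N"
    show "extends i N" unfolding extends_def
    proof (intro allI impI)
      fix f assume f: "arr C f" "src f = src i" "tgt f = N"
      have "(f \<star> q) \<star> ?d1 = azero C (res_obj C M (Suc (Suc 0))) N" using f q(1,2) qd sq M by simp
      then obtain g where g: "arr C g" "src g = res_obj C M 0" "tgt g = N" "g \<star> ?d = f \<star> q"
        using ext_vanD[OF v, of "f \<star> q"] f q sq by auto
      have ti: "tgt i = res_obj C M 0" using I by simp
      have "(g \<star> i) \<star> q = f \<star> q" using g q ia ti by simp
      hence "g \<star> i = f" using epic_cancel[OF q(1)] g f ia q(2) ti by simp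
      thus "\<exists>g. arr C g \<and> src g = tgt i \<and> tgt g = N \<and> g \<star> i = f" using g ti by auto
    qed
  next
    assume v: "extends i N"
    show "ext_van C 0 M N" unfolding ext_van_def
    proof (intro allI impI)
      fix f assume f: "arr C f" "src f = res_obj C M (Suc 0)" "tgt f = N" "f \<star> ?d1 = azero C (res_obj C M (Suc (Suc 0))) N"
      obtain h where h: "arr C h" "src h = tgt q" "tgt h = N" "h \<star> q = f"
        using coker_desc[OF cq f(1)] f by auto
      obtain g where g: "arr C g" "src g = tgt i" "tgt g = N" "g \<star> i = h"
        using v h q(2) unfolding extends_def by metis
      have "g \<star> ?d = f" unfolding q(3) using acmp_reassoc[OF g(4), of q] g h q ia by simp
      thus "\<exists>g. arr C g \<and> src g = res_obj C M 0 \<and> tgt g = N \<and> g \<star> ?d = f" using g I by auto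
    qed
  qed
  also have "\<dots> \<longleftrightarrow> extends k N"
    using extends_independent[OF resolution(2)[OF M] _ q(4) e(1-3)]
      extends_independent[OF e(1-3) resolution(2)[OF M] _ q(4)] resolution(1)[OF M] e(4) by auto
  finally show ?thesis .
qed

section \<open>Orthogonal classes and a criterion for cotorsion pairs\<close>

lemma in_right_perp_iff:
  assumes "S \<subseteq> obj C"
  shows "N \<in> right_perp C S \<longleftrightarrow> N \<in> obj C \<and> (\<forall>M\<in>S. ext_van C 0 M N)"
  unfolding right_perp_def using assms trivial_Ext_iff[of _ N 0, unfolded One_nat_def[symmetric]] by blast

lemma in_left_perp_iff:
  assumes "S \<subseteq> obj C"
  shows "N \<in> left_perp C S \<longleftrightarrow> N \<in> obj C \<and> (\<forall>M\<in>S. ext_van C 0 N M)"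
  unfolding left_perp_def using assms trivial_Ext_iff[of N _ 0, unfolded One_nat_def[symmetric]] by blast

lemma right_perp_middle:
  assumes S: "S \<subseteq> obj C" and s: "ses C f g" and R: "src f \<in> right_perp C S" "tgt g \<in> right_perp C S"
  shows "tgt f \<in> right_perp C S"
  using R ext_van_middle[OF _ s] S arr_tgt[OF sesD(4)[OF s]] unfolding in_right_perp_iff[OF S] by blast

text \<open>Salce's trick: a special preenvelope of an object is obtained by pulling back a special precover
  of its first cosyzygy.\<close>

theorem cotorsion_pair_criterion:
  assumes inj: "enough_injectives C" and S: "S \<subseteq> obj C" and R: "R = right_perp C S"
    and closed: "\<And>f g. ses C f g \<Longrightarrow> src f \<in> R \<Longrightarrow> tgt f \<in> R \<Longrightarrow> tgt g \<in> R"
    and precover: "\<And>E. E \<in> obj C \<Longrightarrow> \<exists>f g. ses C f g \<and> tgt g = E \<and> src f \<in> R \<and> tgt f \<in> left_perp C R"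
  shows "hereditary_complete_cotorsion_pair C (left_perp C R) R"
proof -
  have RC: "R \<subseteq> obj C" unfolding R right_perp_def by blast
  have LC: "left_perp C R \<subseteq> obj C" unfolding left_perp_def by blast
  have SL: "S \<subseteq> left_perp C R"
    using S in_left_perp_iff[OF RC] in_right_perp_iff[OF S] R by blast
  \<comment> \<open>The Galois connection of the two orthogonals: a larger class has a smaller right
    orthogonal, so the right orthogonal of \<open>left_perp C R\<close> lies in that of S, which is
    R.\<close>
  have RL: "R = right_perp C (left_perp C R)"
    using SL RC in_left_perp_iff[OF RC] in_right_perp_iff[OF S] in_right_perp_iff[OF LC] R by blast
  \<comment> \<open>Injectives lie in every right orthogonal class. The same embedding feeds both
    the preenvelopes and the dimension shift.\<close>
  have embed: "\<exists>m c. ses C m c \<and> src m = E \<and> is_injective C (tgt m) \<and> tgt m \<in> R" if E: "E \<in> obj C" for E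
  proof -
    obtain I m' where I: "is_injective C I" "is_mono C E I m'"
      using inj E unfolding enough_injectives_def by blast
    define m where "m = Arrow E m' I"
    have m: "monic C m" "src m = E" "tgt m = I" using I by (simp_all add: monic_def m_def)
    obtain c where c: "coker C m c" using ex_coker m by fastforce
    have "ses C m c" unfolding ses_iff using ker_of_coker[OF m(1) c] cokerD[OF c] by blast
    moreover have "I \<in> R" unfolding R in_right_perp_iff[OF S]
      using ext_van_injective I S by (auto simp: is_injective_def)
    ultimately show ?thesis using m I by blast
  qed
  have cot: "cotorsion_pair C (left_perp C R) R"
    unfolding cotorsion_pair_def using RC LC RL by blast
  have comp: "complete_pair C (left_perp C R) R"
    unfolding complete_pair_def
  proof (intro ballI conjI)
    fix E assume E: "E \<in> obj C"
    obtain f g where "ses C f g" "tgt g = E" "src f \<in> R" "tgt f \<in> left_perp C R" using precover[OF E] by blast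
    thus "\<exists>Y\<in>R. \<exists>X\<in>left_perp C R. \<exists>f g. short_exact C Y X E f g"
      unfolding ses_def by blast
    obtain m c where m: "ses C m c" "src m = E" "tgt m \<in> R" using embed[OF E] by blast
    note M = sesD[OF m(1)]
    obtain f g where fg: "ses C f g" "tgt g = tgt c" "src f \<in> R" "tgt f \<in> left_perp C R"
      using precover[OF arr_tgt[OF M(5)]] by blast
    note G = sesD[OF fg(1)]
    \<comment> \<open>The pullback object has two filtrations: it extends \<open>tgt f\<close> by E,
      which is the wanted sequence, and it extends the injective object by \<open>src f\<close>,
      which places it in R.\<close>
    obtain a b where p: "pullback C c g a b" using ex_pullback[OF M(5) G(5) fg(2)] .
    note P = pullbackD[OF p]
    have b: "epic C b" and a: "epic C a"
      using pullback_epic[OF p M(2)] pullback_epic[OF pullback_sym[OF p] G(2)] by blast+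
    obtain n where n: "ker C b n" "src n = src m" using pullback_ker[OF p M(1)] by blast
    obtain n' where n': "ker C a n'" "src n' = src f" using pullback_ker[OF pullback_sym[OF p] G(1)] by blast
    have sn: "ses C n b" "ses C n' a" unfolding ses_iff using n n' a b by blast+
    have "tgt a \<in> R" using P(7) m(3) M(6) by simp
    hence "tgt n' \<in> R" using right_perp_middle[OF S sn(2)] n'(2) fg(3) R by simp
    moreover have "tgt n = tgt n'" using kerD(3)[OF n(1)] kerD(3)[OF n'(1)] P(6) by simp
    moreover have "tgt b \<in> left_perp C R" using P(8) G(6) fg(4) by simp
    moreover have "short_exact C E (tgt n) (tgt b) (mor n) (mor b)"
      using sn(1) n(2) m(2) unfolding ses_def by metis
    ultimately show "\<exists>Y\<in>R. \<exists>X\<in>left_perp C R. \<exists>f g. short_exact C E Y X f g" by metis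
  qed
  \<comment> \<open>Y must vary in the induction: raising the degree by one replaces Y by its
    cosyzygy \<open>tgt c\<close>, which stays in R by \<open>closed\<close>.\<close>
  have van: "ext_van C n X Y" if "X \<in> left_perp C R" "Y \<in> R" for X Y n
    using that
  proof (induction n arbitrary: Y)
    case 0
    thus ?case using in_left_perp_iff[OF RC] by blast
  next
    case (Suc n)
    have X: "X \<in> obj C" using Suc.prems LC by blast
    obtain m c where m: "ses C m c" "src m = Y" "is_injective C (tgt m)" "tgt m \<in> R"
      using embed Suc.prems RC by blast
    have "tgt c \<in> R" using closed[OF m(1)] m Suc.prems by simp
    hence "ext_van C n X (tgt c)" using Suc by blast
    thus ?case using ext_van_shift[OF X m(1)] ext_van_injective[OF X m(3)] m(2) by simp
  qed
  have "hereditary_pair C (left_perp C R) R"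
    unfolding hereditary_pair_def
  proof (intro allI impI ballI)
    fix i :: nat and X Y assume "1 \<le> i" "X \<in> left_perp C R" "Y \<in> R"
    moreover then obtain n where "i = Suc n" by (cases i) auto
    ultimately show "trivial_group (Ext C i X Y)" using van trivial_Ext_iff RC LC by blast
  qed
  thus ?thesis unfolding hereditary_complete_cotorsion_pair_def using cot comp by blast
qed

end

section \<open>Zero objects, zero cokernels and zero homology\<close>

context preadditive_category
begin

text \<open>Each arrow into or out of Z is its composite with the identity of Z, so a vanishing
  identity collapses the hom-sets. Being a single equation, this form passes easily between B and
  the extension.\<close>

lemma is_zero_iff: "is_zero C Z \<longleftrightarrow> Z \<in> obj C \<and> aid C Z = azero C Z Z"
proof
  assume z: "is_zero C Z"
  hence Z: "Z \<in> obj C" and u: "\<exists>!f. f \<in> homs C Z Z" unfolding is_zero_def by blast+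
  have "mor (aid C Z) \<in> homs C Z Z" "mor (azero C Z Z) \<in> homs C Z Z"
    using arr_mor[OF arr_aid[OF Z]] arr_mor[OF arr_azero[OF Z Z]] by simp_all
  hence "mor (aid C Z) = mor (azero C Z Z)" using u by blast
  thus "Z \<in> obj C \<and> aid C Z = azero C Z Z" using Z by (simp add: arrow.expand)
next
  assume z: "Z \<in> obj C \<and> aid C Z = azero C Z Z"
  hence Z: "Z \<in> obj C" and e: "aid C Z = azero C Z Z" by blast+
  show "is_zero C Z" unfolding is_zero_def
  proof (intro conjI ballI)
    fix X assume X: "X \<in> obj C"
    have mz: "mor (azero C Z X) \<in> homs C Z X" "mor (azero C X Z) \<in> homs C X Z"
      using arr_mor[OF arr_azero[OF Z X]] arr_mor[OF arr_azero[OF X Z]] by simp_all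
    have "f = mor (azero C Z X)" if "f \<in> homs C Z X" for f
    proof -
      have a: "arr C (Arrow Z f X)" using that X Z by (simp add: arr_def del: arr_src arr_tgt)
      have "Arrow Z f X \<star> aid C Z = Arrow Z f X \<star> azero C Z Z" using e by simp
      hence "Arrow Z f X = azero C Z X" using a Z by simp
      thus ?thesis by (metis arrow.sel(2))
    qed
    thus "\<exists>!f. f \<in> homs C Z X" using mz by blast
    have "f = mor (azero C X Z)" if "f \<in> homs C X Z" for f
    proof -
      have a: "arr C (Arrow X f Z)" using that X Z by (simp add: arr_def del: arr_src arr_tgt)
      have "aid C Z \<star> Arrow X f Z = azero C Z Z \<star> Arrow X f Z" using e by simp
      hence "Arrow X f Z = azero C X Z" using a Z by simp
      thus ?thesis by (metis arrow.sel(2))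
    qed
    thus "\<exists>!f. f \<in> homs C X Z" using mz by blast
  qed (rule Z)
qed

lemma coker_zero_epic:
  assumes c: "coker C f c" and z: "is_zero C (tgt c)"
  shows "epic C f"
  unfolding epic_iff_zero
proof (intro conjI allI impI)
  note D = cokerD[OF c] note ca = epicD[OF D(2)]
  show "arr C f" by (rule D)
  have "aid C (tgt c) \<star> c = azero C (tgt c) (tgt c) \<star> c" using z unfolding is_zero_iff by simp
  hence cz: "c = azero C (tgt f) (tgt c)" using ca D(3) by simp
  fix u assume u: "arr C u" "src u = tgt f" "u \<star> f = azero C (src f) (tgt u)"
  obtain v where v: "arr C v" "src v = tgt c" "tgt v = tgt u" "v \<star> c = u" using coker_desc[OF c u] .
  have "u = v \<star> azero C (tgt f) (tgt c)" using v(4) cz by simp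
  thus "u = azero C (tgt f) (tgt u)" using v(1-3) D(1) by simp
qed

lemma ker_zero_monic:
  assumes k: "ker C f k" and z: "k = azero C (src k) (src f)"
  shows "monic C f"
  unfolding monic_iff_zero
proof (intro conjI allI impI)
  note D = kerD[OF k] note ka = monicD[OF D(2)]
  show "arr C f" by (rule D)
  fix u assume u: "arr C u" "tgt u = src f" "f \<star> u = azero C (src u) (tgt f)"
  obtain v where v: "arr C v" "src v = src u" "tgt v = src k" "k \<star> v = u" using ker_lift[OF k u] .
  have "u = azero C (src k) (src f) \<star> v" using v(4) z by metis
  thus "u = azero C (src u) (src f)" using v(1-3) D(1) by simp
qed

lemma biprod_is_biproduct:
  assumes "biprod C i j p q"
  shows "is_biproduct C (src i) (src j) (tgt i) (mor i) (mor j) (mor p) (mor q)"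
  using biprodD[OF assms] arr_tgt[of C i] arr_mor[of C i] arr_mor[of C j] arr_mor[of C p] arr_mor[of C q]
  unfolding is_biproduct_def by (simp add: acmp_def aplus_def aid_def azero_def)

end

context abelian_category
begin

text \<open>The image i of f has the same cokernel as f because the epic part can be cancelled, and
  a monomorphism is the kernel of its cokernel.\<close>

lemma coker_exact:
  assumes c: "coker C f c"
  shows "exact C f c"
proof -
  note D = cokerD[OF c] note ca = epicD[OF D(2)]
  obtain q i where q: "epic C q" "monic C i" "tgt q = src i" "f = i \<star> q" using ex_image[OF D(1)] .
  note s = epicD[OF q(1)] monicD[OF q(2)]
  have sc: "src c = tgt i" using D(3) q(4) by simp
  have "coker C i c" unfolding coker_iff
  proof (intro conjI allI impI)
    have "(c \<star> i) \<star> q = azero C (src q) (tgt c)" using D(4) s ca sc q(3,4) by simp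
    thus "c \<star> i = azero C (src i) (tgt c)" using epic_zeroD[OF q(1), of "c \<star> i"] s ca sc q(3) by simp
    fix t assume t: "arr C t" "src t = tgt i" "t \<star> i = azero C (src i) (tgt t)"
    have "t \<star> f = azero C (src f) (tgt t)" unfolding q(4) using acmp_reassoc[OF t(3), of q] t s q(3) by simp
    thus "\<exists>u. arr C u \<and> src u = tgt c \<and> tgt u = tgt t \<and> u \<star> c = t"
      using coker_desc[OF c t(1)] t(2) q(4) tgt_acmp by metis
  qed (use D s sc in simp_all)
  hence "ker C c i" using ker_of_coker[OF q(2)] by blast
  thus ?thesis unfolding exact_iff using q by blast
qed

end

context abelian_category
begin

text \<open>Homology is the cokernel of the arrow that f induces into the kernel of g. If it is
  zero, that arrow is epic and gives the image factorization required by exactness.\<close>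

lemma homology_zero_exact:
  assumes f: "arr C f" and g: "arr C g" and t: "tgt f = src g" and z: "g \<star> f = azero C (src f) (tgt g)"
    and h: "is_zero C (homology C (src f) (tgt f) (tgt g) (mor f) (mor g))"
  shows "exact C f g"
proof -
  obtain k where k: "ker C g k" using ex_ker[OF g] by blast
  obtain u where u: "arr C u" "src u = src f" "tgt u = src k" "k \<star> u = f" using ker_lift[OF k f t z] .
  obtain c where c: "coker C u c" using ex_coker[OF u(1)] by blast
  \<comment> \<open>\<open>homology\<close> is a choice, so one homology object must be exhibited
    before the chosen one can be unpacked.\<close>
  have "is_homology C (src f) (tgt f) (tgt g) (mor f) (mor g) (tgt c)"
    unfolding is_homology_def
  proof (intro exI conjI)
    show "is_kernel C (tgt f) (tgt g) (mor g) (src k) (mor k)" using k t unfolding ker_def by simp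
    show "mor u \<in> homs C (src f) (src k)" using arr_mor[OF u(1)] u by simp
    show "mor k \<cdot> mor u = mor f" using arg_cong[OF u(4), of mor] by (simp add: acmp_def)
    show "is_cokernel C (src f) (src k) (mor u) (tgt c) (mor c)" using c u unfolding coker_def by simp
  qed
  hence "is_homology C (src f) (tgt f) (tgt g) (mor f) (mor g) (homology C (src f) (tgt f) (tgt g) (mor f) (mor g))"
    unfolding homology_def by (rule someI)
  then obtain K k' u' c' where *: "is_kernel C (tgt f) (tgt g) (mor g) K k'" "u' \<in> homs C (src f) K"
    "k' \<cdot> u' = mor f" "is_cokernel C (src f) K u' (homology C (src f) (tgt f) (tgt g) (mor f) (mor g)) c'"
    unfolding is_homology_def by blast
  have "ker C g (Arrow K k' (src g))" using *(1) t by (simp add: ker_def)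
  moreover have "coker C (Arrow (src f) u' K) (Arrow K c' (homology C (src f) (tgt f) (tgt g) (mor f) (mor g)))"
    using *(4) by (simp add: coker_def)
  hence "epic C (Arrow (src f) u' K)" using coker_zero_epic h by fastforce
  moreover have "f = Arrow K k' (src g) \<star> Arrow (src f) u' K" using *(3) t by (simp add: acmp_def arrow.expand)
  ultimately show ?thesis unfolding exact_iff by (metis arrow.sel(1,3))
qed

end

section \<open>Functors\<close>

definition fmap :: "('o, 'm, 'p, 'n) fctr \<Rightarrow> ('o, 'm) arrow \<Rightarrow> ('p, 'n) arrow" where
  "fmap F f = Arrow (on_obj F (src f)) (on_mor F (mor f)) (on_obj F (tgt f))"

lemma src_fmap [simp]: "src (fmap F f) = on_obj F (src f)"
  and tgt_fmap [simp]: "tgt (fmap F f) = on_obj F (tgt f)"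
  by (simp_all add: fmap_def)

context additive_functor
begin

declare F_obj [simp]

lemma arr_fmap [simp]: "arr C f \<Longrightarrow> arr D (fmap F f)"
  unfolding arr_def fmap_def using F_obj F_mor by simp

lemma fmap_acmp [simp]:
  "\<lbrakk>arr C f; arr C g; tgt f = src g\<rbrakk> \<Longrightarrow> fmap F (g \<star>\<^bsub>C\<^esub> f) = fmap F g \<star>\<^bsub>D\<^esub> fmap F f"
  unfolding arr_def fmap_def acmp_def using F_comp[of "src f" "src g" "tgt g" "mor f" "mor g"] by simp

lemma fmap_aid [simp]: "X \<in> obj C \<Longrightarrow> fmap F (aid C X) = aid D (on_obj F X)"
  by (simp add: fmap_def aid_def F_id)

lemma fmap_aplus [simp]:
  "\<lbrakk>arr C f; arr C g; src g = src f; tgt g = tgt f\<rbrakk>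
     \<Longrightarrow> fmap F (f \<boxplus>\<^bsub>C\<^esub> g) = fmap F f \<boxplus>\<^bsub>D\<^esub> fmap F g"
  unfolding arr_def fmap_def aplus_def using F_add[of "src f" "tgt f" "mor f" "mor g"] by simp

lemma fmap_azero [simp]:
  assumes "preadditive_category C" "preadditive_category D" "X \<in> obj C" "Y \<in> obj C"
  shows "fmap F (azero C X Y) = azero D (on_obj F X) (on_obj F Y)"
proof -
  interpret C: preadditive_category C by fact
  interpret D: preadditive_category D by fact
  let ?z = "azero C X Y"
  have z: "arr C ?z" using assms by simp
  have "fmap F (?z \<boxplus>\<^bsub>C\<^esub> ?z) = fmap F ?z \<boxplus>\<^bsub>D\<^esub> fmap F ?z" using z by (intro fmap_aplus) simp_all
  moreover have "?z \<boxplus>\<^bsub>C\<^esub> ?z = ?z" using z by simp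
  ultimately have "fmap F ?z \<boxplus>\<^bsub>D\<^esub> fmap F ?z = fmap F ?z" by simp
  from D.aplus_idem[OF this] show ?thesis using z by simp
qed

end

locale right_exact_endofunctor = abelian_category B + right_exact_functor B B F
  for B :: "('o, 'm) precat" and F :: "('o, 'm, 'o, 'm) fctr"
begin

lemma fmap_azero' [simp]:
  "\<lbrakk>X \<in> obj B; Y \<in> obj B\<rbrakk> \<Longrightarrow> fmap F (azero B X Y) = azero B (on_obj F X) (on_obj F Y)"
  using fmap_azero preadditive_category_axioms by blast

lemma fmap_ses:
  assumes "ses B f g"
  shows "exact B (fmap F f) (fmap F g)" "epic B (fmap F g)"
  using F_right_exact[of "src f" "tgt f" "tgt g" "mor f" "mor g"] assms
  unfolding ses_def exact_def epic_def fmap_def by auto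

lemma fmap_epic:
  assumes "epic B g"
  shows "epic B (fmap F g)"
proof -
  obtain k where k: "ker B g k" using ex_ker epicD[OF assms] by blast
  have "ses B k g" unfolding ses_iff using k assms by blast
  thus ?thesis by (rule fmap_ses)
qed

text \<open>Right exactness is stated for short exact sequences only. Replacing f by its image
  produces one; F q stays epic, so F f and F i have the same image.\<close>

lemma fmap_exact:
  assumes "exact B f g" "epic B g"
  shows "exact B (fmap F f) (fmap F g)"
proof -
  obtain q i where q: "epic B q" "tgt q = src i" "f = i \<star>\<^bsub>B\<^esub> q" "ker B g i" using assms(1) unfolding exact_iff by blast
  have "ses B i g" unfolding ses_iff using q assms by blast
  then obtain r j where r: "epic B r" "tgt r = src j" "fmap F i = j \<star>\<^bsub>B\<^esub> r" "ker B (fmap F g) j"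
    using fmap_ses(1) unfolding exact_iff by blast
  note i = monicD[OF kerD(2)[OF q(4)]] and j = monicD[OF kerD(2)[OF r(4)]]
  have sr: "src r = on_obj F (src i)" using r(3) by (metis src_acmp src_fmap)
  have "fmap F f = fmap F i \<star>\<^bsub>B\<^esub> fmap F q" unfolding q(3) using q i by simp
  also have "\<dots> = j \<star>\<^bsub>B\<^esub> (r \<star>\<^bsub>B\<^esub> fmap F q)" unfolding r(3) using q(1,2) j r(1,2) sr by simp
  finally show ?thesis unfolding exact_iff
    using r(4) epic_acmp[OF fmap_epic[OF q(1)] r(1)] sr q(2) r(2) by (intro exI[of _ "r \<star>\<^bsub>B\<^esub> fmap F q"] exI[of _ j]) simp
qed

text \<open>This form of right exactness puts a structure morphism on a cokernel taken in B.\<close>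

lemma fmap_coker: "coker B f c \<Longrightarrow> coker B (fmap F f) (fmap F c)"
  using exact_epic_coker fmap_exact fmap_epic coker_exact cokerD(2) by blast

end


section \<open>The extension is abelian\<close>

locale eta_extension_data = right_exact_endofunctor +
  fixes \<eta> :: "'o \<Rightarrow> 'm"
  assumes assoc: "associative_transformation B F \<eta>"
begin

abbreviation A :: "('o \<times> 'm, 'm) precat" where "A \<equiv> eta_extension B F \<eta>"

definition eta_arr :: "'o \<Rightarrow> ('o, 'm) arrow" where
  "eta_arr X = Arrow (on_obj F (on_obj F X)) (\<eta> X) (on_obj F X)"

definition str :: "'o \<times> 'm \<Rightarrow> ('o, 'm) arrow" where
  "str X = Arrow (on_obj F (fst X)) (snd X) (fst X)"

definition U :: "('o \<times> 'm, 'm) arrow \<Rightarrow> ('o, 'm) arrow" where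
  "U f = Arrow (fst (src f)) (mor f) (fst (tgt f))"

text \<open>Places a morphism of B between two objects of the extension, whether or not it respects
  the structure morphisms; \<open>arr_A_lftI\<close> gives the condition.\<close>

definition lft :: "'o \<times> 'm \<Rightarrow> ('o, 'm) arrow \<Rightarrow> 'o \<times> 'm \<Rightarrow> ('o \<times> 'm, 'm) arrow" where
  "lft X u Y = Arrow X (mor u) Y"

lemma src_eta_arr [simp]: "src (eta_arr X) = on_obj F (on_obj F X)"
  and tgt_eta_arr [simp]: "tgt (eta_arr X) = on_obj F X"
  and src_str [simp]: "src (str P) = on_obj F (fst P)"
  and tgt_str [simp]: "tgt (str P) = fst P"
  and src_U [simp]: "src (U f) = fst (src f)"
  and tgt_U [simp]: "tgt (U f) = fst (tgt f)"
  and src_lft [simp]: "src (lft P u Q) = P"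
  and tgt_lft [simp]: "tgt (lft P u Q) = Q"
  by (simp_all add: eta_arr_def str_def U_def lft_def)

lemma U_lft [simp]: "\<lbrakk>src u = fst P; tgt u = fst Q\<rbrakk> \<Longrightarrow> U (lft P u Q) = u"
  by (cases u) (simp add: U_def lft_def)

lemma U_acmp [simp]: "U (g \<star>\<^bsub>A\<^esub> f) = U g \<star>\<^bsub>B\<^esub> U f"
  and U_aplus [simp]: "U (f \<boxplus>\<^bsub>A\<^esub> g) = U f \<boxplus>\<^bsub>B\<^esub> U g"
  and U_aid [simp]: "U (aid A P) = aid B (fst P)"
  and U_azero [simp]: "U (azero A P Q) = azero B (fst P) (fst Q)"
  by (cases P; cases Q; simp add: U_def acmp_def aplus_def aid_def azero_def eta_extension_def)+

text \<open>The underlying functor is the identity on bare morphisms. This faithfulness reduces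
  identities in the extension to identities in B.\<close>

lemma U_inject: "\<lbrakk>U f = U g; src f = src g; tgt f = tgt g\<rbrakk> \<Longrightarrow> f = g"
  by (cases f; cases g) (simp add: U_def)

lemma arr_eta_arr [simp]: "X \<in> obj B \<Longrightarrow> arr B (eta_arr X)"
  using assoc unfolding associative_transformation_def natural_transformation_def
  by (simp add: arr_def eta_arr_def comp_fctr_def del: arr_src arr_tgt)

lemma eta_arr_natural:
  assumes "arr B f"
  shows "eta_arr (tgt f) \<star>\<^bsub>B\<^esub> fmap F (fmap F f) = fmap F f \<star>\<^bsub>B\<^esub> eta_arr (src f)"
proof -
  have "\<eta> (tgt f) \<cdot>\<^bsub>B\<^esub> on_mor F (on_mor F (mor f)) = on_mor F (mor f) \<cdot>\<^bsub>B\<^esub> \<eta> (src f)"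
    using assoc assms unfolding associative_transformation_def natural_transformation_def arr_def
    by (simp add: comp_fctr_def)
  thus ?thesis by (simp add: acmp_def eta_arr_def fmap_def)
qed

lemma eta_arr_assoc:
  "X \<in> obj B \<Longrightarrow> eta_arr X \<star>\<^bsub>B\<^esub> fmap F (eta_arr X) = eta_arr X \<star>\<^bsub>B\<^esub> eta_arr (on_obj F X)"
  using assoc unfolding associative_transformation_def by (simp add: acmp_def eta_arr_def fmap_def)

lemma obj_A_iff:
  "P \<in> obj A \<longleftrightarrow> fst P \<in> obj B \<and> arr B (str P) \<and> str P \<star>\<^bsub>B\<^esub> fmap F (str P) = str P \<star>\<^bsub>B\<^esub> eta_arr (fst P)"
  by (cases P) (auto simp: eta_extension_def arr_def str_def eta_arr_def acmp_def fmap_def simp del: arr_src arr_tgt)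

lemma obj_AD:
  assumes "P \<in> obj A"
  shows "fst P \<in> obj B" "arr B (str P)" "str P \<star>\<^bsub>B\<^esub> fmap F (str P) = str P \<star>\<^bsub>B\<^esub> eta_arr (fst P)"
  using assms unfolding obj_A_iff by blast+

lemma arr_A_iff:
  "arr A f \<longleftrightarrow> src f \<in> obj A \<and> tgt f \<in> obj A \<and> arr B (U f) \<and>
     U f \<star>\<^bsub>B\<^esub> str (src f) = str (tgt f) \<star>\<^bsub>B\<^esub> fmap F (U f)"
proof -
  have "mor f \<in> homs A (src f) (tgt f) \<longleftrightarrow>
      mor f \<in> homs B (fst (src f)) (fst (tgt f)) \<and> mor f \<cdot>\<^bsub>B\<^esub> snd (src f) = snd (tgt f) \<cdot>\<^bsub>B\<^esub> on_mor F (mor f)"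
    by (cases "src f"; cases "tgt f") (simp add: eta_extension_def)
  thus ?thesis
    using obj_AD(1)[of "src f"] obj_AD(1)[of "tgt f"]
    unfolding arr_def by (auto simp: acmp_def U_def str_def fmap_def simp del: arr_src arr_tgt)
qed

lemma arr_AD:
  assumes "arr A f"
  shows "src f \<in> obj A" "tgt f \<in> obj A" "arr B (U f)"
    "U f \<star>\<^bsub>B\<^esub> str (src f) = str (tgt f) \<star>\<^bsub>B\<^esub> fmap F (U f)"
    "fst (src f) \<in> obj B" "fst (tgt f) \<in> obj B" "arr B (str (src f))" "arr B (str (tgt f))"
  using assms obj_AD unfolding arr_A_iff by blast+

lemma arr_A_acmp:
  assumes f: "arr A f" and g: "arr A g" and t: "tgt f = src g"
  shows "arr A (g \<star>\<^bsub>A\<^esub> f)"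
  unfolding arr_A_iff
proof (intro conjI)
  note F = arr_AD[OF f] and G = arr_AD[OF g]
  have "U (g \<star>\<^bsub>A\<^esub> f) \<star>\<^bsub>B\<^esub> str (src f) = U g \<star>\<^bsub>B\<^esub> (U f \<star>\<^bsub>B\<^esub> str (src f))"
    using F(3,7) G(3) t by simp
  also have "\<dots> = (U g \<star>\<^bsub>B\<^esub> str (src g)) \<star>\<^bsub>B\<^esub> fmap F (U f)"
    unfolding F(4) using F(3,8) G(3) t by simp
  also have "\<dots> = str (tgt g) \<star>\<^bsub>B\<^esub> fmap F (U (g \<star>\<^bsub>A\<^esub> f))"
    unfolding G(4) using F(3) G(3,8) t by simp
  finally show "U (g \<star>\<^bsub>A\<^esub> f) \<star>\<^bsub>B\<^esub> str (src (g \<star>\<^bsub>A\<^esub> f)) = str (tgt (g \<star>\<^bsub>A\<^esub> f)) \<star>\<^bsub>B\<^esub> fmap F (U (g \<star>\<^bsub>A\<^esub> f))"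
    by simp
qed (use arr_AD[OF f] arr_AD[OF g] t in simp_all)

lemma arr_A_aid: "P \<in> obj A \<Longrightarrow> arr A (aid A P)"
  unfolding arr_A_iff using obj_AD[of P] by simp

lemma arr_A_azero: "\<lbrakk>P \<in> obj A; Q \<in> obj A\<rbrakk> \<Longrightarrow> arr A (azero A P Q)"
  unfolding arr_A_iff using obj_AD[of P] obj_AD[of Q] by simp

lemma arr_A_aplus:
  assumes f: "arr A f" and g: "arr A g" and t: "src g = src f" "tgt g = tgt f"
  shows "arr A (f \<boxplus>\<^bsub>A\<^esub> g)"
  unfolding arr_A_iff using arr_AD[OF f] arr_AD[OF g] t by simp

lemma fmap_aneg [simp]:
  assumes "arr B f"
  shows "fmap F (aneg B f) = aneg B (fmap F f)"
proof (rule aneg_unique)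
  have "fmap F f \<boxplus>\<^bsub>B\<^esub> fmap F (aneg B f) = fmap F (f \<boxplus>\<^bsub>B\<^esub> aneg B f)"
    using assms by (intro fmap_aplus[symmetric]) simp_all
  also have "\<dots> = azero B (src (fmap F f)) (tgt (fmap F f))" using assms by simp
  finally show "fmap F f \<boxplus>\<^bsub>B\<^esub> fmap F (aneg B f) = azero B (src (fmap F f)) (tgt (fmap F f))" .
qed (use assms in simp_all)

lemma arr_A_lftI:
  "\<lbrakk>P \<in> obj A; Q \<in> obj A; arr B u; src u = fst P; tgt u = fst Q; u \<star>\<^bsub>B\<^esub> str P = str Q \<star>\<^bsub>B\<^esub> fmap F u\<rbrakk>
     \<Longrightarrow> arr A (lft P u Q)"
  unfolding arr_A_iff by simp

lemma homs_A:
  assumes "X \<in> obj A" "Y \<in> obj A"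
  shows "f \<in> homs A X Y \<longleftrightarrow> arr A (Arrow X f Y)"
  using assms by (simp add: arr_def del: arr_src arr_tgt)

text \<open>Compatibility with structure morphisms is additive in the arrow because F is additive,
  so each hom-set is a subgroup of a hom group of B.\<close>

lemma comm_group_hom_A:
  assumes *: "X \<in> obj A" "Y \<in> obj A"
  shows "comm_group (hom_group A X Y)"
proof -
  let ?G = "hom_group B (fst X) (fst Y)"
  have o: "fst X \<in> obj B" "fst Y \<in> obj B" using * obj_AD by blast+
  interpret G: comm_group ?G using hom_comm_group o by blast
  have mo: "madd A = madd B" "zerom A X Y = zerom B (fst X) (fst Y)"
    by (cases X; cases Y; simp add: eta_extension_def)+
  have eq: "hom_group A X Y = ?G\<lparr>carrier := homs A X Y\<rparr>"
    by (simp add: hom_group_def mo)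
  have carr: "h \<in> carrier ?G \<longleftrightarrow> arr B (Arrow (fst X) h (fst Y))" for h
    using o by (simp add: hom_group_def arr_def del: arr_src arr_tgt)
  have UA: "U (Arrow X h Y) = Arrow (fst X) h (fst Y)" for h by (simp add: U_def)
  have sub: "subgroup (homs A X Y) ?G"
  proof
    show "homs A X Y \<subseteq> carrier ?G"
    proof
      fix h assume "h \<in> homs A X Y"
      hence "arr A (Arrow X h Y)" using homs_A[OF *] by blast
      hence "arr B (U (Arrow X h Y))" by (rule arr_AD)
      thus "h \<in> carrier ?G" using carr UA by simp
    qed
    fix x y assume "x \<in> homs A X Y" "y \<in> homs A X Y"
    hence "arr A (Arrow X x Y \<boxplus>\<^bsub>A\<^esub> Arrow X y Y)" using homs_A[OF *] by (intro arr_A_aplus) simp_all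
    thus "x \<otimes>\<^bsub>?G\<^esub> y \<in> homs A X Y" unfolding homs_A[OF *] by (simp add: hom_group_def aplus_def mo)
  next
    show "\<one>\<^bsub>?G\<^esub> \<in> homs A X Y"
      unfolding homs_A[OF *] using arr_A_azero[OF *] by (simp add: hom_group_def azero_def mo)
  next
    fix x assume "x \<in> homs A X Y"
    hence "arr A (Arrow X x Y)" using homs_A[OF *] by blast
    note D = arr_AD[OF this, unfolded UA, simplified]
    have "arr A (lft X (aneg B (Arrow (fst X) x (fst Y))) Y)"
    proof (rule arr_A_lftI[OF *])
      show "aneg B (Arrow (fst X) x (fst Y)) \<star>\<^bsub>B\<^esub> str X = str Y \<star>\<^bsub>B\<^esub> fmap F (aneg B (Arrow (fst X) x (fst Y)))"
        using D by simp
    qed (use D in simp_all)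
    thus "inv\<^bsub>?G\<^esub> x \<in> homs A X Y" unfolding homs_A[OF *] by (simp add: lft_def aneg_def)
  qed
  interpret H: group "?G\<lparr>carrier := homs A X Y\<rparr>" using subgroup.subgroup_is_group[OF sub G.is_group] .
  show "comm_group (hom_group A X Y)" unfolding eq
    by (rule H.group_comm_groupI) (use subgroup.subset[OF sub] G.m_comm in auto)
qed

sublocale A: preadditive_category A
proof (intro preadditive_category.intro category.intro preadditive_category_axioms.intro)
  fix X assume "X \<in> obj A"
  thus "idm A X \<in> homs A X X" using arr_A_aid by (simp add: homs_A aid_def)
next
  fix X Y Z f g assume *: "X \<in> obj A" "Y \<in> obj A" "Z \<in> obj A" "f \<in> homs A X Y" "g \<in> homs A Y Z"
  have "arr A (Arrow Y g Z \<star>\<^bsub>A\<^esub> Arrow X f Y)" using * by (intro arr_A_acmp) (simp_all add: homs_A)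
  thus "g \<cdot>\<^bsub>A\<^esub> f \<in> homs A X Z" using * by (simp add: homs_A acmp_def)
next
  fix X Y f assume *: "X \<in> obj A" "Y \<in> obj A" "f \<in> homs A X Y"
  hence a: "arr A (Arrow X f Y)" by (simp add: homs_A)
  note D = arr_AD[OF a]
  have "Arrow X f Y \<star>\<^bsub>A\<^esub> aid A X = Arrow X f Y"
    by (rule U_inject) (use D in simp_all)
  moreover have "aid A Y \<star>\<^bsub>A\<^esub> Arrow X f Y = Arrow X f Y"
    by (rule U_inject) (use D in simp_all)
  ultimately show "f \<cdot>\<^bsub>A\<^esub> idm A X = f" "idm A Y \<cdot>\<^bsub>A\<^esub> f = f" by (simp_all add: acmp_def aid_def)
next
  fix W X Y Z f g h
  assume *: "W \<in> obj A" "X \<in> obj A" "Y \<in> obj A" "Z \<in> obj A"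
    "f \<in> homs A W X" "g \<in> homs A X Y" "h \<in> homs A Y Z"
  hence a: "arr A (Arrow W f X)" "arr A (Arrow X g Y)" "arr A (Arrow Y h Z)" by (simp_all add: homs_A)
  have "Arrow Y h Z \<star>\<^bsub>A\<^esub> (Arrow X g Y \<star>\<^bsub>A\<^esub> Arrow W f X) = (Arrow Y h Z \<star>\<^bsub>A\<^esub> Arrow X g Y) \<star>\<^bsub>A\<^esub> Arrow W f X"
    by (rule U_inject) (use arr_AD(3)[OF a(1)] arr_AD(3)[OF a(2)] arr_AD(3)[OF a(3)] in simp_all)
  thus "h \<cdot>\<^bsub>A\<^esub> (g \<cdot>\<^bsub>A\<^esub> f) = (h \<cdot>\<^bsub>A\<^esub> g) \<cdot>\<^bsub>A\<^esub> f" by (simp add: acmp_def)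
next
  fix X Y assume "X \<in> obj A" "Y \<in> obj A"
  thus "comm_group (hom_group A X Y)" by (rule comm_group_hom_A)
next
  fix X Y Z f g g' assume *: "X \<in> obj A" "Y \<in> obj A" "Z \<in> obj A" "f \<in> homs A X Y" "g \<in> homs A Y Z" "g' \<in> homs A Y Z"
  hence a: "arr A (Arrow X f Y)" "arr A (Arrow Y g Z)" "arr A (Arrow Y g' Z)" by (simp_all add: homs_A)
  have "(Arrow Y g Z \<boxplus>\<^bsub>A\<^esub> Arrow Y g' Z) \<star>\<^bsub>A\<^esub> Arrow X f Y = (Arrow Y g Z \<star>\<^bsub>A\<^esub> Arrow X f Y) \<boxplus>\<^bsub>A\<^esub> (Arrow Y g' Z \<star>\<^bsub>A\<^esub> Arrow X f Y)"
    by (rule U_inject) (use arr_AD(3)[OF a(1)] arr_AD(3)[OF a(2)] arr_AD(3)[OF a(3)] in simp_all)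
  thus "madd A g g' \<cdot>\<^bsub>A\<^esub> f = madd A (g \<cdot>\<^bsub>A\<^esub> f) (g' \<cdot>\<^bsub>A\<^esub> f)" by (simp add: acmp_def aplus_def)
next
  fix X Y Z f f' g assume *: "X \<in> obj A" "Y \<in> obj A" "Z \<in> obj A" "f \<in> homs A X Y" "f' \<in> homs A X Y" "g \<in> homs A Y Z"
  hence a: "arr A (Arrow X f Y)" "arr A (Arrow X f' Y)" "arr A (Arrow Y g Z)" by (simp_all add: homs_A)
  have "Arrow Y g Z \<star>\<^bsub>A\<^esub> (Arrow X f Y \<boxplus>\<^bsub>A\<^esub> Arrow X f' Y) = (Arrow Y g Z \<star>\<^bsub>A\<^esub> Arrow X f Y) \<boxplus>\<^bsub>A\<^esub> (Arrow Y g Z \<star>\<^bsub>A\<^esub> Arrow X f' Y)"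
    by (rule U_inject) (use arr_AD(3)[OF a(1)] arr_AD(3)[OF a(2)] arr_AD(3)[OF a(3)] in simp_all)
  thus "g \<cdot>\<^bsub>A\<^esub> madd A f f' = madd A (g \<cdot>\<^bsub>A\<^esub> f) (g \<cdot>\<^bsub>A\<^esub> f')" by (simp add: acmp_def aplus_def)
qed

end

section \<open>Kernels, cokernels and biproducts created by the underlying functor\<close>

context eta_extension_data
begin

text \<open>The law for c may be tested after composition with the monic k, where it becomes the law
  for X together with naturality of \<eta>.\<close>

lemma monic_create:
  assumes X: "X \<in> obj A" and k: "monic B k" "tgt k = fst X"
    and c: "arr B c" "src c = on_obj F (src k)" "tgt c = src k" "k \<star>\<^bsub>B\<^esub> c = str X \<star>\<^bsub>B\<^esub> fmap F k"
  obtains K where "K \<in> obj A" "fst K = src k" "arr A (lft K k X)" "U (lft K k X) = k"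
proof -
  note O = obj_AD[OF X] note ka = monicD[OF k(1)]
  define K where "K = (src k, mor c)"
  have K: "fst K = src k" "str K = c" using c by (cases c, simp add: K_def str_def)+
  have "k \<star>\<^bsub>B\<^esub> (c \<star>\<^bsub>B\<^esub> fmap F c) = (str X \<star>\<^bsub>B\<^esub> fmap F k) \<star>\<^bsub>B\<^esub> fmap F c"
    using acmp_reassoc[OF c(4), of "fmap F c"] c(1-3) ka by simp
  also have "\<dots> = str X \<star>\<^bsub>B\<^esub> fmap F (k \<star>\<^bsub>B\<^esub> c)" using c(1-3) ka O(2) k(2) by simp
  also have "\<dots> = (str X \<star>\<^bsub>B\<^esub> fmap F (str X)) \<star>\<^bsub>B\<^esub> fmap F (fmap F k)"
    unfolding c(4) using c(1-3) ka O(1,2) k(2) by simp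
  also have "\<dots> = str X \<star>\<^bsub>B\<^esub> (eta_arr (tgt k) \<star>\<^bsub>B\<^esub> fmap F (fmap F k))"
    unfolding O(3) using c(1-3) ka O(1,2) k(2) by simp
  also have "\<dots> = (str X \<star>\<^bsub>B\<^esub> fmap F k) \<star>\<^bsub>B\<^esub> eta_arr (src k)"
    unfolding eta_arr_natural[OF ka] using ka O(1,2) k(2) by simp
  also have "\<dots> = k \<star>\<^bsub>B\<^esub> (c \<star>\<^bsub>B\<^esub> eta_arr (src k))" unfolding c(4)[symmetric] using c(1-3) ka by simp
  finally have "c \<star>\<^bsub>B\<^esub> fmap F c = c \<star>\<^bsub>B\<^esub> eta_arr (src k)"
    using monic_cancel[OF k(1), of "c \<star>\<^bsub>B\<^esub> fmap F c" "c \<star>\<^bsub>B\<^esub> eta_arr (src k)"] c(1-3) ka by simp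
  hence KA: "K \<in> obj A" unfolding obj_A_iff K using c ka by simp
  have "arr A (lft K k X)" using arr_A_lftI[OF KA X ka] K k c by simp
  thus ?thesis using that KA K k(2) by simp
qed

text \<open>Here the law for c is tested after precomposition with F (F e), which may be cancelled
  because F preserves epimorphisms.\<close>

lemma epic_create:
  assumes Y: "Y \<in> obj A" and e: "epic B e" "src e = fst Y"
    and c: "arr B c" "src c = on_obj F (tgt e)" "tgt c = tgt e" "c \<star>\<^bsub>B\<^esub> fmap F e = e \<star>\<^bsub>B\<^esub> str Y"
  obtains Q where "Q \<in> obj A" "fst Q = tgt e" "arr A (lft Y e Q)" "U (lft Y e Q) = e"
proof -
  note O = obj_AD[OF Y] note ea = epicD[OF e(1)]
  define Q where "Q = (tgt e, mor c)"
  have Q: "fst Q = tgt e" "str Q = c" using c by (cases c, simp add: Q_def str_def)+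
  have FF: "epic B (fmap F (fmap F e))" using fmap_epic e(1) by blast
  have "(c \<star>\<^bsub>B\<^esub> fmap F c) \<star>\<^bsub>B\<^esub> fmap F (fmap F e) = c \<star>\<^bsub>B\<^esub> fmap F (c \<star>\<^bsub>B\<^esub> fmap F e)"
    using c(1-3) ea by simp
  also have "\<dots> = c \<star>\<^bsub>B\<^esub> fmap F (e \<star>\<^bsub>B\<^esub> str Y)" unfolding c(4) ..
  also have "\<dots> = (c \<star>\<^bsub>B\<^esub> fmap F e) \<star>\<^bsub>B\<^esub> fmap F (str Y)"
    using c(1-3) ea e(2) O(2) by simp
  also have "\<dots> = e \<star>\<^bsub>B\<^esub> (str Y \<star>\<^bsub>B\<^esub> eta_arr (fst Y))"
    unfolding c(4) using ea e(2) O by simp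
  also have "\<dots> = (c \<star>\<^bsub>B\<^esub> fmap F e) \<star>\<^bsub>B\<^esub> eta_arr (src e)"
    unfolding c(4) using ea e(2) O(1,2) by simp
  also have "\<dots> = c \<star>\<^bsub>B\<^esub> (eta_arr (tgt e) \<star>\<^bsub>B\<^esub> fmap F (fmap F e))"
    unfolding eta_arr_natural[OF ea] using c(1-3) ea by simp
  also have "\<dots> = (c \<star>\<^bsub>B\<^esub> eta_arr (tgt e)) \<star>\<^bsub>B\<^esub> fmap F (fmap F e)" using c(1-3) ea by simp
  finally have "c \<star>\<^bsub>B\<^esub> fmap F c = c \<star>\<^bsub>B\<^esub> eta_arr (tgt e)"
    by (rule epic_cancel[OF FF]) (use c(1-3) ea in simp_all)
  hence QA: "Q \<in> obj A" unfolding obj_A_iff Q using c ea by simp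
  have "arr A (lft Y e Q)" using arr_A_lftI[OF Y QA ea] Q e c by simp
  thus ?thesis using that QA Q e(2) by simp
qed

text \<open>A factorization found in B needs no further compatibility: the square for u commutes
  once it commutes after the monic \<open>U m\<close>, and there it follows from the squares for t
  and m.\<close>

lemma lft_monic_factor:
  assumes t: "arr A t" and m: "arr A m" "monic B (U m)" "tgt t = tgt m"
    and u: "arr B u" "src u = fst (src t)" "tgt u = fst (src m)" "U m \<star>\<^bsub>B\<^esub> u = U t"
  shows "arr A (lft (src t) u (src m))" "m \<star>\<^bsub>A\<^esub> lft (src t) u (src m) = t"
proof -
  note T = arr_AD[OF t] and M = arr_AD[OF m(1)]
  have "U m \<star>\<^bsub>B\<^esub> (u \<star>\<^bsub>B\<^esub> str (src t)) = U t \<star>\<^bsub>B\<^esub> str (src t)"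
    using acmp_reassoc[OF u(4)] u(1-3) T(7) M(3) by simp
  also have "\<dots> = str (tgt t) \<star>\<^bsub>B\<^esub> fmap F (U m \<star>\<^bsub>B\<^esub> u)" unfolding T(4) u(4) ..
  also have "\<dots> = (str (tgt m) \<star>\<^bsub>B\<^esub> fmap F (U m)) \<star>\<^bsub>B\<^esub> fmap F u" using u(1-3) M(3,8) m(3) by simp
  also have "\<dots> = U m \<star>\<^bsub>B\<^esub> (str (src m) \<star>\<^bsub>B\<^esub> fmap F u)" unfolding M(4)[symmetric] using M(3,7) u(1-3) by simp
  finally have "u \<star>\<^bsub>B\<^esub> str (src t) = str (src m) \<star>\<^bsub>B\<^esub> fmap F u"
    by (rule monic_cancel[OF m(2)]) (use u(1-3) T(7) M(7) in simp_all)
  thus "arr A (lft (src t) u (src m))" using arr_A_lftI[OF T(1) M(1) u(1-3)] by simp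
  show "m \<star>\<^bsub>A\<^esub> lft (src t) u (src m) = t" by (rule U_inject) (use u m(3) in simp_all)
qed

lemma lft_epic_factor:
  assumes t: "arr A t" and e: "arr A e" "epic B (U e)" "src t = src e"
    and u: "arr B u" "src u = fst (tgt e)" "tgt u = fst (tgt t)" "u \<star>\<^bsub>B\<^esub> U e = U t"
  shows "arr A (lft (tgt e) u (tgt t))" "lft (tgt e) u (tgt t) \<star>\<^bsub>A\<^esub> e = t"
proof -
  note T = arr_AD[OF t] and M = arr_AD[OF e(1)]
  have "(u \<star>\<^bsub>B\<^esub> str (tgt e)) \<star>\<^bsub>B\<^esub> fmap F (U e) = u \<star>\<^bsub>B\<^esub> (U e \<star>\<^bsub>B\<^esub> str (src e))"
    unfolding M(4) using u(1-3) M(3,8) by simp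
  also have "\<dots> = U t \<star>\<^bsub>B\<^esub> str (src t)"
    using acmp_reassoc[OF u(4)] u(1-3) T(7) M(3) e(3) by simp
  also have "\<dots> = str (tgt t) \<star>\<^bsub>B\<^esub> fmap F (u \<star>\<^bsub>B\<^esub> U e)" unfolding T(4) u(4) ..
  also have "\<dots> = (str (tgt t) \<star>\<^bsub>B\<^esub> fmap F u) \<star>\<^bsub>B\<^esub> fmap F (U e)" using u(1-3) M(3) T(8) by simp
  finally have "u \<star>\<^bsub>B\<^esub> str (tgt e) = str (tgt t) \<star>\<^bsub>B\<^esub> fmap F u"
    by (rule epic_cancel[OF fmap_epic[OF e(2)]]) (use u(1-3) T(8) M(8) in simp_all)
  thus "arr A (lft (tgt e) u (tgt t))" using arr_A_lftI[OF M(2) T(2) u(1-3)] by simp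
  show "lft (tgt e) u (tgt t) \<star>\<^bsub>A\<^esub> e = t" by (rule U_inject) (use u e(3) in simp_all)
qed

lemma monic_A_reflect:
  assumes f: "arr A f" and m: "monic B (U f)"
  shows "monic A f"
  unfolding A.monic_iff
proof (intro conjI allI impI)
  fix u v assume *: "arr A u" "arr A v" "src u = src v" "tgt u = src f" "tgt v = src f" "f \<star>\<^bsub>A\<^esub> u = f \<star>\<^bsub>A\<^esub> v"
  have "U f \<star>\<^bsub>B\<^esub> U u = U f \<star>\<^bsub>B\<^esub> U v" using arg_cong[OF *(6), of U] by simp
  hence "U u = U v" by (rule monic_cancel[OF m]) (use * arr_AD(3) in simp_all)
  thus "u = v" by (rule U_inject) (use * in simp_all)
qed (rule f)

lemma epic_A_reflect:
  assumes f: "arr A f" and m: "epic B (U f)"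
  shows "epic A f"
  unfolding A.epic_iff
proof (intro conjI allI impI)
  fix u v assume *: "arr A u" "arr A v" "tgt u = tgt v" "src u = tgt f" "src v = tgt f" "u \<star>\<^bsub>A\<^esub> f = v \<star>\<^bsub>A\<^esub> f"
  have "U u \<star>\<^bsub>B\<^esub> U f = U v \<star>\<^bsub>B\<^esub> U f" using arg_cong[OF *(6), of U] by simp
  hence "U u = U v" by (rule epic_cancel[OF m]) (use * arr_AD(3) in simp_all)
  thus "u = v" by (rule U_inject) (use * in simp_all)
qed (rule f)

lemma ker_A_reflect:
  assumes f: "arr A f" and k: "arr A k" and t: "tgt k = src f" and K: "ker B (U f) (U k)"
  shows "ker A f k"
  unfolding A.ker_iff
proof (intro conjI allI impI)
  note D = kerD[OF K]
  show "monic A k" by (rule monic_A_reflect[OF k D(2)])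
  show "f \<star>\<^bsub>A\<^esub> k = azero A (src k) (tgt f)" by (rule U_inject) (use D in simp_all)
  fix s assume s: "arr A s" "tgt s = src f" "f \<star>\<^bsub>A\<^esub> s = azero A (src s) (tgt f)"
  have "U f \<star>\<^bsub>B\<^esub> U s = azero B (src (U s)) (tgt (U f))" using arg_cong[OF s(3), of U] by simp
  moreover have "tgt (U s) = src (U f)" using s(2) by simp
  ultimately obtain u where u: "arr B u" "src u = src (U s)" "tgt u = src (U k)" "U k \<star>\<^bsub>B\<^esub> u = U s"
    using ker_lift[OF K arr_AD(3)[OF s(1)]] by blast
  have ts: "tgt s = tgt k" and u': "src u = fst (src s)" "tgt u = fst (src k)" using s(2) t u by simp_all
  note L = lft_monic_factor[OF s(1) k D(2) ts u(1) u' u(4)]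
  show "\<exists>u. arr A u \<and> src u = src s \<and> tgt u = src k \<and> k \<star>\<^bsub>A\<^esub> u = s"
    using L by (intro exI[of _ "lft (src s) u (src k)"]) simp
qed (use f t in simp_all)

lemma coker_A_reflect:
  assumes f: "arr A f" and c: "arr A c" and t: "src c = tgt f" and K: "coker B (U f) (U c)"
  shows "coker A f c"
  unfolding A.coker_iff
proof (intro conjI allI impI)
  note D = cokerD[OF K]
  show "epic A c" by (rule epic_A_reflect[OF c D(2)])
  show "c \<star>\<^bsub>A\<^esub> f = azero A (src f) (tgt c)" by (rule U_inject) (use D in simp_all)
  fix s assume s: "arr A s" "src s = tgt f" "s \<star>\<^bsub>A\<^esub> f = azero A (src f) (tgt s)"
  have "U s \<star>\<^bsub>B\<^esub> U f = azero B (src (U f)) (tgt (U s))" using arg_cong[OF s(3), of U] by simp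
  moreover have "src (U s) = tgt (U f)" using s(2) by simp
  ultimately obtain u where u: "arr B u" "src u = tgt (U c)" "tgt u = tgt (U s)" "u \<star>\<^bsub>B\<^esub> U c = U s"
    using coker_desc[OF K arr_AD(3)[OF s(1)]] by blast
  have ts: "src s = src c" and u': "src u = fst (tgt c)" "tgt u = fst (tgt s)" using s(2) t u by simp_all
  note L = lft_epic_factor[OF s(1) c D(2) ts u(1) u' u(4)]
  show "\<exists>u. arr A u \<and> src u = tgt c \<and> tgt u = tgt s \<and> u \<star>\<^bsub>A\<^esub> c = s"
    using L by (intro exI[of _ "lft (tgt c) u (tgt s)"]) simp
qed (use f t in simp_all)

lemma ex_ker_A:
  assumes f: "arr A f"
  obtains k where "ker A f k" "ker B (U f) (U k)" "arr A k"
proof -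
  note D = arr_AD[OF f]
  obtain k where k: "ker B (U f) k" using ex_ker[OF D(3)] by blast
  note K = kerD[OF k] note ka = monicD[OF K(2)]
  have tk: "tgt k = fst (src f)" using K by simp
  have s: "arr B (str (src f) \<star>\<^bsub>B\<^esub> fmap F k)" using D(7) ka tk by simp
  have "U f \<star>\<^bsub>B\<^esub> (str (src f) \<star>\<^bsub>B\<^esub> fmap F k) = str (tgt f) \<star>\<^bsub>B\<^esub> fmap F (U f \<star>\<^bsub>B\<^esub> k)"
    using acmp_reassoc[OF D(4), of "fmap F k"] D(3,7,8) ka tk by simp
  also have "\<dots> = azero B (src (str (src f) \<star>\<^bsub>B\<^esub> fmap F k)) (tgt (U f))"
    unfolding K(4) using D ka by simp
  finally obtain c where c: "arr B c" "src c = on_obj F (src k)" "tgt c = src k" "k \<star>\<^bsub>B\<^esub> c = str (src f) \<star>\<^bsub>B\<^esub> fmap F k"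
    using ker_lift[OF k s] by auto
  obtain P where P: "P \<in> obj A" "fst P = src k" "arr A (lft P k (src f))" "U (lft P k (src f)) = k"
    using monic_create[OF D(1) K(2) tk c] .
  show ?thesis using that[of "lft P k (src f)"] ker_A_reflect[OF f P(3)] P k by simp
qed

lemma ex_coker_A:
  assumes f: "arr A f"
  obtains c where "coker A f c" "coker B (U f) (U c)" "arr A c"
proof -
  note D = arr_AD[OF f]
  obtain e where e: "coker B (U f) e" using ex_coker[OF D(3)] by blast
  note K = cokerD[OF e] note ea = epicD[OF K(2)]
  have se: "src e = fst (tgt f)" using K by simp
  have s: "arr B (e \<star>\<^bsub>B\<^esub> str (tgt f))" using D(8) ea se by simp
  have "(e \<star>\<^bsub>B\<^esub> str (tgt f)) \<star>\<^bsub>B\<^esub> fmap F (U f) = e \<star>\<^bsub>B\<^esub> (U f \<star>\<^bsub>B\<^esub> str (src f))"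
    unfolding D(4) using D(3,7,8) ea se by simp
  also have "\<dots> = azero B (src (fmap F (U f))) (tgt (e \<star>\<^bsub>B\<^esub> str (tgt f)))"
    using acmp_reassoc[OF K(4), of "str (src f)"] D ea se by simp
  \<comment> \<open>The structure morphism descends along F e, which is a cokernel of
    \<open>fmap F (U f)\<close> by right exactness.\<close>
  finally obtain c where c: "arr B c" "src c = on_obj F (tgt e)" "tgt c = tgt e" "c \<star>\<^bsub>B\<^esub> fmap F e = e \<star>\<^bsub>B\<^esub> str (tgt f)"
    using coker_desc[OF fmap_coker[OF e] s] by auto
  obtain P where P: "P \<in> obj A" "fst P = tgt e" "arr A (lft (tgt f) e P)" "U (lft (tgt f) e P) = e"
    using epic_create[OF D(2) K(2) se c] .
  show ?thesis using that[of "lft (tgt f) e P"] coker_A_reflect[OF f P(3)] P e by simp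
qed

text \<open>Reflection is faithfulness. Preservation holds because the kernel constructed in the
  extension lies over a kernel in B, so if one vanishes the other does.\<close>

lemma monic_A_iff: "monic A f \<longleftrightarrow> arr A f \<and> monic B (U f)"
proof
  assume m: "monic A f"
  hence f: "arr A f" by simp
  obtain k where k: "ker A f k" "ker B (U f) (U k)" "arr A k" using ex_ker_A[OF f] .
  have "k = azero A (src k) (src f)" using A.monic_zeroD[OF m A.kerD(4)[OF k(1)] k(3)] A.kerD[OF k(1)] by simp
  hence "U k = azero B (src (U k)) (src (U f))" by (metis U_azero src_U)
  thus "arr A f \<and> monic B (U f)" using ker_zero_monic[OF k(2)] f by blast
qed (use monic_A_reflect in blast)

text \<open>For preservation, the cokernel c of an epic f is zero. Since \<open>U c\<close> is epic
  too, the identity of its target is zero, and an arrow of B with zero cokernel is epic.\<close>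

lemma epic_A_iff: "epic A f \<longleftrightarrow> arr A f \<and> epic B (U f)"
proof
  assume m: "epic A f"
  hence f: "arr A f" by simp
  obtain c where c: "coker A f c" "coker B (U f) (U c)" "arr A c" using ex_coker_A[OF f] .
  note D = cokerD[OF c(2)] and DA = arr_AD[OF c(3)]
  have "c = azero A (tgt f) (tgt c)" using A.epic_zeroD[OF m A.cokerD(4)[OF c(1)] c(3)] A.cokerD[OF c(1)] by simp
  hence "U c = azero B (fst (tgt f)) (fst (tgt c))" by (metis U_azero)
  hence "aid B (fst (tgt c)) \<star>\<^bsub>B\<^esub> U c = azero B (fst (tgt c)) (fst (tgt c)) \<star>\<^bsub>B\<^esub> U c"
    using DA D by simp
  hence "aid B (fst (tgt c)) = azero B (fst (tgt c)) (fst (tgt c))"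
    by (rule epic_cancel[OF D(2)]) (use DA in simp_all)
  hence "is_zero B (tgt (U c))" unfolding is_zero_iff using DA by simp
  thus "arr A f \<and> epic B (U f)" using coker_zero_epic[OF c(2)] f by blast
qed (use epic_A_reflect in blast)

lemma ex_biprod_A:
  assumes X: "X \<in> obj A" and Y: "Y \<in> obj A"
  obtains i j p q where "biprod A i j p q" "src i = X" "src j = Y"
proof -
  note OX = obj_AD[OF X] and OY = obj_AD[OF Y]
  obtain i j p q where b: "biprod B i j p q" and s: "src i = fst X" "src j = fst Y"
    using ex_biprod[OF OX(1) OY(1)] .
  note D = biprodD[OF b]
  \<comment> \<open>The diagonal structure morphism. By \<open>pa\<close> and \<open>qa\<close> both
    projections respect it, so its law can be checked component by component.\<close>
  define a where "a = i \<star>\<^bsub>B\<^esub> (str X \<star>\<^bsub>B\<^esub> fmap F p) \<boxplus>\<^bsub>B\<^esub> j \<star>\<^bsub>B\<^esub> (str Y \<star>\<^bsub>B\<^esub> fmap F q)"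
  have a: "arr B a" "src a = on_obj F (tgt i)" "tgt a = tgt i"
    using D(1-9) OX(2) OY(2) s by (simp_all add: a_def)
  define S where "S = (tgt i, mor a)"
  have S: "fst S = tgt i" "str S = a" using a by (cases a, simp add: S_def str_def)+
  have pa: "p \<star>\<^bsub>B\<^esub> a = str X \<star>\<^bsub>B\<^esub> fmap F p" and qa: "q \<star>\<^bsub>B\<^esub> a = str Y \<star>\<^bsub>B\<^esub> fmap F q"
    using D(1-9) OX(2) OY(2) s biprod_simps[OF b] by (simp_all add: a_def)
  have SA: "S \<in> obj A" unfolding obj_A_iff S
  proof (intro conjI)
    show "a \<star>\<^bsub>B\<^esub> fmap F a = a \<star>\<^bsub>B\<^esub> eta_arr (tgt i)"
    proof (rule biprod_ext_left[OF b])
      have "p \<star>\<^bsub>B\<^esub> (a \<star>\<^bsub>B\<^esub> fmap F a) = str X \<star>\<^bsub>B\<^esub> fmap F (p \<star>\<^bsub>B\<^esub> a)"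
        using acmp_reassoc[OF pa, of "fmap F a"] a D(1-9) OX(2) s by simp
      also have "\<dots> = (str X \<star>\<^bsub>B\<^esub> fmap F (str X)) \<star>\<^bsub>B\<^esub> fmap F (fmap F p)"
        unfolding pa using D(1-9) OX(1,2) s by simp
      also have "\<dots> = str X \<star>\<^bsub>B\<^esub> (eta_arr (tgt p) \<star>\<^bsub>B\<^esub> fmap F (fmap F p))"
        unfolding OX(3) using D(1-9) OX(1,2) s by simp
      also have "\<dots> = (p \<star>\<^bsub>B\<^esub> a) \<star>\<^bsub>B\<^esub> eta_arr (tgt i)"
        unfolding eta_arr_natural[OF D(3)] pa using D(1-9) OX(1,2) s by simp
      also have "\<dots> = p \<star>\<^bsub>B\<^esub> (a \<star>\<^bsub>B\<^esub> eta_arr (tgt i))" using a D(1-9) by simp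
      finally show "p \<star>\<^bsub>B\<^esub> (a \<star>\<^bsub>B\<^esub> fmap F a) = p \<star>\<^bsub>B\<^esub> (a \<star>\<^bsub>B\<^esub> eta_arr (tgt i))" .
      have "q \<star>\<^bsub>B\<^esub> (a \<star>\<^bsub>B\<^esub> fmap F a) = str Y \<star>\<^bsub>B\<^esub> fmap F (q \<star>\<^bsub>B\<^esub> a)"
        using acmp_reassoc[OF qa, of "fmap F a"] a D(1-9) OY(2) s by simp
      also have "\<dots> = (str Y \<star>\<^bsub>B\<^esub> fmap F (str Y)) \<star>\<^bsub>B\<^esub> fmap F (fmap F q)"
        unfolding qa using D(1-9) OY(1,2) s by simp
      also have "\<dots> = str Y \<star>\<^bsub>B\<^esub> (eta_arr (tgt q) \<star>\<^bsub>B\<^esub> fmap F (fmap F q))"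
        unfolding OY(3) using D(1-9) OY(1,2) s by simp
      also have "\<dots> = (q \<star>\<^bsub>B\<^esub> a) \<star>\<^bsub>B\<^esub> eta_arr (tgt i)"
        unfolding eta_arr_natural[OF D(4)] qa using D(1-9) OY(1,2) s by simp
      also have "\<dots> = q \<star>\<^bsub>B\<^esub> (a \<star>\<^bsub>B\<^esub> eta_arr (tgt i))" using a D(1-9) by simp
      finally show "q \<star>\<^bsub>B\<^esub> (a \<star>\<^bsub>B\<^esub> fmap F a) = q \<star>\<^bsub>B\<^esub> (a \<star>\<^bsub>B\<^esub> eta_arr (tgt i))" .
    qed (use a D(1-9) in simp_all)
  qed (use a D(1-9) in simp_all)
  have ai: "a \<star>\<^bsub>B\<^esub> fmap F i = i \<star>\<^bsub>B\<^esub> str X"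
  proof -
    have "fmap F p \<star>\<^bsub>B\<^esub> fmap F i = fmap F (p \<star>\<^bsub>B\<^esub> i)" "fmap F q \<star>\<^bsub>B\<^esub> fmap F i = fmap F (q \<star>\<^bsub>B\<^esub> i)"
      using D(1-9) by simp_all
    hence "fmap F p \<star>\<^bsub>B\<^esub> fmap F i = aid B (on_obj F (fst X))"
      "fmap F q \<star>\<^bsub>B\<^esub> fmap F i = azero B (on_obj F (fst X)) (on_obj F (fst Y))"
      unfolding D(10,13) using OX(1) OY(1) s by simp_all
    thus ?thesis using D(1-9) OX(1,2) OY(1,2) s by (simp add: a_def)
  qed
  have aj: "a \<star>\<^bsub>B\<^esub> fmap F j = j \<star>\<^bsub>B\<^esub> str Y"
  proof -
    have "fmap F p \<star>\<^bsub>B\<^esub> fmap F j = fmap F (p \<star>\<^bsub>B\<^esub> j)" "fmap F q \<star>\<^bsub>B\<^esub> fmap F j = fmap F (q \<star>\<^bsub>B\<^esub> j)"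
      using D(1-9) by simp_all
    hence "fmap F q \<star>\<^bsub>B\<^esub> fmap F j = aid B (on_obj F (fst Y))"
      "fmap F p \<star>\<^bsub>B\<^esub> fmap F j = azero B (on_obj F (fst Y)) (on_obj F (fst X))"
      unfolding D(11,12) using OX(1) OY(1) s by simp_all
    thus ?thesis using D(1-9) OX(1,2) OY(1,2) s by (simp add: a_def)
  qed
  have arrs: "arr A (lft X i S)" "arr A (lft Y j S)" "arr A (lft S p X)" "arr A (lft S q Y)"
    by (intro arr_A_lftI; use X Y SA S D(1-9) s ai aj pa qa in simp)+
  have Us: "U (lft X i S) = i" "U (lft Y j S) = j" "U (lft S p X) = p" "U (lft S q Y) = q"
    using S D(1-9) s by simp_all
  have "biprod A (lft X i S) (lft Y j S) (lft S p X) (lft S q Y)"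
    unfolding biprod_def src_lft tgt_lft
    by (intro conjI arrs refl U_inject) (use Us D S s in simp_all)
  thus ?thesis using that by simp
qed

sublocale A: abelian_category A
proof (intro abelian_category.intro A.preadditive_category_axioms abelian_category_axioms.intro)
  obtain Z where "is_zero B Z" using zero_exists by blast
  hence Z: "Z \<in> obj B" "aid B Z = azero B Z Z" unfolding is_zero_iff by blast+
  define P where "P = (Z, mor (azero B (on_obj F Z) Z))"
  have P: "fst P = Z" "str P = azero B (on_obj F Z) Z" by (simp_all add: P_def str_def azero_def)
  have PA: "P \<in> obj A" unfolding obj_A_iff P using Z by simp
  have "aid A P = azero A P P" by (rule U_inject) (use P Z in simp_all)
  thus "\<exists>Z. is_zero A Z" using A.is_zero_iff PA by blast
next
  fix X Y assume "X \<in> obj A" "Y \<in> obj A"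
  then obtain i j p q where "biprod A i j p q" "src i = X" "src j = Y" using ex_biprod_A by blast
  thus "\<exists>S i j p q. is_biproduct A X Y S i j p q" using A.biprod_is_biproduct by blast
next
  fix X Y f assume "X \<in> obj A" "Y \<in> obj A" "f \<in> homs A X Y"
  hence f: "arr A (Arrow X f Y)" using homs_A by blast
  show "\<exists>K k. is_kernel A X Y f K k" using ex_ker_A[OF f] unfolding ker_def arrow.sel by metis
  show "\<exists>Q c. is_cokernel A X Y f Q c" using ex_coker_A[OF f] unfolding coker_def arrow.sel by metis
next
  fix X Y f assume "is_mono A X Y f"
  hence m: "monic A (Arrow X f Y)" by (simp add: monic_def)
  obtain c where c: "coker A (Arrow X f Y) c" "coker B (U (Arrow X f Y)) (U c)" "arr A c" using ex_coker_A[OF A.monicD[OF m]] .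
  \<comment> \<open>In B the underlying monomorphism is the kernel of its cokernel, and this
    property is reflected.\<close>
  have "ker A c (Arrow X f Y)"
    using ker_A_reflect[OF c(3) A.monicD[OF m]] ker_of_coker[OF _ c(2)] m A.cokerD(3)[OF c(1)]
    unfolding monic_A_iff by simp
  thus "\<exists>Z g. is_kernel A Y Z g X f" unfolding ker_def arrow.sel by metis
next
  fix X Y f assume "is_epi A X Y f"
  hence m: "epic A (Arrow X f Y)" by (simp add: epic_def)
  obtain k where k: "ker A (Arrow X f Y) k" "ker B (U (Arrow X f Y)) (U k)" "arr A k" using ex_ker_A[OF A.epicD[OF m]] .
  have "coker A k (Arrow X f Y)"
    using coker_A_reflect[OF k(3) A.epicD[OF m]] coker_of_ker[OF _ k(2)] m A.kerD(3)[OF k(1)]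
    unfolding epic_A_iff by simp
  thus "\<exists>W g. is_cokernel A W X g Y f" unfolding coker_def arrow.sel by metis
qed

text \<open>The kernel property is known in B only for the constructed kernel k. Writing k as f
  after v makes lifts through \<open>U k\<close> into lifts through \<open>U f\<close>.\<close>

lemma U_ses:
  assumes "ses A f g"
  shows "ses B (U f) (U g)"
proof -
  note S = A.sesD[OF assms]
  obtain k where k: "ker A g k" "ker B (U g) (U k)" "arr A k" using ex_ker_A[OF S(5)] .
  note K = kerD[OF k(2)]
  obtain v where v: "arr A v" "src v = src k" "tgt v = src f" "f \<star>\<^bsub>A\<^esub> v = k"
    using A.ker_lift[OF S(1) k(3)] A.kerD[OF k(1)] by metis
  have Uv: "arr B (U v)" "arr B (U f)" "arr B (U g)" using arr_AD(3) v S(4,5) by blast+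
  have "ker B (U g) (U f)" unfolding ker_iff
  proof (intro conjI allI impI)
    show "monic B (U f)" using S(3) monic_A_iff by blast
    show "U g \<star>\<^bsub>B\<^esub> U f = azero B (src (U f)) (tgt (U g))" using arg_cong[OF S(7), of U] by simp
    fix t assume t: "arr B t" "tgt t = src (U g)" "U g \<star>\<^bsub>B\<^esub> t = azero B (src t) (tgt (U g))"
    obtain u where u: "arr B u" "src u = src t" "tgt u = src (U k)" "U k \<star>\<^bsub>B\<^esub> u = t" using ker_lift[OF k(2) t] .
    have fv: "U f \<star>\<^bsub>B\<^esub> U v = U k" using arg_cong[OF v(4), of U] by simp
    have "U f \<star>\<^bsub>B\<^esub> (U v \<star>\<^bsub>B\<^esub> u) = t"
      using acmp_reassoc[OF fv, of u] u Uv v(2,3) by simp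
    thus "\<exists>u. arr B u \<and> src u = src t \<and> tgt u = src (U f) \<and> U f \<star>\<^bsub>B\<^esub> u = t"
      using u v Uv by (intro exI[of _ "U v \<star>\<^bsub>B\<^esub> u"]) simp
  qed (use Uv S in simp_all)
  thus ?thesis unfolding ses_iff using S(2) epic_A_iff by blast
qed

end

section \<open>Free objects\<close>

locale eta_extension_enough_projectives = eta_extension_data +
  assumes proj_B: "enough_projectives B" and proj_A: "enough_projectives (eta_extension B F \<eta>)"
begin

sublocale abelian_category_enough_projectives B
  by unfold_locales (rule proj_B)

sublocale A: abelian_category_enough_projectives A
  by unfold_locales (rule proj_A)

text \<open>For 0 -> K -> P -> X -> 0 with P projective, L_1 F(X) is the kernel of F K -> F P. The
  proof chases a generalized element x of F K killed by F k: up to an epimorphism of its source it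
  lifts to w over F q, w is a cycle and hence a boundary, and q kills boundaries, so x = 0.\<close>

lemma L1_zero_presentation:
  assumes X: "X \<in> obj B" and z: "is_zero B (left_derived B B F 1 X)"
  obtains e k where "epic B e" "is_projective B (src e)" "tgt e = X" "ker B e k" "monic B (fmap F k)"
proof -
  let ?e = "res_aug B X" and ?d = "res_arr B X 0" and ?d1 = "res_arr B X (Suc 0)"
  obtain q k where q: "epic B q" "tgt q = src k" "?d = k \<star>\<^bsub>B\<^esub> q" "ker B ?e k"
    using resolution(3)[OF X] unfolding exact_iff by blast
  note K = kerD[OF q(4)] note s = epicD[OF q(1)] monicD[OF K(2)]
  have sq: "src q = res_obj B X (Suc 0)" using q(3) by (metis src_acmp src_res_arr)
  have "k \<star>\<^bsub>B\<^esub> (q \<star>\<^bsub>B\<^esub> ?d1) = azero B (src ?d1) (tgt k)"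
    using acmp_reassoc[OF q(3)[symmetric], of ?d1] s q(2) sq X K by simp
  hence qd: "q \<star>\<^bsub>B\<^esub> ?d1 = azero B (src ?d1) (tgt q)"
    using monic_zeroD[OF K(2), of "q \<star>\<^bsub>B\<^esub> ?d1"] s sq q(2) X by simp
  have Fd: "fmap F ?d = fmap F k \<star>\<^bsub>B\<^esub> fmap F q" unfolding q(3) using s q(2) by simp
  have dd: "fmap F ?d \<star>\<^bsub>B\<^esub> fmap F ?d1 = azero B (src (fmap F ?d1)) (tgt (fmap F ?d))"
    using fmap_acmp[of ?d1 ?d] X by simp
  \<comment> \<open>Degree 1 falls under the \<open>Suc\<close> clause of
    \<open>left_derived\<close>, so the homology is taken between the differentials of index 1 and
    0.\<close>
  have "left_derived B B F 1 X = homology B (src (fmap F ?d1)) (tgt (fmap F ?d1)) (tgt (fmap F ?d)) (mor (fmap F ?d1)) (mor (fmap F ?d))"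
    by (cases "proj_res B X") (simp add: left_derived_def fmap_def res_arr_def res_obj_def)
  hence ex: "exact B (fmap F ?d1) (fmap F ?d)" using homology_zero_exact[OF _ _ _ dd] z X by simp
  have "monic B (fmap F k)" unfolding monic_iff_zero
  proof (intro conjI allI impI)
    fix x assume x: "arr B x" "tgt x = src (fmap F k)" "fmap F k \<star>\<^bsub>B\<^esub> x = azero B (src x) (tgt (fmap F k))"
    have "tgt x = tgt (fmap F q)" using x(2) q(2) by simp
    then obtain d w where d: "epic B d" "tgt d = src x" "arr B w" "src w = src d" "tgt w = src (fmap F q)"
      "fmap F q \<star>\<^bsub>B\<^esub> w = x \<star>\<^bsub>B\<^esub> d" using epic_local_lift[OF fmap_epic[OF q(1)] x(1)] by metis
    note da = epicD[OF d(1)]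
    have "fmap F ?d \<star>\<^bsub>B\<^esub> w = fmap F k \<star>\<^bsub>B\<^esub> (x \<star>\<^bsub>B\<^esub> d)"
      unfolding Fd d(6)[symmetric] using s q(2) d(3-5) by simp
    also have "\<dots> = azero B (src w) (tgt (fmap F ?d))"
      using acmp_reassoc[OF x(3), of d] x(1,2) s da d(2,4) K q(3) X by simp
    finally obtain d' w' where d': "epic B d'" "tgt d' = src w" "arr B w'" "src w' = src d'"
      "tgt w' = src (fmap F ?d1)" "fmap F ?d1 \<star>\<^bsub>B\<^esub> w' = w \<star>\<^bsub>B\<^esub> d'"
      using exact_local_lift[OF ex d(3)] d(5) sq by auto
    note da' = epicD[OF d'(1)]
    have qd': "fmap F q \<star>\<^bsub>B\<^esub> fmap F ?d1 = azero B (src (fmap F ?d1)) (tgt (fmap F q))"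
      using fmap_acmp[of ?d1 q] qd s sq X by simp
    have "x \<star>\<^bsub>B\<^esub> (d \<star>\<^bsub>B\<^esub> d') = (fmap F q \<star>\<^bsub>B\<^esub> w) \<star>\<^bsub>B\<^esub> d'"
      unfolding d(6) using x(1) da da' d(2,4) d'(2) by simp
    also have "\<dots> = fmap F q \<star>\<^bsub>B\<^esub> (fmap F ?d1 \<star>\<^bsub>B\<^esub> w')"
      unfolding d'(6) using s d(3-5) da' d'(2) by simp
    also have "\<dots> = azero B (src d') (tgt x)"
      using acmp_reassoc[OF qd', of w'] s sq X d'(3-5) x(2) q(2) by simp
    finally show "x = azero B (src x) (src (fmap F k))"
      using epic_zeroD[OF epic_acmp[OF d'(1) d(1)], of x] x(1,2) d(2,4) d'(2) by simp
  qed (use s in simp)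
  thus ?thesis using that[of ?e k] resolution(1)[OF X, of 0] resolution(2)[OF X] q(4) by simp
qed

text \<open>The object P is X + F X with structure morphism (0, 0; 1, eta); i is the unit of the adjunction
  between the free object functor and U.\<close>

definition free :: "'a \<Rightarrow> 'a \<times> 'b \<Rightarrow> ('a, 'b) arrow \<Rightarrow> ('a, 'b) arrow \<Rightarrow> ('a, 'b) arrow \<Rightarrow> ('a, 'b) arrow \<Rightarrow> bool" where
  "free X P i j p q \<longleftrightarrow> X \<in> obj B \<and> biprod B i j p q \<and> src i = X \<and> src j = on_obj F X \<and> P \<in> obj A \<and> fst P = tgt i \<and>
     str P = j \<star>\<^bsub>B\<^esub> (fmap F p \<boxplus>\<^bsub>B\<^esub> eta_arr X \<star>\<^bsub>B\<^esub> fmap F q)"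

lemma freeD:
  assumes "free X P i j p q"
  shows "X \<in> obj B" "biprod B i j p q" "src i = X" "src j = on_obj F X" "P \<in> obj A" "fst P = tgt i"
    "str P = j \<star>\<^bsub>B\<^esub> (fmap F p \<boxplus>\<^bsub>B\<^esub> eta_arr X \<star>\<^bsub>B\<^esub> fmap F q)"
  using assms unfolding free_def by blast+

lemma fmap_biprod:
  assumes "biprod B i j p q"
  shows "fmap F p \<star>\<^bsub>B\<^esub> fmap F i = aid B (on_obj F (src i))" "fmap F q \<star>\<^bsub>B\<^esub> fmap F j = aid B (on_obj F (src j))"
    "fmap F p \<star>\<^bsub>B\<^esub> fmap F j = azero B (on_obj F (src j)) (on_obj F (src i))"
    "fmap F q \<star>\<^bsub>B\<^esub> fmap F i = azero B (on_obj F (src i)) (on_obj F (src j))"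
  using biprodD[OF assms] fmap_acmp[of i p] fmap_acmp[of j q] fmap_acmp[of j p] fmap_acmp[of i q] by simp_all

lemma ex_free:
  assumes X: "X \<in> obj B"
  obtains P i j p q where "free X P i j p q"
proof -
  obtain i j p q where b: "biprod B i j p q" and s: "src i = X" "src j = on_obj F X"
    using ex_biprod[OF X F_obj[OF X]] .
  note D = biprodD[OF b] and FB = fmap_biprod[OF b]
  define m where "m = fmap F p \<boxplus>\<^bsub>B\<^esub> eta_arr X \<star>\<^bsub>B\<^esub> fmap F q"
  have m: "arr B m" "src m = on_obj F (tgt i)" "tgt m = on_obj F X" using D(1-9) s X by (simp_all add: m_def)
  define P where "P = (tgt i, mor (j \<star>\<^bsub>B\<^esub> m))"
  have jm: "arr B (j \<star>\<^bsub>B\<^esub> m)" using m D s by simp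
  have P: "fst P = tgt i" "str P = j \<star>\<^bsub>B\<^esub> m" using jm m D(5) by (simp_all add: P_def str_def acmp_def)
  \<comment> \<open>Because m composed with F j is the component of \<eta> at X, the law for j m
    reduces to associativity and naturality of \<eta>.\<close>
  have "m \<star>\<^bsub>B\<^esub> fmap F j = eta_arr X"
    using D(1-9) FB s X by (simp add: m_def)
  hence "m \<star>\<^bsub>B\<^esub> fmap F (j \<star>\<^bsub>B\<^esub> m) = eta_arr X \<star>\<^bsub>B\<^esub> fmap F m"
    using acmp_reassoc[of m "fmap F j" "eta_arr X" "fmap F m"] m D(1-9) s by simp
  also have "\<dots> = eta_arr X \<star>\<^bsub>B\<^esub> fmap F (fmap F p) \<boxplus>\<^bsub>B\<^esub> (eta_arr X \<star>\<^bsub>B\<^esub> fmap F (eta_arr X)) \<star>\<^bsub>B\<^esub> fmap F (fmap F q)"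
    using D(1-9) s X by (simp add: m_def)
  also have "\<dots> = eta_arr (tgt p) \<star>\<^bsub>B\<^esub> fmap F (fmap F p) \<boxplus>\<^bsub>B\<^esub> eta_arr X \<star>\<^bsub>B\<^esub> (eta_arr (tgt q) \<star>\<^bsub>B\<^esub> fmap F (fmap F q))"
    unfolding eta_arr_assoc[OF X] using D(1-9) s X by simp
  also have "\<dots> = m \<star>\<^bsub>B\<^esub> eta_arr (tgt i)"
    unfolding eta_arr_natural[OF D(3)] eta_arr_natural[OF D(4)] using D(1-9) s X by (simp add: m_def)
  finally have "(j \<star>\<^bsub>B\<^esub> m) \<star>\<^bsub>B\<^esub> fmap F (j \<star>\<^bsub>B\<^esub> m) = (j \<star>\<^bsub>B\<^esub> m) \<star>\<^bsub>B\<^esub> eta_arr (tgt i)"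
    using m D(1-9) s X arr_fmap[OF jm] by (simp del: fmap_acmp)
  hence "P \<in> obj A" unfolding obj_A_iff P using jm D by simp
  thus ?thesis using that[of P i j p q] b s P X unfolding free_def m_def by simp
qed

text \<open>The structure morphism carries F of the unit onto the summand F X. This is why a
  morphism out of the free object is determined by its component on X.\<close>

lemma free_str_unit:
  assumes fr: "free X P i j p q"
  shows "str P \<star>\<^bsub>B\<^esub> fmap F i = j"
proof -
  note R = freeD[OF fr] note D = biprodD[OF R(2)] and FB = fmap_biprod[OF R(2)]
  show ?thesis unfolding R(7) using D(1-9) FB R(1,3,4) by simp
qed

lemma free_component:
  assumes fr: "free X P i j p q" and b: "arr A b" "src b = P"
  shows "U b \<star>\<^bsub>B\<^esub> j = str (tgt b) \<star>\<^bsub>B\<^esub> fmap F (U b \<star>\<^bsub>B\<^esub> i)"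
proof -
  note R = freeD[OF fr] note D = biprodD[OF R(2)] and M = arr_AD[OF b(1)]
  have "U b \<star>\<^bsub>B\<^esub> j = (U b \<star>\<^bsub>B\<^esub> str (src b)) \<star>\<^bsub>B\<^esub> fmap F i"
    unfolding free_str_unit[OF fr, symmetric] using M(3,7) D(1-9) b(2) R(6) by simp
  also have "\<dots> = str (tgt b) \<star>\<^bsub>B\<^esub> fmap F (U b \<star>\<^bsub>B\<^esub> i)"
    unfolding M(4) using M(3,8) D(1-9) b(2) R(6) by simp
  finally show ?thesis .
qed

lemma free_unique:
  assumes fr: "free X P i j p q" and b: "arr A b" "src b = P" and c: "arr A c" "src c = P"
    and t: "tgt b = tgt c" and u: "U b \<star>\<^bsub>B\<^esub> i = U c \<star>\<^bsub>B\<^esub> i"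
  shows "b = c"
proof -
  note R = freeD[OF fr]
  have "U b = U c"
    by (rule biprod_ext_right[OF R(2)])
      (use b c t u R(6) arr_AD(3) free_component[OF fr b] free_component[OF fr c] in simp_all)
  thus ?thesis by (rule U_inject) (use b c t in simp_all)
qed

text \<open>The existence half of the adjunction. The component on F X is forced by
  \<open>free_component\<close>; that the resulting u respects the structure morphisms is the law of
  N combined with naturality of \<eta>.\<close>

lemma free_extend:
  assumes fr: "free X P i j p q" and N: "N \<in> obj A" and a: "arr B a" "src a = X" "tgt a = fst N"
  obtains b where "arr A b" "src b = P" "tgt b = N" "U b \<star>\<^bsub>B\<^esub> i = a" "U b \<star>\<^bsub>B\<^esub> j = str N \<star>\<^bsub>B\<^esub> fmap F a"
proof -
  note R = freeD[OF fr] note D = biprodD[OF R(2)] and ON = obj_AD[OF N] and OP = obj_AD[OF R(5)]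
  define g where "g = str N \<star>\<^bsub>B\<^esub> fmap F a"
  define u where "u = a \<star>\<^bsub>B\<^esub> p \<boxplus>\<^bsub>B\<^esub> g \<star>\<^bsub>B\<^esub> q"
  define m where "m = fmap F p \<boxplus>\<^bsub>B\<^esub> eta_arr X \<star>\<^bsub>B\<^esub> fmap F q"
  have g: "arr B g" "src g = on_obj F X" "tgt g = fst N" using ON a by (simp_all add: g_def)
  have u: "arr B u" "src u = fst P" "tgt u = fst N" using g a D(1-9) R(3,4,6) by (simp_all add: u_def)
  have ui: "u \<star>\<^bsub>B\<^esub> i = a" and uj: "u \<star>\<^bsub>B\<^esub> j = g" using g a D R(1,3,4) by (simp_all add: u_def)
  have m: "arr B m" "src m = on_obj F (tgt i)" "tgt m = on_obj F X" using D(1-9) R by (simp_all add: m_def)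
  have Pm: "str P = j \<star>\<^bsub>B\<^esub> m" using R(7) m_def by simp
  have "str N \<star>\<^bsub>B\<^esub> fmap F g = (str N \<star>\<^bsub>B\<^esub> fmap F (str N)) \<star>\<^bsub>B\<^esub> fmap F (fmap F a)"
    using ON(1,2) a by (simp add: g_def)
  also have "\<dots> = str N \<star>\<^bsub>B\<^esub> (eta_arr (tgt a) \<star>\<^bsub>B\<^esub> fmap F (fmap F a))"
    unfolding ON(3) using ON(1,2) a by simp
  also have "\<dots> = g \<star>\<^bsub>B\<^esub> eta_arr X"
    unfolding eta_arr_natural[OF a(1)] using ON(1,2) a R(1) by (simp add: g_def)
  finally have Ng: "str N \<star>\<^bsub>B\<^esub> fmap F g = g \<star>\<^bsub>B\<^esub> eta_arr X" .
  have "u \<star>\<^bsub>B\<^esub> str P = g \<star>\<^bsub>B\<^esub> m" unfolding Pm using acmp_reassoc[OF uj, of m] u m D(1-9) R(4,6) by simp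
  also have "\<dots> = g \<star>\<^bsub>B\<^esub> fmap F p \<boxplus>\<^bsub>B\<^esub> (g \<star>\<^bsub>B\<^esub> eta_arr X) \<star>\<^bsub>B\<^esub> fmap F q"
    using g D(1-9) R(1,3,4) by (simp add: m_def)
  also have "g \<star>\<^bsub>B\<^esub> fmap F p = str N \<star>\<^bsub>B\<^esub> fmap F (a \<star>\<^bsub>B\<^esub> p)"
    using ON(2) a D(1-9) R(3) by (simp add: g_def)
  also have "(g \<star>\<^bsub>B\<^esub> eta_arr X) \<star>\<^bsub>B\<^esub> fmap F q = str N \<star>\<^bsub>B\<^esub> fmap F (g \<star>\<^bsub>B\<^esub> q)"
    unfolding Ng[symmetric] using ON(2) g D(1-9) R(4) by simp
  also have "str N \<star>\<^bsub>B\<^esub> fmap F (a \<star>\<^bsub>B\<^esub> p) \<boxplus>\<^bsub>B\<^esub> str N \<star>\<^bsub>B\<^esub> fmap F (g \<star>\<^bsub>B\<^esub> q) = str N \<star>\<^bsub>B\<^esub> fmap F u"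
    using ON(2) g a D(1-9) R(3,4) by (simp add: u_def)
  finally have "u \<star>\<^bsub>B\<^esub> str P = str N \<star>\<^bsub>B\<^esub> fmap F u" .
  hence "arr A (lft P u N)" using arr_A_lftI[OF R(5) N u] by simp
  thus ?thesis using that[of "lft P u N"] u ui uj by (simp add: g_def)
qed

text \<open>The left adjoint of a functor that preserves epimorphisms preserves projectives: only
  the component on X has to be lifted, and \<open>free_unique\<close> settles the rest.\<close>

lemma free_projective:
  assumes fr: "free X P i j p q" and X: "is_projective B X"
  shows "is_projective A P"
proof (rule A.projectiveI)
  note R = freeD[OF fr] note D = biprodD[OF R(2)]
  show "P \<in> obj A" by (rule R)
  fix e f assume e: "epic A e" and f: "arr A f" "src f = P" "tgt f = tgt e"
  have eA: "arr A e" and eB: "epic B (U e)" using e epic_A_iff by blast+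
  note Ef = arr_AD[OF eA] and Ff = arr_AD[OF f(1)]
  obtain a where a: "arr B a" "src a = X" "tgt a = src (U e)" "U e \<star>\<^bsub>B\<^esub> a = U f \<star>\<^bsub>B\<^esub> i"
    using projective_lift[OF X eB, of "U f \<star>\<^bsub>B\<^esub> i"] Ff(3) D(1-9) R(3,6) f by auto
  have ta: "tgt a = fst (src e)" using a by simp
  obtain b where b: "arr A b" "src b = P" "tgt b = src e" "U b \<star>\<^bsub>B\<^esub> i = a"
    using free_extend[OF fr Ef(1) a(1,2) ta] by metis
  have "e \<star>\<^bsub>A\<^esub> b = f"
  proof (rule free_unique[OF fr])
    show "U (e \<star>\<^bsub>A\<^esub> b) \<star>\<^bsub>B\<^esub> i = U f \<star>\<^bsub>B\<^esub> i"
      using b Ef(3) arr_AD(3)[OF b(1)] D(1-9) R(6) a(4) by simp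
  qed (use b eA f in simp_all)
  thus "\<exists>h. arr A h \<and> src h = P \<and> tgt h = src e \<and> e \<star>\<^bsub>A\<^esub> h = f" using b by blast
qed

text \<open>The free functor on arrows, with underlying arrow the direct sum of u and F u. Both the
  injection and the projection equations are kept: epimorphisms are tested on the injections,
  monomorphisms and kernels on the projections.\<close>

lemma free_map:
  assumes fr: "free X P i j p q" and fr': "free X' P' i' j' p' q'" and u: "arr B u" "src u = X" "tgt u = X'"
  obtains b where "arr A b" "src b = P" "tgt b = P'" "U b \<star>\<^bsub>B\<^esub> i = i' \<star>\<^bsub>B\<^esub> u" "U b \<star>\<^bsub>B\<^esub> j = j' \<star>\<^bsub>B\<^esub> fmap F u"
    "p' \<star>\<^bsub>B\<^esub> U b = u \<star>\<^bsub>B\<^esub> p" "q' \<star>\<^bsub>B\<^esub> U b = fmap F u \<star>\<^bsub>B\<^esub> q"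
proof -
  note R = freeD[OF fr] note D = biprodD[OF R(2)]
  note R' = freeD[OF fr'] note D' = biprodD[OF R'(2)] note O' = obj_AD[OF R'(5)]
  have iu: "arr B (i' \<star>\<^bsub>B\<^esub> u)" "src (i' \<star>\<^bsub>B\<^esub> u) = X" "tgt (i' \<star>\<^bsub>B\<^esub> u) = fst P'"
    using u D'(1) R'(3,6) by simp_all
  obtain b where b: "arr A b" "src b = P" "tgt b = P'" "U b \<star>\<^bsub>B\<^esub> i = i' \<star>\<^bsub>B\<^esub> u"
    "U b \<star>\<^bsub>B\<^esub> j = str P' \<star>\<^bsub>B\<^esub> fmap F (i' \<star>\<^bsub>B\<^esub> u)"
    using free_extend[OF fr R'(5) iu] by metis
  have Ub: "arr B (U b)" "src (U b) = tgt i" "tgt (U b) = tgt i'" using arr_AD(3)[OF b(1)] b R(6) R'(6) by simp_all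
  have bj: "U b \<star>\<^bsub>B\<^esub> j = j' \<star>\<^bsub>B\<^esub> fmap F u"
    unfolding b(5) using acmp_reassoc[OF free_str_unit[OF fr'], of "fmap F u"] u D'(1) O'(2) R'(3,6) by simp
  note S = D(1-9) D'(1-9) R(1,3,4) R'(1,3,4) u Ub
  have "p' \<star>\<^bsub>B\<^esub> U b = u \<star>\<^bsub>B\<^esub> p"
    by (rule biprod_ext_right[OF R(2)]) (use S D(10-13) b(4) bj biprod_simps[OF R'(2)] in simp_all)
  moreover have "q' \<star>\<^bsub>B\<^esub> U b = fmap F u \<star>\<^bsub>B\<^esub> q"
    by (rule biprod_ext_right[OF R(2)]) (use S D(10-13) b(4) bj biprod_simps[OF R'(2)] in simp_all)
  ultimately show ?thesis using that[OF b(1-4) bj] by blast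
qed

text \<open>The underlying sequence is the direct sum of the sequence k, e and its image under F, so
  every exactness test splits into two components.\<close>

lemma free_ses:
  assumes frK: "free (src k) K ik jk pk qk" and frP: "free (tgt k) P ip jp pp qp" and frX: "free (tgt e) Q ix jx px qx"
    and s: "ses B k e" and m: "monic B (fmap F k)"
    and tk: "arr A tk" "src tk = K" "tgt tk = P" "U tk \<star>\<^bsub>B\<^esub> ik = ip \<star>\<^bsub>B\<^esub> k" "pp \<star>\<^bsub>B\<^esub> U tk = k \<star>\<^bsub>B\<^esub> pk"
      "qp \<star>\<^bsub>B\<^esub> U tk = fmap F k \<star>\<^bsub>B\<^esub> qk"
    and te: "arr A te" "src te = P" "tgt te = Q" "U te \<star>\<^bsub>B\<^esub> ip = ix \<star>\<^bsub>B\<^esub> e" "U te \<star>\<^bsub>B\<^esub> jp = jx \<star>\<^bsub>B\<^esub> fmap F e"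
      "px \<star>\<^bsub>B\<^esub> U te = e \<star>\<^bsub>B\<^esub> pp" "qx \<star>\<^bsub>B\<^esub> U te = fmap F e \<star>\<^bsub>B\<^esub> qp"
  shows "ses A tk te"
proof -
  note S = sesD[OF s]
  note RK = freeD[OF frK] note RP = freeD[OF frP] note RX = freeD[OF frX]
  note DK = biprodD[OF RK(2)] note DP = biprodD[OF RP(2)] note DX = biprodD[OF RX(2)]
  have Uk: "arr B (U tk)" "src (U tk) = tgt ik" "tgt (U tk) = tgt ip"
    using arr_AD(3)[OF tk(1)] tk RK(6) RP(6) by simp_all
  have Ue: "arr B (U te)" "src (U te) = tgt ip" "tgt (U te) = tgt ix"
    using arr_AD(3)[OF te(1)] te RP(6) RX(6) by simp_all
  have e: "epic B e" by (rule S)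
  have Fe: "epic B (fmap F e)" using fmap_epic[OF e] .
  \<comment> \<open>Right exactness supplies everything except monicity of F k, which is the
    assumption \<open>m\<close>.\<close>
  have "ses B (fmap F k) (fmap F e)"
    using fmap_ses[OF s] m exactD(3)[OF fmap_ses(1)[OF s]]
    unfolding ses_def short_exact_def exact_def monic_def epic_def by metis
  hence kF: "ker B (fmap F e) (fmap F k)" unfolding ses_iff by blast
  note T = DK(1-9) DP(1-9) DX(1-9) RK(3,4) RP(3,4) RX(3,4) Uk Ue S(4-6)
  have "ker B (U te) (U tk)" unfolding ker_iff
  proof (intro conjI allI impI)
    show "monic B (U tk)" unfolding monic_iff_zero
    proof (intro conjI allI impI)
      fix x assume x: "arr B x" "tgt x = src (U tk)" "U tk \<star>\<^bsub>B\<^esub> x = azero B (src x) (tgt (U tk))"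
      have "k \<star>\<^bsub>B\<^esub> (pk \<star>\<^bsub>B\<^esub> x) = pp \<star>\<^bsub>B\<^esub> (U tk \<star>\<^bsub>B\<^esub> x)"
        using acmp_reassoc[OF tk(5), of x] x(1,2) T by simp
      also have "\<dots> = azero B (src x) (tgt k)" unfolding x(3) using T x(1) by simp
      finally have 1: "pk \<star>\<^bsub>B\<^esub> x = azero B (src x) (src k)"
        using monic_zeroD[OF S(3), of "pk \<star>\<^bsub>B\<^esub> x"] T x(1,2) by simp
      have "fmap F k \<star>\<^bsub>B\<^esub> (qk \<star>\<^bsub>B\<^esub> x) = qp \<star>\<^bsub>B\<^esub> (U tk \<star>\<^bsub>B\<^esub> x)"
        using acmp_reassoc[OF tk(6), of x] x(1,2) T by simp
      also have "\<dots> = azero B (src x) (tgt (fmap F k))" unfolding x(3) using T x(1) by simp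
      finally have 2: "qk \<star>\<^bsub>B\<^esub> x = azero B (src x) (on_obj F (src k))"
        using monic_zeroD[OF m, of "qk \<star>\<^bsub>B\<^esub> x"] T x(1,2) by simp
      show "x = azero B (src x) (src (U tk))"
        by (rule biprod_ext_left[OF RK(2)]) (use 1 2 x(1,2) T in simp_all)
    qed (use Uk in simp)
    show "U te \<star>\<^bsub>B\<^esub> U tk = azero B (src (U tk)) (tgt (U te))"
    proof (rule biprod_ext_left[OF RX(2)])
      have "px \<star>\<^bsub>B\<^esub> (U te \<star>\<^bsub>B\<^esub> U tk) = (e \<star>\<^bsub>B\<^esub> k) \<star>\<^bsub>B\<^esub> pk"
        using acmp_reassoc[OF te(6), of "U tk"] tk(5) T by simp
      also have "\<dots> = px \<star>\<^bsub>B\<^esub> azero B (src (U tk)) (tgt (U te))" unfolding S(7) using T by simp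
      finally show "px \<star>\<^bsub>B\<^esub> (U te \<star>\<^bsub>B\<^esub> U tk) = px \<star>\<^bsub>B\<^esub> azero B (src (U tk)) (tgt (U te))" .
      have "qx \<star>\<^bsub>B\<^esub> (U te \<star>\<^bsub>B\<^esub> U tk) = (fmap F e \<star>\<^bsub>B\<^esub> fmap F k) \<star>\<^bsub>B\<^esub> qk"
        using acmp_reassoc[OF te(7), of "U tk"] tk(6) T by simp
      also have "\<dots> = qx \<star>\<^bsub>B\<^esub> azero B (src (U tk)) (tgt (U te))" unfolding kerD(4)[OF kF] using T by simp
      finally show "qx \<star>\<^bsub>B\<^esub> (U te \<star>\<^bsub>B\<^esub> U tk) = qx \<star>\<^bsub>B\<^esub> azero B (src (U tk)) (tgt (U te))" .
    qed (use T in simp_all)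
    fix x assume x: "arr B x" "tgt x = src (U te)" "U te \<star>\<^bsub>B\<^esub> x = azero B (src x) (tgt (U te))"
    have "e \<star>\<^bsub>B\<^esub> (pp \<star>\<^bsub>B\<^esub> x) = px \<star>\<^bsub>B\<^esub> (U te \<star>\<^bsub>B\<^esub> x)"
      using acmp_reassoc[OF te(6), of x] x(1,2) T by simp
    also have "\<dots> = azero B (src (pp \<star>\<^bsub>B\<^esub> x)) (tgt e)" unfolding x(3) using T x(1) by simp
    finally obtain a where a: "arr B a" "src a = src x" "tgt a = src k" "k \<star>\<^bsub>B\<^esub> a = pp \<star>\<^bsub>B\<^esub> x"
      using ker_lift[OF S(1), of "pp \<star>\<^bsub>B\<^esub> x"] T x(1,2) by auto
    have "fmap F e \<star>\<^bsub>B\<^esub> (qp \<star>\<^bsub>B\<^esub> x) = qx \<star>\<^bsub>B\<^esub> (U te \<star>\<^bsub>B\<^esub> x)"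
      using acmp_reassoc[OF te(7), of x] x(1,2) T by simp
    also have "\<dots> = azero B (src (qp \<star>\<^bsub>B\<^esub> x)) (tgt (fmap F e))" unfolding x(3) using T x(1) by simp
    finally obtain b where b: "arr B b" "src b = src x" "tgt b = on_obj F (src k)" "fmap F k \<star>\<^bsub>B\<^esub> b = qp \<star>\<^bsub>B\<^esub> x"
      using ker_lift[OF kF, of "qp \<star>\<^bsub>B\<^esub> x"] T x(1,2) by auto
    \<comment> \<open>The lift through \<open>U tk\<close> is assembled from the lifts a and b of
      the two components of x.\<close>
    define u where "u = ik \<star>\<^bsub>B\<^esub> a \<boxplus>\<^bsub>B\<^esub> jk \<star>\<^bsub>B\<^esub> b"
    have u: "arr B u" "src u = src x" "tgt u = src (U tk)" using a(1-3) b(1-3) T by (simp_all add: u_def)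
    have pu: "pk \<star>\<^bsub>B\<^esub> u = a" "qk \<star>\<^bsub>B\<^esub> u = b"
      using a(1-3) b(1-3) T biprod_simps[OF RK(2)] by (simp_all add: u_def)
    have "U tk \<star>\<^bsub>B\<^esub> u = x"
    proof (rule biprod_ext_left[OF RP(2)])
      show "pp \<star>\<^bsub>B\<^esub> (U tk \<star>\<^bsub>B\<^esub> u) = pp \<star>\<^bsub>B\<^esub> x"
        using acmp_reassoc[OF tk(5), of u] u pu a(4) T by simp
      show "qp \<star>\<^bsub>B\<^esub> (U tk \<star>\<^bsub>B\<^esub> u) = qp \<star>\<^bsub>B\<^esub> x"
        using acmp_reassoc[OF tk(6), of u] u pu b(4) T by simp
    qed (use u x T in simp_all)
    thus "\<exists>u. arr B u \<and> src u = src x \<and> tgt u = src (U tk) \<and> U tk \<star>\<^bsub>B\<^esub> u = x" using u by blast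
  qed (use T in simp_all)
  hence "ker A te tk" using ker_A_reflect[OF te(1) tk(1)] tk(3) te(2) by simp
  moreover have "epic B (U te)" unfolding epic_iff_zero
  proof (intro conjI allI impI)
    fix x assume x: "arr B x" "src x = tgt (U te)" "x \<star>\<^bsub>B\<^esub> U te = azero B (src (U te)) (tgt x)"
    have "(x \<star>\<^bsub>B\<^esub> ix) \<star>\<^bsub>B\<^esub> e = (x \<star>\<^bsub>B\<^esub> U te) \<star>\<^bsub>B\<^esub> ip" using te(4) x(1,2) T by simp
    also have "\<dots> = azero B (src e) (tgt x)" unfolding x(3) using T x(1) by simp
    finally have 1: "x \<star>\<^bsub>B\<^esub> ix = azero B (tgt e) (tgt x)"
      using epic_zeroD[OF e, of "x \<star>\<^bsub>B\<^esub> ix" "src e" "tgt x"] T x(1,2) by simp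
    have "(x \<star>\<^bsub>B\<^esub> jx) \<star>\<^bsub>B\<^esub> fmap F e = (x \<star>\<^bsub>B\<^esub> U te) \<star>\<^bsub>B\<^esub> jp" using te(5) x(1,2) T by simp
    also have "\<dots> = azero B (src (fmap F e)) (tgt x)" unfolding x(3) using T x(1) by simp
    finally have 2: "x \<star>\<^bsub>B\<^esub> jx = azero B (tgt (fmap F e)) (tgt x)"
      using epic_zeroD[OF Fe, of "x \<star>\<^bsub>B\<^esub> jx" "src (fmap F e)" "tgt x"] T x(1,2) by simp
    show "x = azero B (tgt (U te)) (tgt x)"
      by (rule biprod_ext_right[OF RX(2)]) (use 1 2 x(1,2) T in simp_all)
  qed (use Ue in simp)
  ultimately show ?thesis unfolding A.ses_iff using te(1) epic_A_iff by blast
qed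

section \<open>Ext out of free objects, special precovers and the transferred cotorsion pair\<close>

lemma ext_van_free:
  assumes fr: "free X Q ix jx px qx" and z: "is_zero B (left_derived B B F 1 X)" and N: "N \<in> obj A"
  shows "ext_van A 0 Q N \<longleftrightarrow> ext_van B 0 X (fst N)"
proof -
  note RX = freeD[OF fr]
  obtain e k where e: "epic B e" "is_projective B (src e)" "tgt e = X" "ker B e k" "monic B (fmap F k)"
    using L1_zero_presentation[OF RX(1) z] .
  have s: "ses B k e" unfolding ses_iff using e by blast
  note S = sesD[OF s]
  obtain K ik jk pk qk where frK: "free (src k) K ik jk pk qk" using ex_free[OF arr_src[OF S(4)]] .
  obtain P ip jp pp qp where frP: "free (tgt k) P ip jp pp qp" using ex_free[OF arr_tgt[OF S(4)]] .
  have frX: "free (tgt e) Q ix jx px qx" using fr e(3) by simp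
  obtain tk where tk: "arr A tk" "src tk = K" "tgt tk = P" "U tk \<star>\<^bsub>B\<^esub> ik = ip \<star>\<^bsub>B\<^esub> k" "U tk \<star>\<^bsub>B\<^esub> jk = jp \<star>\<^bsub>B\<^esub> fmap F k"
    "pp \<star>\<^bsub>B\<^esub> U tk = k \<star>\<^bsub>B\<^esub> pk" "qp \<star>\<^bsub>B\<^esub> U tk = fmap F k \<star>\<^bsub>B\<^esub> qk"
    using free_map[OF frK frP S(4) refl refl] .
  obtain te where te: "arr A te" "src te = P" "tgt te = Q" "U te \<star>\<^bsub>B\<^esub> ip = ix \<star>\<^bsub>B\<^esub> e" "U te \<star>\<^bsub>B\<^esub> jp = jx \<star>\<^bsub>B\<^esub> fmap F e"
    "px \<star>\<^bsub>B\<^esub> U te = e \<star>\<^bsub>B\<^esub> pp" "qx \<star>\<^bsub>B\<^esub> U te = fmap F e \<star>\<^bsub>B\<^esub> qp"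
    using free_map[OF frP frX S(5) S(6)[symmetric] refl] .
  have sA: "ses A tk te" using free_ses[OF frK frP frX s e(5) tk(1-4,6,7) te] .
  have pA: "is_projective A (src te)" using free_projective[OF frP] e(2) S(6) te(2) by simp
  have "ext_van A 0 Q N \<longleftrightarrow> A.extends tk N"
    using A.ext_van_iff_extends[OF freeD(5)[OF fr] A.sesD(2)[OF sA] pA A.sesD(1)[OF sA] te(3)] .
  \<comment> \<open>Arrows from K or P into N correspond to arrows from the source or target of k
    into \<open>fst N\<close> by restriction along the units. As \<open>tk\<close> commutes with the
    units, restriction along \<open>tk\<close> corresponds to restriction along k, and
    \<open>free_unique\<close> turns equality of restrictions into equality in the
    extension.\<close>
  also have "\<dots> \<longleftrightarrow> extends k (fst N)"
  proof
    note RK = freeD[OF frK] note RP = freeD[OF frP]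
    note DK = biprodD[OF RK(2)] note DP = biprodD[OF RP(2)]
    have Uk: "arr B (U tk)" "src (U tk) = tgt ik" "tgt (U tk) = tgt ip"
      using arr_AD(3)[OF tk(1)] tk RK(6) RP(6) by simp_all
    show "extends k (fst N)" if x: "A.extends tk N" unfolding extends_def
    proof (intro allI impI)
      fix f assume f: "arr B f" "src f = src k" "tgt f = fst N"
      obtain b where b: "arr A b" "src b = K" "tgt b = N" "U b \<star>\<^bsub>B\<^esub> ik = f" using free_extend[OF frK N f] by metis
      then obtain g where g: "arr A g" "src g = P" "tgt g = N" "g \<star>\<^bsub>A\<^esub> tk = b"
        using x tk(2,3) unfolding A.extends_def by metis
      have Ug: "arr B (U g)" "src (U g) = tgt ip" "tgt (U g) = fst N" using arr_AD(3)[OF g(1)] g RP(6) by simp_all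
      have gt: "U g \<star>\<^bsub>B\<^esub> U tk = U b" using arg_cong[OF g(4), of U] by simp
      have "(U g \<star>\<^bsub>B\<^esub> ip) \<star>\<^bsub>B\<^esub> k = U g \<star>\<^bsub>B\<^esub> (U tk \<star>\<^bsub>B\<^esub> ik)"
        unfolding tk(4) using Ug DP(1) S(4) RP(3) by simp
      also have "\<dots> = f" using acmp_reassoc[OF gt, of ik] Ug Uk DK(1) b(4) by simp
      finally show "\<exists>g. arr B g \<and> src g = tgt k \<and> tgt g = fst N \<and> g \<star>\<^bsub>B\<^esub> k = f"
        using Ug DP(1) RP(3) by (intro exI[of _ "U g \<star>\<^bsub>B\<^esub> ip"]) simp
    qed
    show "A.extends tk N" if x: "extends k (fst N)" unfolding A.extends_def
    proof (intro allI impI)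
      fix f assume f: "arr A f" "src f = src tk" "tgt f = N"
      have Uf: "arr B (U f)" "src (U f) = tgt ik" "tgt (U f) = fst N" using arr_AD(3)[OF f(1)] f tk RK(6) by simp_all
      have "arr B (U f \<star>\<^bsub>B\<^esub> ik)" "src (U f \<star>\<^bsub>B\<^esub> ik) = src k" "tgt (U f \<star>\<^bsub>B\<^esub> ik) = fst N" using Uf DK(1) RK(3) by simp_all
      then obtain g where g: "arr B g" "src g = tgt k" "tgt g = fst N" "g \<star>\<^bsub>B\<^esub> k = U f \<star>\<^bsub>B\<^esub> ik"
        using x unfolding extends_def by blast
      obtain b where b: "arr A b" "src b = P" "tgt b = N" "U b \<star>\<^bsub>B\<^esub> ip = g" using free_extend[OF frP N g(1-3)] by metis
      have Ub: "arr B (U b)" "src (U b) = tgt ip" using arr_AD(3)[OF b(1)] b RP(6) by simp_all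
      have "b \<star>\<^bsub>A\<^esub> tk = f"
      proof (rule free_unique[OF frK])
        have "U (b \<star>\<^bsub>A\<^esub> tk) \<star>\<^bsub>B\<^esub> ik = U b \<star>\<^bsub>B\<^esub> (ip \<star>\<^bsub>B\<^esub> k)" using Ub Uk DK(1) tk(4) by simp
        also have "\<dots> = U f \<star>\<^bsub>B\<^esub> ik" using acmp_reassoc[OF b(4), of k] Ub DP(1) RP(3) S(4) g(4) by simp
        finally show "U (b \<star>\<^bsub>A\<^esub> tk) \<star>\<^bsub>B\<^esub> ik = U f \<star>\<^bsub>B\<^esub> ik" .
      qed (use b tk f in simp_all)
      thus "\<exists>g. arr A g \<and> src g = tgt tk \<and> tgt g = N \<and> g \<star>\<^bsub>A\<^esub> tk = f" using b tk by auto
    qed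
  qed
  also have "\<dots> \<longleftrightarrow> ext_van B 0 X (fst N)"
    using ext_van_iff_extends[OF RX(1) e(1,2,4,3)] by simp
  finally show ?thesis .
qed

text \<open>The kernel of the morphism Q = X + F X to E extending x is the pullback of x and of a morphism
  from F X to E; since x is epic, it is an extension of F X by the kernel of x.\<close>

lemma ex_free_precover:
  assumes E: "E \<in> obj A" and s: "ses B y x" "tgt x = fst E"
  obtains Q i j p q c b n m where "free (src x) Q i j p q" "ses A c b" "src b = Q" "tgt b = E"
    "ses B n m" "src n = src y" "tgt n = fst (src c)" "tgt m = on_obj F (src x)"
proof -
  note S = sesD[OF s(1)]
  obtain Q i j p q where fr: "free (src x) Q i j p q" using ex_free[OF arr_src[OF S(5)]] .
  note R = freeD[OF fr] note D = biprodD[OF R(2)]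
  obtain b where b: "arr A b" "src b = Q" "tgt b = E" "U b \<star>\<^bsub>B\<^esub> i = x" using free_extend[OF fr E S(5) refl s(2)] by metis
  have Ub: "arr B (U b)" "src (U b) = tgt i" using arr_AD(3)[OF b(1)] b R(6) by simp_all
  have "epic B (U b)" using epic_left[of "U b" i] b(4) S(2) D(1) Ub by simp
  hence eb: "epic A b" using epic_A_iff b(1) by blast
  obtain c where c: "ker A b c" "ker B (U b) (U c)" "arr A c" using ex_ker_A[OF b(1)] .
  have pb: "pullback B x (aneg B (U b \<star>\<^bsub>B\<^esub> j)) (p \<star>\<^bsub>B\<^esub> U c) (q \<star>\<^bsub>B\<^esub> U c)"
    using biprod_ker_pullback[OF R(2) c(2) Ub(2)] b(4) by simp
  have eq: "epic B (q \<star>\<^bsub>B\<^esub> U c)" using pullback_epic[OF pb S(2)] .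
  obtain n where n: "ker B (q \<star>\<^bsub>B\<^esub> U c) n" "src n = src y" using pullback_ker[OF pb S(1)] by blast
  have "ses B n (q \<star>\<^bsub>B\<^esub> U c)" unfolding ses_iff using n eq by blast
  moreover have "tgt n = fst (src c)" using kerD(3)[OF n(1)] by simp
  moreover have "tgt (q \<star>\<^bsub>B\<^esub> U c) = on_obj F (src x)" using D R by simp
  moreover have "ses A c b" unfolding A.ses_iff using c(1) eb by blast
  ultimately show ?thesis using that fr b n by blast
qed

theorem U_preimage_cotorsion_pair:
  assumes inj: "enough_injectives A"
    and XY: "hereditary_complete_cotorsion_pair B X Y"
    and L1: "\<forall>M\<in>X. is_zero B (left_derived B B F 1 M)"
    and FX: "\<forall>M\<in>X. on_obj F M \<in> Y"
  shows "hereditary_complete_cotorsion_pair A (left_perp A (U_preimage B F \<eta> Y)) (U_preimage B F \<eta> Y)"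
proof -
  let ?R = "U_preimage B F \<eta> Y"
  \<comment> \<open>\<open>free\<close> is a relation, so S contains every free object over a member
    of X and no functorial choice is made; \<open>ex_free\<close> supplies at least one for
    each.\<close>
  define S where "S = {P. \<exists>M\<in>X. \<exists>i j p q. free M P i j p q}"
  have X: "X \<subseteq> obj B" and Yperp: "Y = right_perp B X"
    using XY unfolding hereditary_complete_cotorsion_pair_def cotorsion_pair_def by blast+
  have Yi: "N \<in> Y \<longleftrightarrow> N \<in> obj B \<and> (\<forall>M\<in>X. ext_van B 0 M N)" for N
    unfolding Yperp using in_right_perp_iff[OF X] .
  have her: "ext_van B n M N" if "M \<in> X" "N \<in> Y" for n M N
  proof -
    have "trivial_group (Ext B (Suc n) M N)"
      using XY that unfolding hereditary_complete_cotorsion_pair_def hereditary_pair_def by auto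
    thus ?thesis using trivial_Ext_iff X Yi that by blast
  qed
  have SA: "S \<subseteq> obj A" unfolding S_def using freeD(5) by blast
  have Ri: "N \<in> ?R \<longleftrightarrow> N \<in> obj A \<and> fst N \<in> Y" for N
    unfolding U_preimage_def by (cases N) simp
  have vS: "ext_van A 0 P N" if "P \<in> S" "N \<in> ?R" for P N
    using that ext_van_free L1 Ri her unfolding S_def by blast
  have R: "?R = right_perp A S"
  proof (intro equalityI subsetI)
    fix N assume "N \<in> ?R"
    thus "N \<in> right_perp A S" using vS A.in_right_perp_iff[OF SA] Ri by blast
  next
    fix N assume "N \<in> right_perp A S"
    hence N: "N \<in> obj A" and v: "\<And>P. P \<in> S \<Longrightarrow> ext_van A 0 P N" using A.in_right_perp_iff[OF SA] by blast+
    have "ext_van B 0 M (fst N)" if M: "M \<in> X" for M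
    proof -
      obtain P i j p q where fr: "free M P i j p q" using ex_free M X by blast
      hence "P \<in> S" unfolding S_def using M by blast
      thus ?thesis using ext_van_free[OF fr _ N] v L1 M by blast
    qed
    thus "N \<in> ?R" using Ri Yi N obj_AD(1) by blast
  qed
  show ?thesis
  proof (rule A.cotorsion_pair_criterion[OF inj SA R])
    fix f g assume s: "ses A f g" and f: "src f \<in> ?R" "tgt f \<in> ?R"
    have sB: "ses B (U f) (U g)" by (rule U_ses[OF s])
    have "src (U f) \<in> Y" "tgt (U f) \<in> Y" using f Ri by simp_all
    \<comment> \<open>Heredity enters here: Ext^2(M, -) vanishes on the subobject, so the vanishing
      of Ext^1(M, -) passes from the middle term to the quotient.\<close>
    hence "ext_van B 0 M (tgt (U g))" if "M \<in> X" for M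
      using ext_van_right[OF _ sB] her that X by blast
    hence "tgt (U g) \<in> Y" using Yi arr_tgt[OF sesD(5)[OF sB]] by blast
    thus "tgt g \<in> ?R" using Ri arr_tgt[OF A.sesD(5)[OF s]] by simp
  next
    fix E assume E: "E \<in> obj A"
    obtain M N y x where "N \<in> Y" "M \<in> X" "short_exact B N M (fst E) y x"
      using XY obj_AD(1)[OF E] unfolding hereditary_complete_cotorsion_pair_def complete_pair_def by blast
    hence s: "ses B (Arrow N y M) (Arrow M x (fst E))" by (simp add: ses_def)
    obtain Q i j p q c b n m where *: "free M Q i j p q" "ses A c b" "src b = Q" "tgt b = E"
      "ses B n m" "src n = N" "tgt n = fst (src c)" "tgt m = on_obj F M"
      by (rule ex_free_precover[OF E s arrow.sel(3), unfolded arrow.sel])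
    \<comment> \<open>The hypothesis on F enters here: the kernel of the precover has the subobject
      N and the quotient F M, both in Y.\<close>
    have "tgt n \<in> Y" unfolding Yperp
      by (rule right_perp_middle[OF X *(5)]) (use * FX \<open>N \<in> Y\<close> \<open>M \<in> X\<close> Yperp in simp_all)
    hence "src c \<in> ?R" using Ri *(7) arr_src[OF A.sesD(4)[OF *(2)]] by simp
    moreover have "Q \<in> S" unfolding S_def using * \<open>M \<in> X\<close> by blast
    hence "Q \<in> left_perp A ?R"
      using A.in_left_perp_iff[of ?R Q] vS SA Ri by blast
    ultimately show "\<exists>f g. ses A f g \<and> tgt g = E \<and> src f \<in> ?R \<and> tgt f \<in> left_perp A ?R"
      using *(2,3,4) A.sesD(6)[OF *(2)] by metis
  qed
qed

end

theorem theorem4p13: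
  fixes B :: "('o, 'm) precat" and F :: "('o, 'm, 'o, 'm) fctr" and \<eta> :: "'o \<Rightarrow> 'm"
    and \<X> \<Y> :: "'o set"
  assumes "abelian_category B"
    and "enough_projectives B" and "enough_injectives B"
    and "right_exact_functor B B F"
    and "associative_transformation B F \<eta>"
    and "enough_projectives (eta_extension B F \<eta>)" and "enough_injectives (eta_extension B F \<eta>)"
    and "image_nilpotent B F \<eta>"
    and "hereditary_complete_cotorsion_pair B \<X> \<Y>"
    and "\<forall>X\<in>\<X>. is_zero B (left_derived B B F 1 X)"
    and "\<forall>X\<in>\<X>. on_obj F X \<in> \<Y>"
  shows "hereditary_complete_cotorsion_pair (eta_extension B F \<eta>)
           (left_perp (eta_extension B F \<eta>) (U_preimage B F \<eta> \<Y>)) (U_preimage B F \<eta> \<Y>)"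
proof -
  interpret B: abelian_category B by fact
  interpret F: right_exact_functor B B F by fact
  interpret eta_extension_enough_projectives B F \<eta>
    by unfold_locales fact+
  show ?thesis using U_preimage_cotorsion_pair assms by blast
qed

end
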